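(* Let $\mathfrak g=\mathfrak{so}(8,\mathbb C)$, with parabolic subalgebra $\mathfrak q=\mathfrak l\oplus\mathfrak n$ of Heisenberg type, and let $E=\mathrm{span}_{\mathbb C}\{\omega_3(Y): Y\in V^-\}\subset \mathcal M(\mathbb C_{-d\chi})=\mathcal U(\mathfrak g)\otimes_{\mathcal U(\mathfrak q)}\mathbb C_{-d\chi}$. Then $E$ is a $\mathfrak q$-submodule of $\mathcal M(\mathbb C_{-d\chi})$ which is irreducible as an $\mathfrak l$-module and on which $\mathfrak n$ acts trivially, and there is a non-zero $\mathcal U(\mathfrak g)$-homomorphism from the generalized Verma module $\mathcal U(\mathfrak g)\otimes_{\mathcal U(\mathfrak q)}E$ to $\mathcal M(\mathbb C_{-d\chi})$, given by $$u\otimes\omega_3(Y)\mapsto u\cdot\omega_3(Y)\qquad(u\in\mathcal U(\mathfrak g),\ Y\in V^-).$$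
   Context: Lie algebra. $\mathfrak g=\mathfrak{so}(8,\mathbb C)$, $\mathfrak h$ a Cartan subalgebra, $\Delta$ the roots, $\Delta^+$ a positive system, $S$ the simple roots, $\gamma$ the highest root. $B_{\mathfrak g}$ is the positive multiple of the Killing form, and $(\cdot,\cdot)$ the induced form on $\mathfrak h^*$, for which root vectors $X_\alpha\in\mathfrak g_\alpha$ and $H_\alpha\in\mathfrak h$ ($\alpha\in\Delta$) can be and are chosen with: $\{X_{-\alpha},H_\alpha,X_\alpha\}$ an $\mathfrak{sl}(2)$-triple with $[X_\alpha,X_{-\alpha}]=H_\alpha$ for $\alpha\in\Delta^+$; $[H_\alpha,X_\beta]=\beta(H_\alpha)X_\beta$; $B_{\mathfrak g}(X_\alpha,X_{-\alpha})=1$, so $(\alpha,\alpha)=2$; $\beta(H_\alpha)=(\beta,\alpha)$. $\mathfrak q=\mathfrak l\oplus\mathfrak n$ is the standard parabolic subalgebra corresponding to $\{\alpha\in S:(\alpha,\gamma)=0\}$ (Heisenberg type), with Levi factor $\mathfrak l\supset\mathfrak h$ and nilradical $\mathfrak n$; $\bar{\mathfrak n}$ is the opposite nilradical. The decomposition of $\mathfrak g$ into eigenspaces of $\mathrm{ad}(H_\gamma)$ for the eigenvalues $-2,-1,0,1,2$ is $\mathfrak g=\mathfrak z(\bar{\mathfrak n})\oplus V^-\oplus\mathfrak l\oplus V^+\oplus\mathfrak z(\mathfrak n)$. $\Delta(V^+)$ is the set of roots $\alpha$ with $\mathfrak g_\alpha\subset V^+$. Generalized Verma module. $d\chi:\mathfrak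 q\to\mathbb C$ is the character with $[Z,X_\gamma]=d\chi(Z)X_\gamma$ for $Z\in\mathfrak l$ and $d\chi|_{\mathfrak n}=0$ (so $d\chi|_{\mathfrak h}=\gamma$). $\mathbb C_{-d\chi}$ is the one-dimensional $\mathfrak q$-module with character $-d\chi$, and $\mathcal M(\mathbb C_{-d\chi})=\mathcal U(\mathfrak g)\otimes_{\mathcal U(\mathfrak q)}\mathbb C_{-d\chi}$, identified as a vector space with $\mathcal U(\bar{\mathfrak n})\otimes\mathbb C_{-d\chi}$. Elements. For $\beta\in\Delta(V^+)$ put $\beta'=\gamma-\beta$, define $N_{\beta,\beta'}$ by $[X_\beta,X_{\beta'}]=N_{\beta,\beta'}X_\gamma$, and for $Z\in\mathfrak l$ define $M_{\alpha,\beta}(Z)$ by $[Z,X_\alpha]=\sum_{\beta\in\Delta(V^+)}M_{\alpha,\beta}(Z)X_\beta$. Let $u_2:\mathfrak l=[\mathfrak l,\mathfrak l]\oplus\mathbb CH_\gamma\to\mathcal U(\bar{\mathfrak n})$ be the linear map with $u_2(H_\gamma)=0$ and $$u_2(Z)=-\tfrac12\sum_{\alpha,\beta\in\Delta(V^+)}N_{\beta,\beta'}M_{\alpha,\beta'}(Z)X_{-\alpha}X_{-\beta}\quad(Z\in[\mathfrak l,\mathfrak l]).$$ For $Y\in V^-$, $\omega_3(Y)=\Big(\sum_{\epsilon\in\Delta(V^+)}X_{-\epsilon}\,u_2([X_\epsilon,Y])\Big)\otimes1\in\mathcal U(\bar{\mathfrak n})\otimes\mathbb C_{-d\chi}$.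 (Under the right-translation action $R$ of $\mathcal U(\bar{\mathfrak n})$ on smooth functions on the opposite nilpotent group, $\omega_3(Y)$ corresponds to the differential operator $\tilde\Omega_3(Y)=\sum_{\epsilon}R(X_{-\epsilon})\Omega_2([X_\epsilon,Y])$, with $\Omega_2(Z)=R(u_2(Z))$.) *)

theory Defs
  imports
    "HOL-Analysis.Determinants"
    "HOL-Algebra.Free_Abelian_Groups"
    "HOL-Library.Function_Algebras"
    "HOL-Library.Numeral_Type"
begin

section \<open>Complex Lie algebras\<close>

class complex_lie_algebra = ab_group_add +
  fixes cscale :: "complex \<Rightarrow> 'a \<Rightarrow> 'a"  (infixr \<open>*\<^sub>C\<close> 75)
    and lie :: "'a \<Rightarrow> 'a \<Rightarrow> 'a"
  assumes cscale_right_distrib: "a *\<^sub>C (x + y) = a *\<^sub>C x + a *\<^sub>C y"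
    and cscale_left_distrib: "(a + b) *\<^sub>C x = a *\<^sub>C x + b *\<^sub>C x"
    and cscale_cscale: "a *\<^sub>C b *\<^sub>C x = (a * b) *\<^sub>C x"
    and cscale_one: "1 *\<^sub>C x = x"
    and lie_add_left: "lie (x + y) z = lie x z + lie y z"
    and lie_add_right: "lie x (y + z) = lie x y + lie x z"
    and lie_cscale_left: "lie (a *\<^sub>C x) y = a *\<^sub>C lie x y"
    and lie_cscale_right: "lie x (a *\<^sub>C y) = a *\<^sub>C lie x y"
    and lie_self: "lie x x = 0"
    and jacobi: "lie x (lie y z) + lie y (lie z x) + lie z (lie x y) = 0"

global_interpretation cvs: vector_space "cscale :: complex \<Rightarrow> 'a \<Rightarrow> 'a::complex_lie_algebra"
  by standard
    (simp_all add: cscale_right_distrib cscale_left_distrib cscale_cscale cscale_one)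

definition derived_algebra :: "'a::complex_lie_algebra set \<Rightarrow> 'a set" where
  "derived_algebra L = cvs.span {lie x y | x y. x \<in> L \<and> y \<in> L}"

definition ad_eigenspace :: "'a::complex_lie_algebra \<Rightarrow> complex \<Rightarrow> 'a set" where
  "ad_eigenspace x c = {y. lie x y = c *\<^sub>C y}"

text \<open>The trace of an endomorphism of a finite-dimensional algebra, computed in some basis.\<close>

definition ctrace :: "('a \<Rightarrow> 'a::complex_lie_algebra) \<Rightarrow> complex" where
  "ctrace T = (let b = (SOME b. cvs.independent b \<and> cvs.span b = UNIV)
               in \<Sum>x\<in>b. cvs.representation b (T x) x)"

definition killing_form :: "'a::complex_lie_algebra \<Rightarrow> 'a \<Rightarrow> complex" where
  "killing_form x y = ctrace (\<lambda>z. lie x (lie y z))"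


section \<open>The Lie algebra \<open>so(8,\<complex>)\<close>\<close>

typedef so8 = "{A :: complex^8^8. transpose A = - A}"
  by (rule exI[of _ 0]) (simp add: transpose_def vec_eq_iff)

setup_lifting type_definition_so8

lemma transpose_plus: "transpose (A + B) = transpose A + transpose (B :: complex^'n^'m)"
  by (simp add: transpose_def vec_eq_iff)

lemma transpose_minus: "transpose (A - B) = transpose A - transpose (B :: complex^'n^'m)"
  by (simp add: transpose_def vec_eq_iff)

lemma transpose_uminus: "transpose (- A) = - transpose (A :: complex^'n^'m)"
  by (simp add: transpose_def vec_eq_iff)

lemma matrix_add_distrib_right: "(A + B) ** C = A ** C + B ** (C :: complex^'n^'m)"
  by (simp add: matrix_matrix_mult_def vec_eq_iff sum.distrib algebra_simps)

lemma matrix_diff_distrib_left: "A ** (B - C) = A ** B - A ** (C :: complex^'n^'m)"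
  by (simp add: matrix_matrix_mult_def vec_eq_iff sum_subtractf algebra_simps)

lemma matrix_diff_distrib_right: "(A - B) ** C = A ** C - B ** (C :: complex^'n^'m)"
  by (simp add: matrix_matrix_mult_def vec_eq_iff sum_subtractf algebra_simps)

lemma minus_matrix_mul_left: "(- A) ** B = - (A ** (B :: complex^'n^'m))"
  by (simp add: matrix_matrix_mult_def vec_eq_iff sum_negf)

lemma minus_matrix_mul_right: "A ** (- B) = - (A ** (B :: complex^'n^'m))"
  by (simp add: matrix_matrix_mult_def vec_eq_iff sum_negf)

instantiation so8 :: complex_lie_algebra
begin

lift_definition zero_so8 :: so8 is 0
  by (simp add: transpose_def vec_eq_iff)

lift_definition plus_so8 :: "so8 \<Rightarrow> so8 \<Rightarrow> so8" is "(+)"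
  by (simp add: transpose_plus)

lift_definition minus_so8 :: "so8 \<Rightarrow> so8 \<Rightarrow> so8" is "(-)"
  by (simp add: transpose_minus)

lift_definition uminus_so8 :: "so8 \<Rightarrow> so8" is "uminus"
  by (simp add: transpose_uminus)

lift_definition cscale_so8 :: "complex \<Rightarrow> so8 \<Rightarrow> so8" is "\<lambda>c A. \<chi> i j. c * A $ i $ j"
proof -
  fix c and A :: "complex^8^8"
  assume "transpose A = - A"
  moreover have "transpose (\<chi> i j. c * A $ i $ j) = (\<chi> i j. c * transpose A $ i $ j)"
    by (simp add: transpose_def)
  ultimately show "transpose (\<chi> i j. c * A $ i $ j) = - (\<chi> i j. c * A $ i $ j)"
    by (simp add: vec_eq_iff)
qed

lift_definition lie_so8 :: "so8 \<Rightarrow> so8 \<Rightarrow> so8" is "\<lambda>A B. A ** B - B ** A"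
  by (simp add: transpose_minus matrix_transpose_mul minus_matrix_mul_left minus_matrix_mul_right)

instance
proof
  fix x y z :: so8 and a b :: complex
  show "x + y + z = x + (y + z)" by transfer simp
  show "x + y = y + x" by transfer simp
  show "0 + x = x" by transfer simp
  show "- x + x = 0" by transfer simp
  show "x - y = x + - y" by transfer simp
  show "a *\<^sub>C (x + y) = a *\<^sub>C x + a *\<^sub>C y"
    by transfer (simp add: vec_eq_iff algebra_simps)
  show "(a + b) *\<^sub>C x = a *\<^sub>C x + b *\<^sub>C x"
    by transfer (simp add: vec_eq_iff algebra_simps)
  show "a *\<^sub>C b *\<^sub>C x = (a * b) *\<^sub>C x"
    by transfer (simp add: vec_eq_iff algebra_simps)
  show "1 *\<^sub>C x = x"
    by transfer (simp add: vec_eq_iff)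
  show "lie (x + y) z = lie x z + lie y z"
    by transfer (simp add: matrix_add_ldistrib matrix_add_distrib_right)
  show "lie x (y + z) = lie x y + lie x z"
    by transfer (simp add: matrix_add_ldistrib matrix_add_distrib_right)
  show "lie (a *\<^sub>C x) y = a *\<^sub>C lie x y"
    by transfer (simp add: matrix_matrix_mult_def vec_eq_iff sum_distrib_left algebra_simps)
  show "lie x (a *\<^sub>C y) = a *\<^sub>C lie x y"
    by transfer (simp add: matrix_matrix_mult_def vec_eq_iff sum_distrib_left algebra_simps)
  show "lie x x = 0" by transfer simp
  show "lie x (lie y z) + lie y (lie z x) + lie z (lie x y) = 0"
    by transfer (simp add: matrix_diff_distrib_left matrix_diff_distrib_right matrix_mul_assoc)
qed

end


section \<open>Cartan subalgebras, roots and parabolic subalgebras\<close>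

text \<open>For a semisimple complex Lie algebra: a maximal abelian subalgebra all of whose elements
  are diagonalizable in the adjoint representation.\<close>

definition cartan_subalgebra :: "'a::complex_lie_algebra set \<Rightarrow> bool" where
  "cartan_subalgebra h \<longleftrightarrow>
     cvs.subspace h \<and>
     (\<forall>x\<in>h. \<forall>y\<in>h. lie x y = 0) \<and>
     (\<forall>x. (\<forall>y\<in>h. lie y x = 0) \<longrightarrow> x \<in> h) \<and>
     (\<forall>x\<in>h. cvs.span (\<Union>c. ad_eigenspace x c) = UNIV)"

text \<open>Functionals on \<open>h\<close> are extended by zero outside \<open>h\<close>, so that they are determined by their
  values on \<open>h\<close> and are closed under pointwise \<open>+\<close> and \<open>-\<close>.\<close>

definition dual_space :: "'a::complex_lie_algebra set \<Rightarrow> ('a \<Rightarrow> complex) set" where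
  "dual_space h = {\<mu>. (\<forall>x\<in>h. \<forall>y\<in>h. \<mu> (x + y) = \<mu> x + \<mu> y) \<and>
                       (\<forall>c. \<forall>x\<in>h. \<mu> (c *\<^sub>C x) = c * \<mu> x) \<and>
                       (\<forall>x. x \<notin> h \<longrightarrow> \<mu> x = 0)}"

definition root_space :: "'a::complex_lie_algebra set \<Rightarrow> ('a \<Rightarrow> complex) \<Rightarrow> 'a set" where
  "root_space h \<alpha> = {x. \<forall>y\<in>h. lie y x = \<alpha> y *\<^sub>C x}"

definition roots :: "'a::complex_lie_algebra set \<Rightarrow> ('a \<Rightarrow> complex) set" where
  "roots h = {\<alpha> \<in> dual_space h. \<alpha> \<noteq> 0 \<and> root_space h \<alpha> \<noteq> {0}}"

definition positive_system :: "'a::complex_lie_algebra set \<Rightarrow> ('a \<Rightarrow> complex) set \<Rightarrow> bool" where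
  "positive_system h P \<longleftrightarrow>
     P \<subseteq> roots h \<and>
     (\<forall>\<alpha>\<in>roots h. \<alpha> \<in> P \<longleftrightarrow> - \<alpha> \<notin> P) \<and>
     (\<forall>\<alpha>\<in>P. \<forall>\<beta>\<in>P. \<alpha> + \<beta> \<in> roots h \<longrightarrow> \<alpha> + \<beta> \<in> P)"

definition simple_roots :: "('a \<Rightarrow> complex) set \<Rightarrow> ('a \<Rightarrow> complex) set" where
  "simple_roots P = {\<alpha> \<in> P. \<not> (\<exists>\<beta>\<in>P. \<exists>\<beta>'\<in>P. \<alpha> = \<beta> + \<beta>')}"

definition highest_root ::
  "'a::complex_lie_algebra set \<Rightarrow> ('a \<Rightarrow> complex) set \<Rightarrow> ('a \<Rightarrow> complex) \<Rightarrow> bool" where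
  "highest_root h P \<gamma> \<longleftrightarrow>
     \<gamma> \<in> roots h \<and>
     (\<forall>\<alpha>\<in>roots h. \<exists>k :: ('a \<Rightarrow> complex) \<Rightarrow> nat.
        \<gamma> - \<alpha> = (\<lambda>x. \<Sum>\<sigma>\<in>simple_roots P. of_nat (k \<sigma>) * \<sigma> x))"

text \<open>\<open>t \<mu>\<close> is the element of \<open>h\<close> that represents \<open>\<mu>\<close> with respect to \<open>B\<close>.\<close>

definition dual_form ::
  "('a::complex_lie_algebra \<Rightarrow> 'a \<Rightarrow> complex) \<Rightarrow> 'a set \<Rightarrow>
   ('a \<Rightarrow> complex) \<Rightarrow> ('a \<Rightarrow> complex) \<Rightarrow> complex" where
  "dual_form B h \<mu> \<nu> =
     (let t = (\<lambda>\<phi>. THE z. z \<in> h \<and> (\<forall>x\<in>h. B z x = \<phi> x)) in B (t \<mu>) (t \<nu>))"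

definition normalized_root_vectors ::
  "('a::complex_lie_algebra \<Rightarrow> 'a \<Rightarrow> complex) \<Rightarrow> 'a set \<Rightarrow> ('a \<Rightarrow> complex) set \<Rightarrow>
   (('a \<Rightarrow> complex) \<Rightarrow> 'a) \<Rightarrow> (('a \<Rightarrow> complex) \<Rightarrow> 'a) \<Rightarrow> bool" where
  "normalized_root_vectors B h P X H \<longleftrightarrow>
     (\<forall>\<alpha>\<in>roots h. X \<alpha> \<in> root_space h \<alpha> \<and> H \<alpha> \<in> h) \<and>
     (\<forall>\<alpha>\<in>P. lie (X \<alpha>) (X (- \<alpha>)) = H \<alpha> \<and>
             lie (H \<alpha>) (X \<alpha>) = 2 *\<^sub>C X \<alpha> \<and>
             lie (H \<alpha>) (X (- \<alpha>)) = (- 2) *\<^sub>C X (- \<alpha>)) \<and>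
     (\<forall>\<alpha>\<in>roots h. \<forall>\<beta>\<in>roots h. lie (H \<alpha>) (X \<beta>) = \<beta> (H \<alpha>) *\<^sub>C X \<beta>) \<and>
     (\<forall>\<alpha>\<in>roots h. B (X \<alpha>) (X (- \<alpha>)) = 1 \<and> dual_form B h \<alpha> \<alpha> = 2) \<and>
     (\<forall>\<alpha>\<in>roots h. \<forall>\<beta>\<in>roots h. \<beta> (H \<alpha>) = dual_form B h \<beta> \<alpha>)"

text \<open>The standard parabolic subalgebra corresponding to a set \<open>\<Theta>\<close> of simple roots: its Levi
  factor is spanned by \<open>h\<close> and the root spaces of the roots in the integer span of \<open>\<Theta>\<close>, its
  nilradical by the root spaces of the remaining positive roots.\<close>

definition levi_roots ::
  "'a::complex_lie_algebra set \<Rightarrow> ('a \<Rightarrow> complex) set \<Rightarrow> ('a \<Rightarrow> complex) set" where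
  "levi_roots h \<Theta> = {\<alpha> \<in> roots h. \<exists>k :: ('a \<Rightarrow> complex) \<Rightarrow> int.
                        \<alpha> = (\<lambda>x. \<Sum>\<sigma>\<in>\<Theta>. of_int (k \<sigma>) * \<sigma> x)}"

definition std_levi ::
  "'a::complex_lie_algebra set \<Rightarrow> ('a \<Rightarrow> complex) set \<Rightarrow> 'a set" where
  "std_levi h \<Theta> = cvs.span (h \<union> (\<Union>\<alpha>\<in>levi_roots h \<Theta>. root_space h \<alpha>))"

definition std_nilradical ::
  "'a::complex_lie_algebra set \<Rightarrow> ('a \<Rightarrow> complex) set \<Rightarrow> ('a \<Rightarrow> complex) set \<Rightarrow> 'a set" where
  "std_nilradical h P \<Theta> = cvs.span (\<Union>\<alpha>\<in>P - levi_roots h \<Theta>. root_space h \<alpha>)"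

definition std_parabolic ::
  "'a::complex_lie_algebra set \<Rightarrow> ('a \<Rightarrow> complex) set \<Rightarrow> ('a \<Rightarrow> complex) set \<Rightarrow> 'a set" where
  "std_parabolic h P \<Theta> = {x + y | x y. x \<in> std_levi h \<Theta> \<and> y \<in> std_nilradical h P \<Theta>}"


section \<open>The universal enveloping algebra\<close>

text \<open>\<open>'a word \<Rightarrow>\<^sub>0 complex\<close> is the free associative unital complex algebra on the set \<open>'a\<close>: the
  product of finitely supported functions is convolution over concatenation of words.\<close>

datatype 'a word = Word (letters: "'a list")

instantiation word :: (type) monoid_add
begin

definition zero_word :: "'a word" where "0 = Word []"
definition plus_word :: "'a word \<Rightarrow> 'a word \<Rightarrow> 'a word" where "v + w = Word (letters v @ letters w)"

instance
  by standard (simp_all add: zero_word_def plus_word_def)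

end

abbreviation letter :: "'a \<Rightarrow> 'a word \<Rightarrow>\<^sub>0 complex" where
  "letter x \<equiv> Poly_Mapping.single (Word [x]) 1"

abbreviation free_const :: "complex \<Rightarrow> 'a word \<Rightarrow>\<^sub>0 complex" where
  "free_const c \<equiv> Poly_Mapping.single 0 c"

text \<open>The two-sided ideal whose quotient is the enveloping algebra. The first two families of
  generators make \<open>letter\<close> complex linear, so that the quotient by them alone is the tensor
  algebra.\<close>

inductive_set uea_ideal :: "('a::complex_lie_algebra word \<Rightarrow>\<^sub>0 complex) set" where
  rel_add: "letter (x + y) - letter x - letter y \<in> uea_ideal"
| rel_cscale: "letter (c *\<^sub>C x) - free_const c * letter x \<in> uea_ideal"
| rel_lie: "letter x * letter y - letter y * letter x - letter (lie x y) \<in> uea_ideal"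
| ideal_add: "f \<in> uea_ideal \<Longrightarrow> g \<in> uea_ideal \<Longrightarrow> f + g \<in> uea_ideal"
| ideal_mult_left: "f \<in> uea_ideal \<Longrightarrow> g * f \<in> uea_ideal"
| ideal_mult_right: "f \<in> uea_ideal \<Longrightarrow> f * g \<in> uea_ideal"

lemma uea_ideal_zero: "0 \<in> uea_ideal"
  using ideal_mult_left[OF rel_add, of 0] by simp

lemma uea_ideal_uminus: "f \<in> uea_ideal \<Longrightarrow> - f \<in> uea_ideal"
  using ideal_mult_left[of f "- 1"] by simp

lemma uea_ideal_diff: "f \<in> uea_ideal \<Longrightarrow> g \<in> uea_ideal \<Longrightarrow> f - g \<in> uea_ideal"
  using ideal_add[OF _ uea_ideal_uminus] by fastforce

quotient_type (overloaded) 'a uea = "'a::complex_lie_algebra word \<Rightarrow>\<^sub>0 complex"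
  / "\<lambda>f g. f - g \<in> uea_ideal"
proof (rule equivpI)
  show "reflp (\<lambda>f g :: 'a word \<Rightarrow>\<^sub>0 complex. f - g \<in> uea_ideal)"
    by (simp add: reflp_def uea_ideal_zero)
  show "symp (\<lambda>f g :: 'a word \<Rightarrow>\<^sub>0 complex. f - g \<in> uea_ideal)"
    by (rule sympI) (metis minus_diff_eq uea_ideal_uminus)
  show "transp (\<lambda>f g :: 'a word \<Rightarrow>\<^sub>0 complex. f - g \<in> uea_ideal)"
  proof (rule transpI)
    fix f g k :: "'a word \<Rightarrow>\<^sub>0 complex"
    assume "f - g \<in> uea_ideal" "g - k \<in> uea_ideal"
    then have "(f - g) + (g - k) \<in> uea_ideal"
      by (rule ideal_add)
    then show "f - k \<in> uea_ideal"
      by simp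
  qed
qed

lemma word_zero_eq_plus: "0 = v + w \<longleftrightarrow> v = 0 \<and> w = (0 :: 'a word)"
  by (cases v; cases w) (auto simp: zero_word_def plus_word_def)

lemma lookup_mult_zero_word:
  fixes f g :: "'a word \<Rightarrow>\<^sub>0 complex"
  shows "Poly_Mapping.lookup (f * g) 0 = Poly_Mapping.lookup f 0 * Poly_Mapping.lookup g 0"
proof -
  have "(\<Sum>q. Poly_Mapping.lookup g q when 0 = l + q) = (Poly_Mapping.lookup g 0 when l = 0)" for l
    by (cases "l = 0") (simp_all add: word_zero_eq_plus)
  then show ?thesis
    by (simp add: lookup_mult mult_when)
qed

lemma letter_lookup_zero: "Poly_Mapping.lookup (letter x) 0 = 0"
  by (simp add: lookup_single when_def zero_word_def)

lemma lookup_uea_ideal: "f \<in> uea_ideal \<Longrightarrow> Poly_Mapping.lookup f 0 = 0"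
  by (induction rule: uea_ideal.induct)
    (simp_all add: lookup_mult_zero_word lookup_minus lookup_add letter_lookup_zero)

instantiation uea :: (complex_lie_algebra) ring_1
begin

lift_definition zero_uea :: "'a uea" is 0 .
lift_definition one_uea :: "'a uea" is 1 .
lift_definition plus_uea :: "'a uea \<Rightarrow> 'a uea \<Rightarrow> 'a uea" is "(+)"
  by (simp add: add_diff_add ideal_add)
lift_definition minus_uea :: "'a uea \<Rightarrow> 'a uea \<Rightarrow> 'a uea" is "(-)"
proof -
  fix f f' g g' :: "'a word \<Rightarrow>\<^sub>0 complex"
  assume "f - f' \<in> uea_ideal" "g - g' \<in> uea_ideal"
  then have "(f - f') - (g - g') \<in> uea_ideal"
    by (rule uea_ideal_diff)
  then show "(f - g) - (f' - g') \<in> uea_ideal"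
    by (simp add: algebra_simps)
qed
lift_definition uminus_uea :: "'a uea \<Rightarrow> 'a uea" is uminus
  by (simp only: minus_diff_minus uea_ideal_uminus)
lift_definition times_uea :: "'a uea \<Rightarrow> 'a uea \<Rightarrow> 'a uea" is "(*)"
proof -
  fix f f' g g' :: "'a word \<Rightarrow>\<^sub>0 complex"
  assume "f - f' \<in> uea_ideal" "g - g' \<in> uea_ideal"
  then have "(f - f') * g + f' * (g - g') \<in> uea_ideal"
    by (intro ideal_add ideal_mult_left ideal_mult_right)
  then show "f * g - f' * g' \<in> uea_ideal"
    by (simp add: algebra_simps)
qed

instance
proof
  fix u v w :: "'a uea"
  show "u + v + w = u + (v + w)" by transfer (simp add: add.assoc uea_ideal_zero)
  show "u + v = v + u" by transfer (simp add: add.commute uea_ideal_zero)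
  show "0 + u = u" by transfer (simp add: uea_ideal_zero)
  show "- u + u = 0" by transfer (simp add: uea_ideal_zero)
  show "u - v = u + - v" by transfer (simp add: uea_ideal_zero)
  show "u * v * w = u * (v * w)" by transfer (simp add: mult.assoc uea_ideal_zero)
  show "(u + v) * w = u * w + v * w" by transfer (simp add: distrib_right uea_ideal_zero)
  show "u * (v + w) = u * v + u * w" by transfer (simp add: distrib_left uea_ideal_zero)
  show "1 * u = u" by transfer (simp add: uea_ideal_zero)
  show "u * 1 = u" by transfer (simp add: uea_ideal_zero)
  show "(0 :: 'a uea) \<noteq> 1"
  proof (transfer, rule notI)
    assume "0 - 1 \<in> (uea_ideal :: ('a word \<Rightarrow>\<^sub>0 complex) set)"
    then have "Poly_Mapping.lookup (0 - 1 :: 'a word \<Rightarrow>\<^sub>0 complex) 0 = 0"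
      by (rule lookup_uea_ideal)
    then show False
      by (simp add: lookup_minus lookup_one)
  qed
qed

end

lift_definition uea_of :: "'a::complex_lie_algebra \<Rightarrow> 'a uea" is letter .

lift_definition uea_const :: "complex \<Rightarrow> 'a::complex_lie_algebra uea" is free_const .

text \<open>For a subalgebra \<open>L\<close>, the enveloping algebra of \<open>L\<close>, regarded (by the
  Poincare-Birkhoff-Witt theorem) as the subalgebra generated by \<open>L\<close>.\<close>

inductive_set uea_sub :: "'a::complex_lie_algebra set \<Rightarrow> 'a uea set" for L where
  sub_const: "uea_const c \<in> uea_sub L"
| sub_gen: "x \<in> L \<Longrightarrow> uea_of x \<in> uea_sub L"
| sub_add: "u \<in> uea_sub L \<Longrightarrow> v \<in> uea_sub L \<Longrightarrow> u + v \<in> uea_sub L"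
| sub_mult: "u \<in> uea_sub L \<Longrightarrow> v \<in> uea_sub L \<Longrightarrow> u * v \<in> uea_sub L"


section \<open>Modules and generalized Verma modules\<close>

text \<open>Left modules over a possibly noncommutative ring. As in \<^const>\<open>free_Abelian_group\<close>, the
  additive group is a \<^typ>\<open>'m monoid\<close>, so \<open>mult\<close> is the addition and \<open>one\<close> the zero vector.
  A module over a subring \<open>S\<close> uses \<open>lact\<close> only on \<open>S\<close>. Complex scalars act on a module over an
  enveloping algebra by \<^const>\<open>uea_const\<close>, Lie algebra elements by \<^const>\<open>uea_of\<close>.\<close>

record ('r, 'm) lmodule = "'m monoid" +
  lact :: "'r \<Rightarrow> 'm \<Rightarrow> 'm"

definition lmodule_hom ::
  "('r, 'm, 'x) lmodule_scheme \<Rightarrow> ('r, 'n, 'y) lmodule_scheme \<Rightarrow> ('m \<Rightarrow> 'n) set" where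
  "lmodule_hom M M' = {f \<in> hom M M'. \<forall>r. \<forall>m\<in>carrier M. f (lact M r m) = lact M' r (f m)}"

text \<open>Extension of scalars \<open>'r \<otimes>\<^bsub>S\<^esub> V\<close> of an \<open>S\<close>-module \<open>V\<close>, where \<open>S\<close> is a subring of \<open>'r\<close>: the
  free abelian group on \<open>'r \<times> V\<close> modulo the biadditivity and \<open>S\<close>-balancedness relations.\<close>

definition balanced_relations ::
  "'r::ring_1 set \<Rightarrow> ('r, 'm) lmodule \<Rightarrow> (('r \<times> 'm) \<Rightarrow>\<^sub>0 int) set" where
  "balanced_relations S V =
     {frag_of (u + u', v) - frag_of (u, v) - frag_of (u', v) | u u' v. v \<in> carrier V} \<union>
     {frag_of (u, v \<otimes>\<^bsub>V\<^esub> v') - frag_of (u, v) - frag_of (u, v') | u v v'.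
        v \<in> carrier V \<and> v' \<in> carrier V} \<union>
     {frag_of (u * s, v) - frag_of (u, lact V s v) | u s v. s \<in> S \<and> v \<in> carrier V}"

definition tensor_free :: "('r::ring_1, 'm) lmodule \<Rightarrow> (('r \<times> 'm) \<Rightarrow>\<^sub>0 int) monoid" where
  "tensor_free V = free_Abelian_group (UNIV \<times> carrier V)"

definition tensor_kernel ::
  "'r::ring_1 set \<Rightarrow> ('r, 'm) lmodule \<Rightarrow> (('r \<times> 'm) \<Rightarrow>\<^sub>0 int) set" where
  "tensor_kernel S V = generate (tensor_free V) (balanced_relations S V)"

definition tensor_elt ::
  "'r::ring_1 set \<Rightarrow> ('r, 'm) lmodule \<Rightarrow> 'r \<Rightarrow> 'm \<Rightarrow> (('r \<times> 'm) \<Rightarrow>\<^sub>0 int) set" where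
  "tensor_elt S V u v = tensor_kernel S V #>\<^bsub>tensor_free V\<^esub> frag_of (u, v)"

text \<open>The action \<open>u (r \<otimes> v) = (u r) \<otimes> v\<close>, computed on the representatives of a coset.\<close>

definition ext_scalars ::
  "'r::ring_1 set \<Rightarrow> ('r, 'm) lmodule \<Rightarrow> ('r, (('r \<times> 'm) \<Rightarrow>\<^sub>0 int) set) lmodule" where
  "ext_scalars S V =
     (let Q = tensor_free V Mod tensor_kernel S V in
      \<lparr>carrier = carrier Q, mult = mult Q, one = one Q,
       lact = (\<lambda>u t. \<Union>f\<in>t. tensor_kernel S V #>\<^bsub>tensor_free V\<^esub>
                            frag_extend (\<lambda>(r, v). frag_of (u * r, v)) f)\<rparr>)"

text \<open>The algebra homomorphism on the enveloping algebra of \<open>L\<close> extending a character of \<open>L\<close>; only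
  its values on \<^term>\<open>uea_sub L\<close> are determined.\<close>

definition character_ext ::
  "'a::complex_lie_algebra set \<Rightarrow> ('a \<Rightarrow> complex) \<Rightarrow> 'a uea \<Rightarrow> complex" where
  "character_ext L \<mu> = (SOME \<phi>. (\<forall>c. \<phi> (uea_const c) = c) \<and> (\<forall>x\<in>L. \<phi> (uea_of x) = \<mu> x) \<and>
     (\<forall>u\<in>uea_sub L. \<forall>v\<in>uea_sub L. \<phi> (u + v) = \<phi> u + \<phi> v \<and> \<phi> (u * v) = \<phi> u * \<phi> v))"

definition one_dim_module ::
  "'a::complex_lie_algebra set \<Rightarrow> ('a \<Rightarrow> complex) \<Rightarrow> ('a uea, complex) lmodule" where
  "one_dim_module L \<mu> =
     \<lparr>carrier = UNIV, mult = (+), one = 0, lact = (\<lambda>u z. character_ext L \<mu> u * z)\<rparr>"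

definition csubspace :: "('a::complex_lie_algebra uea, 'm) lmodule \<Rightarrow> 'm set \<Rightarrow> bool" where
  "csubspace M W \<longleftrightarrow> W \<subseteq> carrier M \<and> \<one>\<^bsub>M\<^esub> \<in> W \<and>
     (\<forall>v\<in>W. \<forall>w\<in>W. v \<otimes>\<^bsub>M\<^esub> w \<in> W) \<and> (\<forall>c. \<forall>w\<in>W. lact M (uea_const c) w \<in> W)"

definition cspan :: "('a::complex_lie_algebra uea, 'm) lmodule \<Rightarrow> 'm set \<Rightarrow> 'm set" where
  "cspan M A = \<Inter> {W. csubspace M W \<and> A \<subseteq> W}"

definition lie_submodule ::
  "'a::complex_lie_algebra set \<Rightarrow> ('a uea, 'm) lmodule \<Rightarrow> 'm set \<Rightarrow> bool" where
  "lie_submodule L M W \<longleftrightarrow> csubspace M W \<and> (\<forall>x\<in>L. \<forall>w\<in>W. lact M (uea_of x) w \<in> W)"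

definition lie_irreducible ::
  "'a::complex_lie_algebra set \<Rightarrow> ('a uea, 'm) lmodule \<Rightarrow> 'm set \<Rightarrow> bool" where
  "lie_irreducible L M E \<longleftrightarrow> lie_submodule L M E \<and> E \<noteq> {\<one>\<^bsub>M\<^esub>} \<and>
     (\<forall>W. W \<subseteq> E \<and> lie_submodule L M W \<longrightarrow> W = {\<one>\<^bsub>M\<^esub>} \<or> W = E)"

end

theory Submission
  imports Defs "HOL-Computational_Algebra.Fundamental_Theorem_Algebra"
begin

text \<open>
  The proof is an explicit computation in a basis of the vector representation. Elements of a Cartan
  subalgebra \<open>h\<close> of \<open>so(8)\<close> are simultaneously diagonalizable on \<open>\<complex>\<^sup>8\<close>, and weight vectors can be
  paired into a Witt basis \<open>v 1, \<dots>, v 4\<close>, \<open>v (- 1), \<dots>, v (- 4)\<close> in which \<open>h\<close> is the set of all diagonal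
  elements (\<open>witt_basis_exists\<close>). The roots are then the sums \<open>eps s + eps t\<close>, with root vectors
  \<open>wedge (v s) (v t)\<close> (\<open>roots_eq\<close>), and after a signed permutation of the basis the highest root is
  \<open>eps 1 + eps 2\<close> (\<open>relabelled_basis\<close>). Because the highest root is dominant, the parabolic subalgebra
  is the sum of the non-negative eigenspaces of \<open>ad (H \<gamma>)\<close> (\<open>levi_roots_eq\<close>, \<open>positive_outside_levi\<close>).
  Its Levi factor is \<open>gl(2) \<oplus> so(4)\<close>, where \<open>so(4)\<close> acts on the middle block \<open>mid\<close> spanned by the
  \<open>v s\<close> with \<open>s = 3, 4, - 3, - 4\<close>, and \<open>V\<^sup>-\<close> consists of two copies \<open>ua d\<close>, \<open>ub d\<close> of that block.

  The scalings of the root vectors cancel in the definition of \<open>u\<^sub>2\<close> (\<open>u2_formula\<close>), so \<open>\<omega>\<^sub>3(Y)\<close> can be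
  computed: up to a common non-zero factor, \<open>\<omega>\<^sub>3\<close> of the vectors \<open>ua d\<close> and \<open>ub d\<close> is \<open>uw d \<otimes> 1\<close> and
  \<open>uw' d \<otimes> 1\<close> (\<open>omega_eq\<close>). The principal symbols of \<open>uw d\<close>, \<open>uw' d\<close> are derivatives of the quartic
  \<open>A B - C\<^sup>2\<close>, where \<open>A\<close>, \<open>B\<close>, \<open>C\<close> are the entries of the Gram matrix of the two rows. They transform
  under the Levi factor as the semi-invariance of the quartic suggests (\<open>levi_uw\<close>, \<open>levi_uw'\<close>, \<open>ur_uw\<close>). The
  nilradical annihilates them modulo the annihilator \<open>J\<close> of the generator (\<open>ux_uw\<close>, \<open>uy_uw\<close>, and the
  rest by commutation with \<open>gl(2)\<close>); here the dimension four of the middle block and the value of the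
  character on the diagonal elements enter, and this is where \<open>so(8)\<close> is special. Hence \<open>E\<close> is
  \<open>q\<close>-stable with trivial action of \<open>n\<close>. The Levi factor moves any non-zero vector of \<open>E\<close> to any other
  by rotations of the middle block and by the two off-diagonal elements of \<open>gl(2)\<close> (\<open>irreducible_l\<close>).

  What remains is that \<open>E\<close> is not zero, which can be seen in a concrete module: the enveloping
  algebra acts on rational functions on the dual space of \<open>so(8)\<close> by derivations, and the function
  \<open>1 / X\<^sub>\<gamma>\<close> transforms under \<open>q\<close> by the character \<open>- d\<chi>\<close>. Evaluation of \<open>u (1 / X\<^sub>\<gamma>)\<close> at a point is
  therefore a well-defined functional of \<open>u \<otimes> 1\<close> (\<open>pairing_mult_sub\<close>), and at a suitable point it does
  not vanish on \<open>uw (v 3)\<close> (\<open>pairing_uw\<close>). The same function shows that the character of the enveloping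
  algebra of \<open>q\<close> extending \<open>- d\<chi>\<close> exists. The homomorphism of the theorem comes from the universal
  property of extension of scalars, and it is not zero because \<open>1 \<otimes> e\<close> goes to \<open>e\<close>.
\<close>

section \<open>Extension of scalars\<close>

locale scalar_extension =
  fixes S :: "'r::ring_1 set" and V :: "('r, 'm) lmodule"
  assumes mult_closed: "v \<in> carrier V \<Longrightarrow> v' \<in> carrier V \<Longrightarrow> v \<otimes>\<^bsub>V\<^esub> v' \<in> carrier V"
    and lact_closed: "s \<in> S \<Longrightarrow> v \<in> carrier V \<Longrightarrow> lact V s v \<in> carrier V"
begin

abbreviation F where "F \<equiv> tensor_free V"
abbreviation K where "K \<equiv> tensor_kernel S V"
abbreviation T where "T \<equiv> ext_scalars S V"
abbreviation shift :: "'r \<Rightarrow> (('r \<times> 'm) \<Rightarrow>\<^sub>0 int) \<Rightarrow> (('r \<times> 'm) \<Rightarrow>\<^sub>0 int)" where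
  "shift u \<equiv> frag_extend (\<lambda>(r, v). frag_of (u * r, v))"

lemma comm_group_F: "comm_group F"
  by (simp add: tensor_free_def abelian_free_Abelian_group)

lemma group_F: "group F"
  using comm_group_F by (rule comm_group.axioms)

lemma mult_F: "f \<otimes>\<^bsub>F\<^esub> g = f + g" and one_F: "\<one>\<^bsub>F\<^esub> = 0"
  and in_F: "f \<in> carrier F \<longleftrightarrow> Poly_Mapping.keys f \<subseteq> UNIV \<times> carrier V"
  by (simp_all add: tensor_free_def)

lemma inv_F: "f \<in> carrier F \<Longrightarrow> inv\<^bsub>F\<^esub> f = - f"
  by (simp add: tensor_free_def)

lemma frag_of_F: "v \<in> carrier V \<Longrightarrow> frag_of (u, v) \<in> carrier F"
  by (simp add: in_F)

lemma F_plus: "f \<in> carrier F \<Longrightarrow> g \<in> carrier F \<Longrightarrow> f + g \<in> carrier F"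
  using group.is_monoid[OF group_F] by (metis mult_F monoid.m_closed)

lemma F_minus: "f \<in> carrier F \<Longrightarrow> g \<in> carrier F \<Longrightarrow> f - g \<in> carrier F"
  by (metis F_plus add_uminus_conv_diff group.inv_closed group_F inv_F)

lemma relations_F: "balanced_relations S V \<subseteq> carrier F"
  by (auto simp: balanced_relations_def intro!: F_minus frag_of_F mult_closed lact_closed)

lemma normal_K: "K \<lhd> F"
  unfolding tensor_kernel_def
  by (rule comm_group.subgroup_imp_normal[OF comm_group_F])
    (rule group.generate_is_subgroup[OF group_F relations_F])

lemma comm_group_T: "comm_group T"
proof -
  have "comm_group (F Mod K)"
    by (rule comm_group.abelian_FactGroup[OF comm_group_F normal_imp_subgroup[OF normal_K]])
  then interpret Q: comm_group "F Mod K" .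
  have eqs: "carrier T = carrier (F Mod K)" "mult T = mult (F Mod K)" "\<one>\<^bsub>T\<^esub> = \<one>\<^bsub>F Mod K\<^esub>"
    by (simp_all only: ext_scalars_def Let_def lmodule.simps monoid.simps partial_object.simps)
  show ?thesis
    by (rule comm_groupI; unfold eqs)
      (erule (1) Q.m_closed, rule Q.one_closed, erule (2) Q.m_assoc, erule (1) Q.m_comm,
        erule Q.l_one, erule Q.l_inv_ex)
qed

lemma carrier_T: "carrier T = {K #>\<^bsub>F\<^esub> f | f. f \<in> carrier F}"
  by (auto simp: ext_scalars_def Let_def FactGroup_def RCOSETS_def)

lemma hom_proj: "(\<lambda>f. K #>\<^bsub>F\<^esub> f) \<in> hom F T"
  using normal.r_coset_hom_Mod[OF normal_K]
  by (auto simp: ext_scalars_def Let_def hom_def)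

lemma group_hom_proj: "group_hom F T (\<lambda>f. K #>\<^bsub>F\<^esub> f)"
  using hom_proj group_F comm_group_T by (simp add: group_hom_def group_hom_axioms_def comm_group_def)

lemma proj_add: "f \<in> carrier F \<Longrightarrow> g \<in> carrier F \<Longrightarrow> K #>\<^bsub>F\<^esub> (f + g) = (K #>\<^bsub>F\<^esub> f) \<otimes>\<^bsub>T\<^esub> (K #>\<^bsub>F\<^esub> g)"
  using hom_mult[OF hom_proj] by (simp add: mult_F)

lemma proj_0: "K #>\<^bsub>F\<^esub> 0 = \<one>\<^bsub>T\<^esub>"
  using group_hom.hom_one[OF group_hom_proj] by (simp add: one_F)

lemma proj_eq_one: "f \<in> carrier F \<Longrightarrow> K #>\<^bsub>F\<^esub> f = \<one>\<^bsub>T\<^esub> \<longleftrightarrow> f \<in> K"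
proof -
  have "\<one>\<^bsub>T\<^esub> = K" by (simp add: ext_scalars_def Let_def FactGroup_def)
  then show "f \<in> carrier F \<Longrightarrow> ?thesis"
    by (metis group.coset_join1 group_F normal_imp_subgroup[OF normal_K] subgroup.rcos_const
        subgroup.subset)
qed

lemma proj_eq_iff:
  assumes "f \<in> carrier F" "g \<in> carrier F"
  shows "K #>\<^bsub>F\<^esub> f = K #>\<^bsub>F\<^esub> g \<longleftrightarrow> f - g \<in> K"
proof -
  interpret T: comm_group T by (rule comm_group_T)
  have cl: "K #>\<^bsub>F\<^esub> f \<in> carrier T" "K #>\<^bsub>F\<^esub> g \<in> carrier T" "K #>\<^bsub>F\<^esub> (f - g) \<in> carrier T"
    using assms F_minus by (auto simp: carrier_T)
  have "K #>\<^bsub>F\<^esub> f = (K #>\<^bsub>F\<^esub> (f - g)) \<otimes>\<^bsub>T\<^esub> (K #>\<^bsub>F\<^esub> g)"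
    using proj_add[of "f - g" g] assms F_minus by simp
  then have "K #>\<^bsub>F\<^esub> f = K #>\<^bsub>F\<^esub> g \<longleftrightarrow> K #>\<^bsub>F\<^esub> (f - g) = \<one>\<^bsub>T\<^esub>"
    using cl by (metis T.l_one T.right_cancel T.one_closed)
  then show ?thesis using proj_eq_one F_minus assms by simp
qed

lemma tensor_elt_T: "v \<in> carrier V \<Longrightarrow> tensor_elt S V u v \<in> carrier T"
  using frag_of_F by (auto simp: tensor_elt_def carrier_T)

lemma relation_in_K: "f \<in> balanced_relations S V \<Longrightarrow> f \<in> K"
  by (simp add: tensor_kernel_def generate.incl)

lemma tensor_relation:
  assumes "f - g - g' \<in> balanced_relations S V" "f \<in> carrier F" "g \<in> carrier F" "g' \<in> carrier F"
  shows "K #>\<^bsub>F\<^esub> f = (K #>\<^bsub>F\<^esub> g) \<otimes>\<^bsub>T\<^esub> (K #>\<^bsub>F\<^esub> g')"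
proof -
  have "f - (g + g') \<in> K" using relation_in_K[OF assms(1)] by (simp add: diff_diff_eq)
  then have "K #>\<^bsub>F\<^esub> f = K #>\<^bsub>F\<^esub> (g + g')" using assms by (simp only: proj_eq_iff F_plus)
  then show ?thesis using assms by (simp only: proj_add)
qed

lemma tensor_add_left:
  "v \<in> carrier V \<Longrightarrow>
    tensor_elt S V (u + u') v = tensor_elt S V u v \<otimes>\<^bsub>T\<^esub> tensor_elt S V u' v"
  unfolding tensor_elt_def
  by (rule tensor_relation) (auto simp: balanced_relations_def frag_of_F)

lemma tensor_balanced:
  "s \<in> S \<Longrightarrow> v \<in> carrier V \<Longrightarrow> tensor_elt S V (u * s) v = tensor_elt S V u (lact V s v)"
  unfolding tensor_elt_def
  by (subst proj_eq_iff)
    (auto simp: frag_of_F lact_closed balanced_relations_def intro!: relation_in_K)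

lemma tensor_zero_left: "v \<in> carrier V \<Longrightarrow> tensor_elt S V 0 v = \<one>\<^bsub>T\<^esub>"
proof -
  interpret T: comm_group T by (rule comm_group_T)
  assume v: "v \<in> carrier V"
  show ?thesis
    using tensor_add_left[OF v, of 0 0] tensor_elt_T[OF v, of 0] by (metis T.l_cancel_one add_0)
qed

lemma shift_F: "f \<in> carrier F \<Longrightarrow> shift u f \<in> carrier F"
  using keys_frag_extend[of "\<lambda>(r, v). frag_of (u * r, v)" f]
  by (fastforce simp: in_F split: prod.splits)

lemma shift_relations: "f \<in> balanced_relations S V \<Longrightarrow> shift u f \<in> balanced_relations S V"
proof -
  assume "f \<in> balanced_relations S V"
  then consider
    (left) r r' v where "f = frag_of (r + r', v) - frag_of (r, v) - frag_of (r', v)" "v \<in> carrier V"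
  | (right) r v v' where "f = frag_of (r, v \<otimes>\<^bsub>V\<^esub> v') - frag_of (r, v) - frag_of (r, v')"
      "v \<in> carrier V" "v' \<in> carrier V"
  | (balanced) r s v where "f = frag_of (r * s, v) - frag_of (r, lact V s v)"
      "s \<in> S" "v \<in> carrier V"
    unfolding balanced_relations_def by blast
  then show ?thesis
  proof cases
    case left
    then have "shift u f = frag_of (u * r + u * r', v) - frag_of (u * r, v) - frag_of (u * r', v)"
      by (simp add: frag_extend_diff distrib_left)
    then show ?thesis using left unfolding balanced_relations_def by blast
  next
    case right
    then have "shift u f = frag_of (u * r, v \<otimes>\<^bsub>V\<^esub> v') - frag_of (u * r, v) - frag_of (u * r, v')"
      by (simp add: frag_extend_diff)
    then show ?thesis using right unfolding balanced_relations_def by blast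
  next
    case balanced
    then have "shift u f = frag_of ((u * r) * s, v) - frag_of (u * r, lact V s v)"
      by (simp add: frag_extend_diff mult.assoc)
    then show ?thesis using balanced unfolding balanced_relations_def by blast
  qed
qed

text \<open>The action is defined by a union over the representatives of a coset; it is well defined because
  left multiplication preserves the relations.\<close>

lemma shift_K: "f \<in> K \<Longrightarrow> shift u f \<in> K"
  unfolding tensor_kernel_def
proof (induction rule: generate.induct)
  case one
  then show ?case by (metis frag_extend_0 generate.one one_F)
next
  case (incl f)
  then show ?case by (simp add: generate.incl shift_relations)
next
  case (inv f)
  then have "shift u (inv\<^bsub>F\<^esub> f) = inv\<^bsub>F\<^esub> (shift u f)"
    using relations_F by (auto simp: inv_F shift_F frag_extend_minus)
  then show ?case using inv by (simp add: generate.inv shift_relations)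
next
  case (eng f g)
  then show ?case by (metis frag_extend_add generate.eng mult_F)
qed

lemma lact_proj:
  assumes f: "f \<in> carrier F"
  shows "lact T u (K #>\<^bsub>F\<^esub> f) = K #>\<^bsub>F\<^esub> shift u f"
proof -
  have "K #>\<^bsub>F\<^esub> shift u g = K #>\<^bsub>F\<^esub> shift u f" if g: "g \<in> K #>\<^bsub>F\<^esub> f" for g
  proof -
    obtain k where k: "k \<in> K" "g = k + f" using g unfolding r_coset_def mult_F by blast
    have "k \<in> carrier F" using k normal_imp_subgroup[OF normal_K] subgroup.subset by blast
    then show ?thesis
      using k f shift_K by (simp add: proj_eq_iff shift_F F_plus frag_extend_add)
  qed
  moreover have "f \<in> K #>\<^bsub>F\<^esub> f"
    by (meson f group.rcos_self group_F normal_K normal_imp_subgroup)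
  ultimately have "(\<Union>g\<in>K #>\<^bsub>F\<^esub> f. K #>\<^bsub>F\<^esub> shift u g) = K #>\<^bsub>F\<^esub> shift u f"
    by blast
  then show ?thesis by (simp add: ext_scalars_def Let_def)
qed

lemma lact_tensor: "v \<in> carrier V \<Longrightarrow> lact T u (tensor_elt S V r v) = tensor_elt S V (u * r) v"
  unfolding tensor_elt_def by (simp add: lact_proj frag_of_F)

lemma lact_T: "m \<in> carrier T \<Longrightarrow> lact T u m \<in> carrier T"
  by (auto simp: carrier_T lact_proj intro: shift_F)

lemma lact_mult:
  "m \<in> carrier T \<Longrightarrow> m' \<in> carrier T \<Longrightarrow> lact T u (m \<otimes>\<^bsub>T\<^esub> m') = lact T u m \<otimes>\<^bsub>T\<^esub> lact T u m'"
proof -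
  assume "m \<in> carrier T" "m' \<in> carrier T"
  then obtain f f' where f: "f \<in> carrier F" "f' \<in> carrier F" "m = K #>\<^bsub>F\<^esub> f" "m' = K #>\<^bsub>F\<^esub> f'"
    unfolding carrier_T by blast
  then have "lact T u (m \<otimes>\<^bsub>T\<^esub> m') = K #>\<^bsub>F\<^esub> shift u (f + f')"
    by (simp only: proj_add[symmetric] lact_proj F_plus)
  also have "\<dots> = (K #>\<^bsub>F\<^esub> shift u f) \<otimes>\<^bsub>T\<^esub> (K #>\<^bsub>F\<^esub> shift u f')"
    by (simp only: frag_extend_add proj_add shift_F f)
  finally show ?thesis by (simp only: f lact_proj)
qed

lemma lact_hom: "lact T u \<in> hom T T"
  by (rule homI) (simp_all add: lact_T lact_mult)

text \<open>The homomorphism from the free abelian group kills the balancing relations. This is the source of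
  both maps out of an extension of scalars below: the functional that detects non-zero vectors of the
  generalized Verma module, and the homomorphism of the theorem.\<close>

lemma universal:
  assumes H: "comm_group H"
    and cl: "\<And>u v. v \<in> carrier V \<Longrightarrow> f u v \<in> carrier H"
    and add_left: "\<And>u u' v. v \<in> carrier V \<Longrightarrow> f (u + u') v = f u v \<otimes>\<^bsub>H\<^esub> f u' v"
    and add_right: "\<And>u v v'. v \<in> carrier V \<Longrightarrow> v' \<in> carrier V \<Longrightarrow>
        f u (v \<otimes>\<^bsub>V\<^esub> v') = f u v \<otimes>\<^bsub>H\<^esub> f u v'"
    and balanced: "\<And>u s v. s \<in> S \<Longrightarrow> v \<in> carrier V \<Longrightarrow> f (u * s) v = f u (lact V s v)"
  obtains \<phi> where "\<phi> \<in> hom T H" "\<And>u v. v \<in> carrier V \<Longrightarrow> \<phi> (tensor_elt S V u v) = f u v"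
proof -
  interpret H: comm_group H by (rule H)
  have "case_prod f ` (UNIV \<times> carrier V) \<subseteq> carrier H" using cl by auto
  then obtain h where h: "h \<in> hom F H"
    and "\<And>x. x \<in> UNIV \<times> carrier V \<Longrightarrow> h (frag_of x) = case_prod f x"
    unfolding tensor_free_def using H.free_Abelian_group_universal by blast
  then have hf: "h (frag_of (u, v)) = f u v" if "v \<in> carrier V" for u v
    using that by auto
  interpret gh: group_hom F H h
    using h group_F H.is_group by (simp add: group_hom_def group_hom_axioms_def)
  have h_diff: "h (x - y) = h x \<otimes>\<^bsub>H\<^esub> inv\<^bsub>H\<^esub> h y" if "x \<in> carrier F" "y \<in> carrier F" for x y
    using that gh.hom_mult[of x "- y"] gh.hom_inv[of y] F_minus[of 0 y]
    by (simp add: mult_F inv_F in_F)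
  have cancel: "x \<otimes>\<^bsub>H\<^esub> y \<otimes>\<^bsub>H\<^esub> inv\<^bsub>H\<^esub> x \<otimes>\<^bsub>H\<^esub> inv\<^bsub>H\<^esub> y = \<one>\<^bsub>H\<^esub>"
    if "x \<in> carrier H" "y \<in> carrier H" for x y
    using that H.m_assoc[of "x \<otimes>\<^bsub>H\<^esub> y" "inv\<^bsub>H\<^esub> x" "inv\<^bsub>H\<^esub> y"] H.inv_mult[of x y]
      H.r_inv[of "x \<otimes>\<^bsub>H\<^esub> y"] by simp
  have "balanced_relations S V \<subseteq> kernel F H h"
  proof
    fix x assume x: "x \<in> balanced_relations S V"
    consider
      (left) r r' v where "x = frag_of (r + r', v) - frag_of (r, v) - frag_of (r', v)"
        "v \<in> carrier V"
    | (right) r v v' where "x = frag_of (r, v \<otimes>\<^bsub>V\<^esub> v') - frag_of (r, v) - frag_of (r, v')"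
        "v \<in> carrier V" "v' \<in> carrier V"
    | (balanced) r s v where "x = frag_of (r * s, v) - frag_of (r, lact V s v)"
        "s \<in> S" "v \<in> carrier V"
      using x unfolding balanced_relations_def by blast
    then have "h x = \<one>\<^bsub>H\<^esub>"
    proof cases
      case left
      then show ?thesis
        by (simp only: h_diff F_minus frag_of_F hf add_left cancel cl)
    next
      case right
      then show ?thesis
        by (simp only: h_diff F_minus frag_of_F hf add_right cancel cl mult_closed)
    next
      case balanced
      then show ?thesis
        by (simp only: h_diff frag_of_F hf assms(5) lact_closed cl H.r_inv)
    qed
    then show "x \<in> kernel F H h" using relations_F x by (auto simp: kernel_def)
  qed
  then have "K \<subseteq> kernel F H h"
    unfolding tensor_kernel_def
    by (simp add: group.generate_subgroup_incl[OF group_F] gh.subgroup_kernel)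
  then obtain \<phi> where "\<phi> \<in> hom (F Mod K) H" and \<phi>: "\<And>x. x \<in> carrier F \<Longrightarrow> \<phi> (K #>\<^bsub>F\<^esub> x) = h x"
    using gh.FactGroup_universal_kernel[OF normal_K] by blast
  then have "\<phi> \<in> hom T H" by (simp add: ext_scalars_def Let_def hom_def)
  moreover have "\<phi> (tensor_elt S V u v) = f u v" if "v \<in> carrier V" for u v
    using that by (simp add: tensor_elt_def \<phi> frag_of_F hf)
  ultimately show thesis using that by blast
qed

text \<open>Applied to the composites of a group homomorphism with the action of a ring element on either
  side, this reduces linearity over the ring to the elements \<open>u \<otimes> v\<close>.\<close>

lemma hom_eqI:
  assumes H: "comm_group H" and "\<phi> \<in> hom T H" "\<psi> \<in> hom T H"
    and eq: "\<And>u v. v \<in> carrier V \<Longrightarrow> \<phi> (tensor_elt S V u v) = \<psi> (tensor_elt S V u v)"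
    and m: "m \<in> carrier T"
  shows "\<phi> m = \<psi> m"
proof -
  interpret H: comm_group H by (rule H)
  interpret p: group_hom T H \<phi>
    using assms comm_group_T by (simp add: group_hom_def group_hom_axioms_def comm_group_def)
  interpret q: group_hom T H \<psi>
    using assms comm_group_T by (simp add: group_hom_def group_hom_axioms_def comm_group_def)
  interpret k: group_hom F T "\<lambda>f. K #>\<^bsub>F\<^esub> f" by (rule group_hom_proj)
  obtain f where f: "f \<in> carrier F" "m = K #>\<^bsub>F\<^esub> f" using m by (auto simp: carrier_T)
  have "\<phi> (K #>\<^bsub>F\<^esub> f) = \<psi> (K #>\<^bsub>F\<^esub> f)"
  proof (rule free_Abelian_group_induct[of f "UNIV \<times> carrier V"])
    show "Poly_Mapping.keys f \<subseteq> UNIV \<times> carrier V" using f by (simp add: in_F)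
    show "\<phi> (K #>\<^bsub>F\<^esub> 0) = \<psi> (K #>\<^bsub>F\<^esub> 0)" by (simp add: proj_0)
    fix x y assume xy: "Poly_Mapping.keys x \<subseteq> UNIV \<times> carrier V" "Poly_Mapping.keys y \<subseteq> UNIV \<times> carrier V"
      "\<phi> (K #>\<^bsub>F\<^esub> x) = \<psi> (K #>\<^bsub>F\<^esub> x)" "\<phi> (K #>\<^bsub>F\<^esub> y) = \<psi> (K #>\<^bsub>F\<^esub> y)"
    then have F: "x \<in> carrier F" "y \<in> carrier F" by (simp_all add: in_F)
    then have "K #>\<^bsub>F\<^esub> (x - y) = (K #>\<^bsub>F\<^esub> x) \<otimes>\<^bsub>T\<^esub> inv\<^bsub>T\<^esub> (K #>\<^bsub>F\<^esub> y)"
      using k.hom_mult[of x "- y"] k.hom_inv[of y] F_minus[of 0 y] by (simp add: mult_F inv_F in_F)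
    then show "\<phi> (K #>\<^bsub>F\<^esub> (x - y)) = \<psi> (K #>\<^bsub>F\<^esub> (x - y))"
      using F xy k.hom_closed[OF F(1)] k.hom_closed[OF F(2)] by (simp add: p.hom_mult q.hom_mult)
  next
    fix a :: "'r \<times> 'm" assume "a \<in> UNIV \<times> carrier V"
    then show "\<phi> (K #>\<^bsub>F\<^esub> frag_of a) = \<psi> (K #>\<^bsub>F\<^esub> frag_of a)"
      using eq[of "snd a" "fst a"] by (auto simp: tensor_elt_def)
  qed
  then show ?thesis using f by simp
qed

end

section \<open>The action of the enveloping algebra on rational functions on the dual space\<close>

definition lin_ext :: "('w \<Rightarrow> complex) \<Rightarrow> ('w \<Rightarrow>\<^sub>0 complex) \<Rightarrow> complex" where
  "lin_ext h f = (\<Sum>w\<in>Poly_Mapping.keys f. Poly_Mapping.lookup f w * h w)"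

lemma lin_ext_superset:
  "finite A \<Longrightarrow> Poly_Mapping.keys f \<subseteq> A \<Longrightarrow>
    lin_ext h f = (\<Sum>w\<in>A. Poly_Mapping.lookup f w * h w)"
  unfolding lin_ext_def by (rule sum.mono_neutral_left) (auto simp: in_keys_iff)

lemma lin_ext_0 [simp]: "lin_ext h 0 = 0"
  by (simp add: lin_ext_def)

lemma lin_ext_single [simp]: "lin_ext h (Poly_Mapping.single w c) = c * h w"
  by (simp add: lin_ext_def lookup_single)

lemma lin_ext_add: "lin_ext h (f + g) = lin_ext h f + lin_ext h g"
proof -
  let ?A = "Poly_Mapping.keys f \<union> Poly_Mapping.keys g"
  have "lin_ext h (f + g) = (\<Sum>w\<in>?A. Poly_Mapping.lookup (f + g) w * h w)"
    "lin_ext h f = (\<Sum>w\<in>?A. Poly_Mapping.lookup f w * h w)"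
    "lin_ext h g = (\<Sum>w\<in>?A. Poly_Mapping.lookup g w * h w)"
    by (rule lin_ext_superset; use keys_add[of f g] in auto)+
  then show ?thesis by (simp add: lookup_add distrib_right sum.distrib)
qed

lemma lin_ext_diff: "lin_ext h (f - g) = lin_ext h f - lin_ext h g"
  using lin_ext_add[of h "f - g" g] by simp

lemma poly_mapping_induct_add:
  assumes "P 0" "\<And>w c. P (Poly_Mapping.single w c)" "\<And>f g. P f \<Longrightarrow> P g \<Longrightarrow> P (f + g)"
  shows "P (f :: 'w \<Rightarrow>\<^sub>0 complex)"
proof -
  have "P (\<Sum>w\<in>A. Poly_Mapping.single w (Poly_Mapping.lookup f w))" if "finite A" for A
    using that by induction (simp_all add: assms)
  then have "P (\<Sum>w\<in>Poly_Mapping.keys f. Poly_Mapping.single w (Poly_Mapping.lookup f w))" by simp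
  moreover have "(\<Sum>w\<in>Poly_Mapping.keys f. Poly_Mapping.single w (Poly_Mapping.lookup f w)) = f"
    by (rule poly_mapping_eqI) (simp add: lookup_sum lookup_single when_def in_keys_iff)
  ultimately show ?thesis by simp
qed

lemma lin_ext_mult_single_left:
  "lin_ext h (Poly_Mapping.single v c * f) = c * lin_ext (\<lambda>w. h (v + w)) f"
  by (induction f rule: poly_mapping_induct_add)
    (simp_all add: mult_single distrib_left lin_ext_add)

lemma lin_ext_mult_single_right:
  "lin_ext h (f * Poly_Mapping.single v c) = c * lin_ext (\<lambda>w. h (w + v)) f"
  by (induction f rule: poly_mapping_induct_add)
    (simp_all add: mult_single distrib_right distrib_left lin_ext_add)

text \<open>Rational functions on the dual space whose denominator is a power of the linear function \<open>p\<close>, kept as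
  expressions so that the derivations can be defined by recursion: \<open>Coord y\<close> is evaluation at \<open>y\<close> and
  \<open>Recip\<close> is \<open>1 / p\<close>. Different expressions may denote the same function.\<close>

datatype 'a rat_expr =
    Const complex
  | Coord 'a
  | Plus "'a rat_expr" "'a rat_expr"
  | Times "'a rat_expr" "'a rat_expr"
  | Recip

primrec val :: "'a::complex_lie_algebra \<Rightarrow> ('a \<Rightarrow> complex) \<Rightarrow> 'a rat_expr \<Rightarrow> complex" where
  "val p l (Const c) = c"
| "val p l (Coord y) = l y"
| "val p l (Plus e f) = val p l e + val p l f"
| "val p l (Times e f) = val p l e * val p l f"
| "val p l Recip = 1 / l p"

primrec der :: "'a::complex_lie_algebra \<Rightarrow> 'a \<Rightarrow> 'a rat_expr \<Rightarrow> 'a rat_expr" where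
  "der p x (Const c) = Const 0"
| "der p x (Coord y) = Coord (lie x y)"
| "der p x (Plus e f) = Plus (der p x e) (der p x f)"
| "der p x (Times e f) = Plus (Times (der p x e) f) (Times e (der p x f))"
| "der p x Recip = Times (Const (- 1)) (Times (Coord (lie x p)) (Times Recip Recip))"

definition regular_points :: "'a::complex_lie_algebra \<Rightarrow> ('a \<Rightarrow> complex) set" where
  "regular_points p = {l. (\<forall>x y. l (x + y) = l x + l y) \<and> (\<forall>c x. l (c *\<^sub>C x) = c * l x) \<and> l p \<noteq> 0}"

abbreviation der_word :: "'a::complex_lie_algebra \<Rightarrow> 'a word \<Rightarrow> 'a rat_expr \<Rightarrow> 'a rat_expr" where
  "der_word p w e \<equiv> foldr (der p) (letters w) e"

context
  fixes p :: "'a::complex_lie_algebra"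
begin

lemma regular_add: "l \<in> regular_points p \<Longrightarrow> l (x + y) = l x + l y"
  and regular_scale: "l \<in> regular_points p \<Longrightarrow> l (c *\<^sub>C x) = c * l x"
  and regular_nonzero: "l \<in> regular_points p \<Longrightarrow> l p \<noteq> 0"
  by (simp_all add: regular_points_def)

lemma val_der_add:
  "l \<in> regular_points p \<Longrightarrow> val p l (der p (x + y) e) = val p l (der p x e) + val p l (der p y e)"
  by (induction e) (simp_all add: lie_add_left regular_add algebra_simps)

lemma val_der_scale:
  "l \<in> regular_points p \<Longrightarrow> val p l (der p (c *\<^sub>C x) e) = c * val p l (der p x e)"
  by (induction e) (simp_all add: lie_cscale_left regular_scale algebra_simps)

lemma lie_lie: "lie x (lie y z) = lie (lie x y) z + lie y (lie x (z::'a))"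
proof -
  have anti: "lie u v = - lie v u" for u v :: 'a
  proof -
    have "0 = lie (u + v) (u + v)" by (simp only: lie_self)
    also have "\<dots> = lie u v + lie v u"
      by (simp only: lie_add_left lie_add_right) (simp add: lie_self)
    finally show ?thesis by (simp add: eq_neg_iff_add_eq_0)
  qed
  have neg: "lie u (- v) = - lie u v" for u v :: 'a
    using lie_add_right[of u v "- v"] lie_add_right[of u 0 0] by (simp add: eq_neg_iff_add_eq_0 add.commute)
  have "lie y (lie z x) = - lie y (lie x z)" by (simp only: anti[of z x] neg)
  moreover have "lie z (lie x y) = - lie (lie x y) z" by (rule anti)
  ultimately show ?thesis using jacobi[of x y z] by (simp add: algebra_simps)
qed

text \<open>Checked on coordinates by the Jacobi identity; the commutator of two derivations is a derivation.\<close>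

lemma val_der_lie:
  assumes l: "l \<in> regular_points p"
  shows "val p l (der p x (der p y e)) - val p l (der p y (der p x e)) = val p l (der p (lie x y) e)"
proof (induction e)
  case (Coord z)
  then show ?case using regular_add[OF l] lie_lie[of x y z] by simp
next
  case Recip
  show ?case
    using regular_add[OF l] lie_lie[of x y p] by (simp add: field_simps add_divide_distrib)
next
  case (Times e f)
  have "val p l (der p x (der p y (Times e f))) - val p l (der p y (der p x (Times e f)))
     = (val p l (der p x (der p y e)) - val p l (der p y (der p x e))) * val p l f
     + val p l e * (val p l (der p x (der p y f)) - val p l (der p y (der p x f)))"
    by (simp add: algebra_simps)
  then show ?case using Times by simp
next
  case (Plus e f)
  then show ?case by (simp add: algebra_simps)
qed simp

text \<open>The formal derivation is the derivative along the coadjoint vector field of \<open>x\<close>; hence it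
  respects equality of functions, which is not visible from its recursive definition.\<close>

lemma val_has_derivative:
  assumes l: "l \<in> regular_points p"
  shows "((\<lambda>t. val p (\<lambda>y. l y + t * l (lie x y)) e) has_field_derivative val p l (der p x e)) (at 0)"
proof (induction e)
  case (Coord y)
  show ?case by (auto intro!: derivative_eq_intros)
next
  case (Plus e f)
  then show ?case by (auto intro!: derivative_eq_intros)
next
  case (Times e f)
  then show ?case by (auto intro!: derivative_eq_intros)
next
  case Recip
  show ?case using regular_nonzero[OF l]
    by (auto intro!: derivative_eq_intros simp: power2_eq_square field_simps)
qed simp

lemma regular_line:
  assumes l: "l \<in> regular_points p"
  shows "\<forall>\<^sub>F t in at 0. (\<lambda>y. l y + t * l (lie x y)) \<in> regular_points p"
proof -
  have "((\<lambda>t. l p + t * l (lie x p)) \<longlongrightarrow> l p + 0 * l (lie x p)) (at 0)"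
    by (intro tendsto_intros)
  then have "\<forall>\<^sub>F t in at 0. l p + t * l (lie x p) \<noteq> 0"
    using tendsto_imp_eventually_ne regular_nonzero[OF l] by fastforce
  then show ?thesis
    by eventually_elim
      (simp add: regular_points_def regular_add[OF l] regular_scale[OF l] lie_add_right
        lie_cscale_right algebra_simps)
qed

lemma derivative_zero:
  assumes l: "l \<in> regular_points p"
    and d: "((\<lambda>t. g (\<lambda>y. l y + t * l (lie x y))) has_field_derivative D) (at 0)"
    and z: "\<And>l. l \<in> regular_points p \<Longrightarrow> g l = (0::complex)"
  shows "D = 0"
proof -
  have "\<forall>\<^sub>F t in nhds 0. g (\<lambda>y. l y + t * l (lie x y)) = 0"
    using regular_line[OF l, of x] z l by (auto simp: eventually_nhds_conv_at elim: eventually_mono)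
  then have "((\<lambda>t. 0) has_field_derivative D) (at 0)"
    using d DERIV_cong_ev[OF refl _ refl, THEN iffD1] by fast
  then show ?thesis by (rule DERIV_unique) (rule DERIV_const)
qed

lemma val_der_cong:
  assumes l: "l \<in> regular_points p"
    and z: "\<And>l. l \<in> regular_points p \<Longrightarrow> val p l e = c * val p l f"
  shows "val p l (der p x e) = c * val p l (der p x f)"
proof -
  have "((\<lambda>t. val p (\<lambda>y. l y + t * l (lie x y)) e - c * val p (\<lambda>y. l y + t * l (lie x y)) f)
      has_field_derivative val p l (der p x e) - c * val p l (der p x f)) (at 0)"
    by (intro derivative_intros val_has_derivative l DERIV_cmult)
  from derivative_zero[where g = "\<lambda>l. val p l e - c * val p l f", OF l this] z show ?thesis by simp
qed

text \<open>The equality is required at all regular points, since derivations move the point.\<close>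

lemma val_der_word_cong:
  assumes "\<And>l. l \<in> regular_points p \<Longrightarrow> val p l e = c * val p l f" and "l \<in> regular_points p"
  shows "val p l (der_word p w e) = c * val p l (der_word p w f)"
proof -
  have "\<forall>l\<in>regular_points p. val p l (foldr (der p) xs e) = c * val p l (foldr (der p) xs f)" for xs
    by (induction xs) (simp_all add: assms val_der_cong)
  then show ?thesis using assms by blast
qed

lemma letters_plus: "letters (v + w) = letters v @ letters w"
  by (simp add: plus_word_def)

abbreviation free_pairing :: "('a \<Rightarrow> complex) \<Rightarrow> 'a rat_expr \<Rightarrow> ('a word \<Rightarrow>\<^sub>0 complex) \<Rightarrow> complex" where
  "free_pairing l e \<equiv> lin_ext (\<lambda>w. val p l (der_word p w e))"

lemma free_pairing_letter_has_derivative: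
  assumes l: "l \<in> regular_points p"
  shows "((\<lambda>t. free_pairing (\<lambda>y. l y + t * l (lie x y)) e f)
           has_field_derivative free_pairing l e (letter x * f)) (at 0)"
proof -
  have "((\<lambda>t. free_pairing (\<lambda>y. l y + t * l (lie x y)) e f)
      has_field_derivative lin_ext (\<lambda>w. val p l (der p x (der_word p w e))) f) (at 0)"
    unfolding lin_ext_def by (intro DERIV_sum DERIV_cmult val_has_derivative l)
  then show ?thesis by (simp add: lin_ext_mult_single_left letters_plus)
qed

lemma free_pairing_mult_left:
  assumes z: "\<And>l. l \<in> regular_points p \<Longrightarrow> free_pairing l e f = 0" and l: "l \<in> regular_points p"
  shows "free_pairing l e (g * f) = 0"
proof -
  have letter: "\<forall>l\<in>regular_points p. free_pairing l e (letter x * h) = 0"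
    if "\<forall>l\<in>regular_points p. free_pairing l e h = 0" for x h
  proof
    fix l assume l: "l \<in> regular_points p"
    show "free_pairing l e (letter x * h) = 0"
      using derivative_zero[where g = "\<lambda>l. free_pairing l e h",
          OF l free_pairing_letter_has_derivative[OF l]] that by blast
  qed
  have "\<forall>l\<in>regular_points p. free_pairing l e (Poly_Mapping.single (Word xs) 1 * f) = 0" for xs
  proof (induction xs)
    case Nil
    have "Poly_Mapping.single (Word []) 1 = (1 :: 'a word \<Rightarrow>\<^sub>0 complex)"
      by (simp only: zero_word_def[symmetric] single_one)
    then show ?case using z by simp
  next
    case (Cons x xs)
    have "Poly_Mapping.single (Word (x # xs)) 1 = letter x * Poly_Mapping.single (Word xs) (1::complex)"
      by (simp add: mult_single plus_word_def)
    then show ?case using letter[OF Cons] by (simp add: mult.assoc)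
  qed
  then have *: "free_pairing l e (Poly_Mapping.single w 1 * f) = 0" for w
    using l by (metis word.collapse)
  show ?thesis
    using * by (induction g rule: poly_mapping_induct_add)
      (simp_all add: lin_ext_mult_single_left distrib_right lin_ext_add)
qed

text \<open>Multiplication on the right by a word changes the expression \<open>e\<close>, and multiplication on the left by a
  letter differentiates with respect to the point \<open>l\<close>. Therefore the induction over the two-sided
  ideal must be for all \<open>e\<close> and all regular \<open>l\<close> at once.\<close>

lemma free_pairing_ideal:
  "f \<in> uea_ideal \<Longrightarrow> \<forall>e. \<forall>l\<in>regular_points p. free_pairing l e f = 0"
proof (induction rule: uea_ideal.induct)
  case (rel_add x y)
  show ?case by (simp add: lin_ext_diff val_der_add)
next
  case (rel_cscale c x)
  show ?case by (simp add: lin_ext_diff val_der_scale mult_single)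
next
  case (rel_lie x y)
  show ?case by (simp add: lin_ext_diff mult_single plus_word_def val_der_lie)
next
  case (ideal_add f g)
  then show ?case by (simp add: lin_ext_add)
next
  case (ideal_mult_left f g)
  then show ?case using free_pairing_mult_left by blast
next
  case (ideal_mult_right f g)
  have single: "free_pairing l e (f * Poly_Mapping.single w c) = 0" if "l \<in> regular_points p" for l e w c
  proof -
    have "free_pairing l e (f * Poly_Mapping.single w c) = c * free_pairing l (der_word p w e) f"
      by (simp add: lin_ext_mult_single_right letters_plus)
    then show ?thesis using ideal_mult_right that by simp
  qed
  show ?case
  proof (intro allI ballI)
    fix e l assume "l \<in> regular_points p"
    then show "free_pairing l e (f * g) = 0"
      by (induction g rule: poly_mapping_induct_add) (simp_all add: single distrib_left lin_ext_add)
  qed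
qed

end

text \<open>The value at \<open>l\<close> of the function obtained by letting an element of the enveloping algebra act on \<open>e\<close>;
  the last letter of a word acts first.\<close>

lift_definition pairing ::
  "'a::complex_lie_algebra \<Rightarrow> ('a \<Rightarrow> complex) \<Rightarrow> 'a rat_expr \<Rightarrow> 'a uea \<Rightarrow> complex" is
  "\<lambda>p l e f. if l \<in> regular_points p then lin_ext (\<lambda>w. val p l (der_word p w e)) f else 0"
  using free_pairing_ideal by (fastforce simp: lin_ext_diff)

context
  fixes p :: "'a::complex_lie_algebra" and l :: "'a \<Rightarrow> complex"
  assumes l: "l \<in> regular_points p"
begin

lemma pairing_add: "pairing p l e (u + v) = pairing p l e u + pairing p l e v"
  by transfer (simp add: lin_ext_add)

lemma pairing_diff: "pairing p l e (u - v) = pairing p l e u - pairing p l e v"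
  by transfer (simp add: lin_ext_diff)

lemma pairing_const: "pairing p l e (uea_const c) = c * val p l e"
  using l by transfer (simp add: zero_word_def)

lemma pairing_of: "pairing p l e (uea_of x) = val p l (der p x e)"
  using l by transfer simp

lemma pairing_mult_of: "pairing p l e (u * uea_of x) = pairing p l (der p x e) u"
  by transfer (simp add: lin_ext_mult_single_right letters_plus)

lemma pairing_mult_const: "pairing p l e (u * uea_const c) = c * pairing p l e u"
  by transfer (simp add: lin_ext_mult_single_right)

lemma pairing_cong:
  assumes "\<And>l. l \<in> regular_points p \<Longrightarrow> val p l e = c * val p l f"
  shows "pairing p l e u = c * pairing p l f u"
  using assms
proof (transfer fixing: c)
  fix p :: 'a and l e f and g :: "'a word \<Rightarrow>\<^sub>0 complex"
  assume *: "\<And>l. l \<in> regular_points p \<Longrightarrow> val p l e = c * val p l f"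
  show "(if l \<in> regular_points p then lin_ext (\<lambda>w. val p l (der_word p w e)) g else 0)
    = c * (if l \<in> regular_points p then lin_ext (\<lambda>w. val p l (der_word p w f)) g else 0)"
    using val_der_word_cong[OF *] by (simp add: lin_ext_def sum_distrib_left algebra_simps)
qed

end

text \<open>If \<open>L\<close> acts on the line through \<open>p\<close> by \<open>\<mu>\<close>, then it acts on the function \<open>1 / p\<close> by \<open>- \<mu>\<close>. Reading off
  the eigenvalue of an element of the enveloping algebra of \<open>L\<close> on this function gives the
  multiplicative extension of \<open>- \<mu>\<close>.\<close>

context
  fixes p :: "'a::complex_lie_algebra" and l :: "'a \<Rightarrow> complex" and L \<mu>
  assumes l: "l \<in> regular_points p" and \<mu>: "\<And>x. x \<in> L \<Longrightarrow> lie x p = \<mu> x *\<^sub>C p"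
begin

lemma val_der_Recip: "x \<in> L \<Longrightarrow> l' \<in> regular_points p \<Longrightarrow> val p l' (der p x Recip) = - \<mu> x * val p l' Recip"
  using regular_nonzero[of l' p] regular_scale[of l' p] by (simp add: \<mu> field_simps)

lemma pairing_sub:
  "u \<in> uea_sub L \<Longrightarrow> pairing p l Recip (w * u) = pairing p l Recip u * l p * pairing p l Recip w"
proof (induction arbitrary: w rule: uea_sub.induct)
  case (sub_const c)
  then show ?case using regular_nonzero[OF l] by (simp add: l pairing_mult_const pairing_const)
next
  case (sub_gen x)
  have "pairing p l Recip (w * uea_of x) = - \<mu> x * pairing p l Recip w"
    using pairing_cong[OF l val_der_Recip[OF sub_gen]] by (simp only: pairing_mult_of l)
  moreover have "pairing p l Recip (uea_of x) * l p = - \<mu> x"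
    using val_der_Recip[OF sub_gen l] regular_nonzero[OF l] by (simp only: pairing_of l val.simps) simp
  ultimately show ?case by simp
next
  case (sub_add u v)
  then show ?case by (simp add: distrib_left distrib_right l pairing_add)
next
  case (sub_mult u v)
  have "pairing p l Recip (w * (u * v)) = pairing p l Recip v * l p * pairing p l Recip (w * u)"
    by (simp only: sub_mult.IH(2) flip: mult.assoc)
  then show ?case
    by (simp only: sub_mult.IH(1)[of w] sub_mult.IH(2)[of u] mult_ac)
qed

lemma character_ext_spec:
  defines "\<psi> \<equiv> character_ext L (\<lambda>x. - \<mu> x)"
  shows "\<psi> (uea_const c) = c" and "x \<in> L \<Longrightarrow> \<psi> (uea_of x) = - \<mu> x"
    and "u \<in> uea_sub L \<Longrightarrow> v \<in> uea_sub L \<Longrightarrow> \<psi> (u + v) = \<psi> u + \<psi> v"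
    and "u \<in> uea_sub L \<Longrightarrow> v \<in> uea_sub L \<Longrightarrow> \<psi> (u * v) = \<psi> u * \<psi> v"
proof -
  let ?\<phi> = "\<lambda>u. pairing p l Recip u * l p"
  have "(\<forall>c. \<psi> (uea_const c) = c) \<and> (\<forall>x\<in>L. \<psi> (uea_of x) = - \<mu> x) \<and>
     (\<forall>u\<in>uea_sub L. \<forall>v\<in>uea_sub L. \<psi> (u + v) = \<psi> u + \<psi> v \<and> \<psi> (u * v) = \<psi> u * \<psi> v)"
    unfolding \<psi>_def character_ext_def
  proof (rule someI[of _ ?\<phi>], intro conjI allI ballI)
    show "?\<phi> (uea_const c) = c" for c
      using regular_nonzero[OF l] by (simp add: l pairing_const)
    show "?\<phi> (uea_of x) = - \<mu> x" if "x \<in> L" for x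
      using val_der_Recip[OF that l] regular_nonzero[OF l] by (simp only: pairing_of l val.simps) simp
    fix u v assume "u \<in> uea_sub L" "v \<in> uea_sub L"
    then show "?\<phi> (u + v) = ?\<phi> u + ?\<phi> v" "?\<phi> (u * v) = ?\<phi> u * ?\<phi> v"
      by (simp_all add: l pairing_add distrib_right pairing_sub)
  qed
  then show "\<psi> (uea_const c) = c" "x \<in> L \<Longrightarrow> \<psi> (uea_of x) = - \<mu> x"
    "u \<in> uea_sub L \<Longrightarrow> v \<in> uea_sub L \<Longrightarrow> \<psi> (u + v) = \<psi> u + \<psi> v"
    "u \<in> uea_sub L \<Longrightarrow> v \<in> uea_sub L \<Longrightarrow> \<psi> (u * v) = \<psi> u * \<psi> v" by blast+
qed

lemma pairing_mult_sub:
  assumes "s \<in> uea_sub L"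
  shows "pairing p l Recip (w * s) = character_ext L (\<lambda>x. - \<mu> x) s * pairing p l Recip w"
proof -
  have "character_ext L (\<lambda>x. - \<mu> x) s = pairing p l Recip s * l p" using assms
  proof (induction rule: uea_sub.induct)
    case (sub_const c)
    then show ?case using regular_nonzero[OF l] by (simp add: character_ext_spec l pairing_const)
  next
    case (sub_gen x)
    then show ?case
      using val_der_Recip[OF sub_gen l] regular_nonzero[OF l]
      by (simp only: character_ext_spec pairing_of l val.simps) simp
  next
    case (sub_add u v)
    then show ?case by (simp add: character_ext_spec l pairing_add distrib_right)
  next
    case (sub_mult u v)
    then show ?case by (simp add: character_ext_spec pairing_sub)
  qed
  then show ?thesis using pairing_sub[OF assms, of w] by simp
qed

end

section \<open>The vector representation\<close>

definition bil :: "complex^8 \<Rightarrow> complex^8 \<Rightarrow> complex" where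
  "bil u v = (\<Sum>i\<in>UNIV. u $ i * v $ i)"

definition app :: "so8 \<Rightarrow> complex^8 \<Rightarrow> complex^8" where
  "app A x = Rep_so8 A *v x"

text \<open>The skew-symmetric matrices \<open>u v\<^sup>T - v u\<^sup>T\<close>; they span the algebra.\<close>

lift_definition wedge :: "complex^8 \<Rightarrow> complex^8 \<Rightarrow> so8" is
  "\<lambda>u v. \<chi> i j. u $ i * v $ j - v $ i * u $ j"
  by (simp add: transpose_def vec_eq_iff)

lemma bil_commute: "bil u v = bil v u"
  by (simp add: bil_def mult.commute)

lemma bil_add_left: "bil (u + v) w = bil u w + bil v w"
  and bil_diff_left: "bil (u - v) w = bil u w - bil v w"
  and bil_minus_left: "bil (- u) w = - bil u w"
  and bil_scale_left: "bil (c *s u) w = c * bil u w"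
  and bil_zero_left: "bil 0 w = 0"
  by (simp_all add: bil_def sum.distrib sum_subtractf sum_negf sum_distrib_left algebra_simps)

lemma bil_add_right: "bil w (u + v) = bil w u + bil w v"
  and bil_diff_right: "bil w (u - v) = bil w u - bil w v"
  and bil_minus_right: "bil w (- u) = - bil w u"
  and bil_scale_right: "bil w (c *s u) = c * bil w u"
  and bil_zero_right: "bil w 0 = 0"
  by (simp_all only: bil_commute[of w] bil_add_left bil_diff_left bil_minus_left bil_scale_left
      bil_zero_left)

lemmas bil_simps = bil_add_left bil_diff_left bil_minus_left bil_scale_left bil_zero_left
  bil_add_right bil_diff_right bil_minus_right bil_scale_right bil_zero_right

lemma bil_sum_left: "bil (\<Sum>a\<in>F. g a) w = (\<Sum>a\<in>F. bil (g a) w)"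
  by (induction F rule: infinite_finite_induct) (simp_all add: bil_simps)

lemma bil_axis: "bil u (axis i 1) = u $ i"
  by (simp add: bil_def axis_def if_distrib cong: if_cong)

lemma bil_eqI: "(\<And>w. bil u w = bil v w) \<Longrightarrow> u = v"
  by (metis bil_axis vec_eq_iff)

lemma app_add_right: "app A (x + y) = app A x + app A y"
  and app_diff_right: "app A (x - y) = app A x - app A y"
  and app_scale_right: "app A (c *s x) = c *s app A x"
  and app_zero_right: "app A 0 = 0"
  and app_minus_right: "app A (- x) = - app A x"
  by (simp_all add: app_def matrix_vector_mult_def vec_eq_iff sum.distrib sum_subtractf sum_negf
      sum_distrib_left algebra_simps)

lemma app_add_left: "app (A + B) x = app A x + app B x"
  and app_diff_left: "app (A - B) x = app A x - app B x"
  and app_minus_left: "app (- A) x = - app A x"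
  and app_zero_left: "app 0 x = 0"
  and app_scale_left: "app (c *\<^sub>C A) x = c *s app A x"
  by (simp_all add: app_def plus_so8.rep_eq minus_so8.rep_eq uminus_so8.rep_eq zero_so8.rep_eq
      cscale_so8.rep_eq matrix_vector_mult_def vec_eq_iff sum.distrib sum_subtractf sum_negf
      sum_distrib_left algebra_simps)

lemmas app_simps = app_add_right app_diff_right app_scale_right app_zero_right app_minus_right
  app_add_left app_diff_left app_minus_left app_zero_left app_scale_left

lemma app_sum_right: "app A (\<Sum>a\<in>F. g a) = (\<Sum>a\<in>F. app A (g a))"
  by (induction F rule: infinite_finite_induct) (simp_all add: app_simps)

lemma app_lie: "app (lie A B) x = app A (app B x) - app B (app A x)"
  by (simp add: app_def lie_so8.rep_eq matrix_vector_mul_assoc matrix_vector_mult_diff_rdistrib)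

lemma app_wedge: "app (wedge u v) x = bil v x *s u - bil u x *s v"
  by (simp add: app_def wedge.rep_eq matrix_vector_mult_def vec_eq_iff bil_def sum_subtractf
      sum_distrib_left algebra_simps)

lemma bil_app: "bil (app A x) y = - bil x (app A y)"
proof -
  have skew: "Rep_so8 A $ i $ j = - Rep_so8 A $ j $ i" for i j
  proof -
    have "transpose (Rep_so8 A) = - Rep_so8 A" using Rep_so8[of A] by simp
    then have "transpose (Rep_so8 A) $ j $ i = - Rep_so8 A $ j $ i" by simp
    then show ?thesis by (simp add: transpose_def)
  qed
  have "bil (app A x) y = (\<Sum>i\<in>UNIV. \<Sum>j\<in>UNIV. Rep_so8 A $ i $ j * x $ j * y $ i)"
    by (simp add: bil_def app_def matrix_vector_mult_def sum_distrib_right)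
  also have "\<dots> = (\<Sum>j\<in>UNIV. \<Sum>i\<in>UNIV. Rep_so8 A $ i $ j * x $ j * y $ i)"
    by (rule sum.swap)
  also have "\<dots> = (\<Sum>j\<in>UNIV. \<Sum>i\<in>UNIV. - (x $ j * (Rep_so8 A $ j $ i * y $ i)))"
  proof (intro sum.cong refl)
    fix i j show "Rep_so8 A $ i $ j * x $ j * y $ i = - (x $ j * (Rep_so8 A $ j $ i * y $ i))"
      by (subst skew) simp
  qed
  finally show ?thesis
    by (simp add: bil_def app_def matrix_vector_mult_def sum_distrib_left sum_negf)
qed

lemma app_eqI: "(\<And>x. app A x = app B x) \<Longrightarrow> A = B"
  by (metis Rep_so8_inject app_def matrix_eq)

lemma lie_wedge: "lie A (wedge u v) = wedge (app A u) v + wedge u (app A v)"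
  by (rule app_eqI) (simp add: app_lie app_simps app_wedge bil_app vec.scale_left_diff_distrib
      vec.scale_minus_left)

lemma wedge_add_left: "wedge (u + u') v = wedge u v + wedge u' v"
  and wedge_diff_left: "wedge (u - u') v = wedge u v - wedge u' v"
  and wedge_minus_left: "wedge (- u) v = - wedge u v"
  and wedge_scale_left: "wedge (c *s u) v = c *\<^sub>C wedge u v"
  and wedge_zero_left: "wedge 0 v = 0"
  by (transfer; simp add: vec_eq_iff algebra_simps)+

lemma wedge_add_right: "wedge v (u + u') = wedge v u + wedge v u'"
  and wedge_diff_right: "wedge v (u - u') = wedge v u - wedge v u'"
  and wedge_minus_right: "wedge v (- u) = - wedge v u"
  and wedge_scale_right: "wedge v (c *s u) = c *\<^sub>C wedge v u"
  and wedge_zero_right: "wedge v 0 = 0"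
  and wedge_self: "wedge v v = 0"
  and wedge_commute: "wedge u v = - wedge v u"
  by (transfer; simp add: vec_eq_iff algebra_simps)+

lemmas wedge_simps = wedge_add_left wedge_diff_left wedge_minus_left wedge_scale_left wedge_zero_left
  wedge_add_right wedge_diff_right wedge_minus_right wedge_scale_right wedge_zero_right wedge_self

lemma cscale_minus_right: "c *\<^sub>C (- x) = - (c *\<^sub>C (x::'a::complex_lie_algebra))"
  and cscale_diff_right: "c *\<^sub>C (x - y) = c *\<^sub>C x - c *\<^sub>C (y::'a)"
  and cscale_minus_left: "(- c) *\<^sub>C x = - (c *\<^sub>C x)"
  and cscale_diff_left: "(a - b) *\<^sub>C x = a *\<^sub>C x - b *\<^sub>C x"
  and cscale_zero_left: "0 *\<^sub>C x = 0"
  and cscale_zero_right: "c *\<^sub>C (0::'a) = 0"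
  by (simp_all add: cvs.scale_right_diff_distrib cvs.scale_left_diff_distrib)

lemmas cscale_simps = cscale_right_distrib cscale_left_distrib cscale_cscale cscale_one
  cscale_minus_right cscale_diff_right cscale_minus_left cscale_diff_left cscale_zero_left
  cscale_zero_right

section \<open>Diagonalization\<close>

text \<open>For \<open>p \<noteq> 0\<close> of least degree with \<open>p(A) v = 0\<close> and a root \<open>r\<close> of \<open>p\<close>, the vector \<open>(p / (x - r))(A) v\<close> is an
  eigenvector; such a \<open>p\<close> exists because nine vectors are dependent.\<close>

lemma exists_eigenvector:
  fixes A :: so8
  shows "\<exists>v c. v \<noteq> 0 \<and> app A v = c *s v"
proof -
  define v where "v = (axis 1 1 :: complex^8)"
  have v: "v \<noteq> 0" by (simp add: v_def)
  define ev where "ev p = fold_coeffs (\<lambda>c w. c *s v + app A w) p 0" for p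
  have ev_0: "ev 0 = 0" by (simp add: ev_def)
  have ev_pCons: "ev (pCons c p) = c *s v + app A (ev p)" for c p
    by (cases "p = 0 \<and> c = 0") (auto simp: ev_def app_simps)
  have ev_add: "ev (p + q) = ev p + ev q" for p q
    by (induction p q rule: poly_induct2)
      (simp_all add: ev_0 ev_pCons app_simps vec.scale_left_distrib)
  have ev_smult: "ev (smult c p) = c *s ev p" for c p
    by (induction p) (simp_all add: ev_0 ev_pCons app_simps vec.scale_right_distrib)
  have ev_sum: "ev (\<Sum>i\<in>I. f i) = (\<Sum>i\<in>I. ev (f i))" for f :: "nat \<Rightarrow> complex poly" and I
    by (induction I rule: infinite_finite_induct) (simp_all add: ev_0 ev_add)
  have ev_monom: "ev (monom c i) = c *s ev (monom 1 i)" for c i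
    by (metis ev_smult mult.right_neutral smult_monom)
  have "\<exists>p. p \<noteq> 0 \<and> ev p = 0"
  proof (cases "inj_on (\<lambda>i. ev (monom 1 i)) {..8}")
    case False
    then obtain i j where ij: "i \<noteq> j" "ev (monom 1 i) = ev (monom 1 j)"
      by (auto simp: inj_on_def)
    have "ev (monom 1 i + monom (- 1) j) = 0"
      using ij by (simp add: ev_add ev_monom[of "- 1"])
    moreover have "coeff (monom 1 i + monom (- 1) j :: complex poly) i = 1"
      using ij by simp
    then have "monom 1 i + monom (- 1) j \<noteq> (0 :: complex poly)" by (metis coeff_0 zero_neq_one)
    ultimately show ?thesis by blast
  next
    case True
    let ?S = "(\<lambda>i. ev (monom 1 i)) ` {..8}"
    have "card ?S = 9" using True by (simp add: card_image)
    moreover have "vec.dim ?S \<le> 8"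
      using vec.dim_subset[of ?S UNIV] vec_dim_card[where 'a = complex and 'n = 8] by simp
    ultimately have "vec.dependent ?S"
      using vec.independent_card_le_dim[of ?S ?S] by auto
    then obtain w u where wu: "w \<in> ?S" "u w \<noteq> 0" "(\<Sum>x\<in>?S. u x *s x) = 0"
      using vec.dependent_finite[of ?S] by auto
    let ?p = "\<Sum>i\<in>{..8}. monom (u (ev (monom 1 i))) i"
    have "ev ?p = (\<Sum>i\<in>{..8}. u (ev (monom 1 i)) *s ev (monom 1 i))"
      unfolding ev_sum by (intro sum.cong refl ev_monom)
    also have "\<dots> = 0" using wu(3) sum.reindex[OF True, of "\<lambda>x. u x *s x"] by (simp add: o_def)
    finally have "ev ?p = 0" .
    moreover obtain i where i: "i \<in> {..8}" "w = ev (monom 1 i)" using wu by auto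
    have "coeff ?p i = u w" using i by (simp add: coeff_sum)
    then have "?p \<noteq> 0" using wu by auto
    ultimately show ?thesis by blast
  qed
  then have "\<exists>p. (p \<noteq> 0 \<and> ev p = 0) \<and> (\<forall>q. q \<noteq> 0 \<and> ev q = 0 \<longrightarrow> degree p \<le> degree q)"
    using ex_has_least_nat[of "\<lambda>p. p \<noteq> 0 \<and> ev p = 0" _ degree] by (elim exE)
  then obtain p where p: "p \<noteq> 0" "ev p = 0" and
    least: "\<And>q. q \<noteq> 0 \<Longrightarrow> ev q = 0 \<Longrightarrow> degree p \<le> degree q" by auto
  have "degree p \<noteq> 0"
  proof
    assume "degree p = 0"
    then obtain c where c: "p = [:c:]" using degree_eq_zeroE by blast
    then have "c *s v = 0" using p by (simp add: ev_0 ev_pCons app_simps)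
    then show False using v p c by (simp add: vec.scale_eq_0_iff)
  qed
  then obtain r where "poly p r = 0"
    using fundamental_theorem_of_algebra[of p] constant_degree[of p] by auto
  then obtain q where q: "p = [:- r, 1:] * q" using poly_eq_0_iff_dvd by (metis dvdE)
  have q0: "q \<noteq> 0" using p q by auto
  have "degree p = degree [:- r, 1:] + degree q"
    unfolding q by (rule degree_mult_eq) (use q0 in auto)
  then have "degree q < degree p" by simp
  then have "ev q \<noteq> 0" using least[OF q0] by auto
  moreover have "ev p = app A (ev q) - r *s ev q"
  proof -
    have "p = pCons 0 q + smult (- r) q" by (simp add: q)
    then show ?thesis by (simp add: ev_add ev_smult ev_pCons del: smult_minus_left)
  qed
  then have "app A (ev q) = r *s ev q" using p by simp
  ultimately show ?thesis by blast
qed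

abbreviation eigenvectors :: "so8 \<Rightarrow> (complex^8) set" where
  "eigenvectors A \<equiv> {v. \<exists>c. app A v = c *s v}"

text \<open>Applying the eigenvectors of \<open>ad A\<close> to an eigenvector \<open>u\<close> of \<open>A\<close> gives eigenvectors of
  \<open>A\<close>, and \<open>so(8)\<close> maps \<open>u\<close> onto the orthogonal complement of \<open>u\<close>.\<close>

lemma orthogonal_eigenvectors:
  assumes ad: "cvs.span (\<Union>c. ad_eigenspace A c) = UNIV"
    and u: "u \<noteq> 0" "app A u = b *s u" and w: "bil u w = 0"
  shows "w \<in> vec.span (eigenvectors A)"
proof -
  have mem: "app C u \<in> vec.span (eigenvectors A)" for C
  proof -
    have "C \<in> cvs.span (\<Union>c. ad_eigenspace A c)" using ad by simp
    then show ?thesis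
    proof (induction rule: cvs.span_induct_alt)
      case base
      then show ?case by (simp add: app_simps vec.span_zero)
    next
      case (step c D C)
      then obtain d where "lie A D = d *\<^sub>C D" by (auto simp: ad_eigenspace_def)
      then have "app A (app D u) = app (d *\<^sub>C D) u + app D (app A u)"
        using app_lie[of A D u] by simp
      then have "app A (app D u) = (d + b) *s app D u"
        by (simp add: u app_simps vec.scale_left_distrib)
      then have "app D u \<in> vec.span (eigenvectors A)" by (auto intro: vec.span_base)
      then show ?case using step by (simp add: app_simps vec.span_add vec.span_scale)
    qed
  qed
  obtain i where "u $ i \<noteq> 0" using u(1) by (auto simp: vec_eq_iff)
  then have "app (wedge w (inverse (u $ i) *s axis i 1)) u = w"
    using w by (simp add: app_wedge bil_simps bil_axis bil_commute[of _ u])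
  then show ?thesis using mem[of "wedge w (inverse (u $ i) *s axis i 1)"] by simp
qed

text \<open>Two independent eigenvectors \<open>u\<close> and \<open>w\<close> suffice, because their orthogonal complements together span
  the whole space. A second eigenvector exists, as otherwise every vector orthogonal to \<open>u\<close> would be a
  multiple of \<open>u\<close>.\<close>

lemma diagonalizable:
  assumes ad: "cvs.span (\<Union>c. ad_eigenspace A c) = UNIV"
  shows "vec.span (eigenvectors A) = UNIV"
proof -
  obtain u b where u: "u \<noteq> 0" "app A u = b *s u" using exists_eigenvector by blast
  obtain i where i: "u $ i \<noteq> 0" using u(1) by (auto simp: vec_eq_iff)
  have "\<exists>w. w \<in> eigenvectors A \<and> (\<forall>c. w \<noteq> c *s u)"
  proof (rule ccontr)
    assume "\<not> ?thesis"
    then have sub: "eigenvectors A \<subseteq> vec.span {u}" by (auto simp: vec.span_singleton)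
    have mult: "\<exists>c. w = c *s u" if "bil u w = 0" for w
    proof -
      have "vec.span (eigenvectors A) \<subseteq> vec.span {u}"
        using sub by (rule vec.span_minimal[OF _ vec.subspace_span])
      then show ?thesis
        using orthogonal_eigenvectors[OF ad u that] by (auto simp: vec.span_singleton)
    qed
    have "\<exists>j k. i \<noteq> j \<and> i \<noteq> k \<and> j \<noteq> k"
    proof -
      have "card (UNIV - {i} :: 8 set) = 7" by (simp add: card_Diff_singleton)
      then obtain j where j: "j \<in> UNIV - {i}" by (metis card.empty equals0I zero_neq_numeral)
      have "card (UNIV - {i} - {j} :: 8 set) = 6"
        using j \<open>card (UNIV - {i} :: 8 set) = 7\<close> by (simp add: card_Diff_singleton)
      then obtain k where "k \<in> UNIV - {i} - {j}" by (metis card.empty equals0I zero_neq_numeral)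
      then have "i \<noteq> j \<and> i \<noteq> k \<and> j \<noteq> k" using j by auto
      then show ?thesis by (intro exI)
    qed
    then obtain j k where jk: "i \<noteq> j" "i \<noteq> k" "j \<noteq> k" by blast
    have zero: "u $ k = 0" if ne: "i \<noteq> j" "i \<noteq> k" "j \<noteq> k" for j k
    proof -
      let ?w = "u $ j *s axis i 1 - u $ i *s axis j 1"
      have "bil u ?w = 0" by (simp add: bil_simps bil_axis)
      then obtain c where c: "?w = c *s u" using mult by blast
      have "?w $ j = - u $ i" "?w $ k = 0" using ne by (simp_all add: axis_def)
      then have "c * u $ j = - u $ i" "c * u $ k = 0" unfolding c by simp_all
      then show ?thesis using i by auto
    qed
    have "u $ j = 0" "u $ k = 0" using zero jk by metis+
    let ?w = "u $ k *s axis i 1 - u $ i *s axis k 1"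
    have "bil u ?w = 0" by (simp add: bil_simps bil_axis)
    then obtain c where c: "?w = c *s u" using mult by blast
    have "?w $ k = - u $ i" using jk by (simp add: axis_def)
    then have "c * u $ k = - u $ i" unfolding c by simp
    then show False using i \<open>u $ k = 0\<close> by simp
  qed
  then obtain w c where w: "app A w = c *s w" "\<And>c. w \<noteq> c *s u" by blast
  have w0: "w \<noteq> 0" using w(2)[of 0] by simp
  have "\<exists>j. w $ j * u $ i - w $ i * u $ j \<noteq> 0"
  proof (rule ccontr)
    assume "\<not> ?thesis"
    then have "w $ j = (w $ i / u $ i) * u $ j" for j using i by (simp add: field_simps)
    then have "w = (w $ i / u $ i) *s u" unfolding vec_eq_iff vector_smult_component by blast
    then show False using w(2) by blast
  qed
  then obtain j where j: "w $ j * u $ i - w $ i * u $ j \<noteq> 0" by blast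
  define r where "r = inverse (w $ j * u $ i - w $ i * u $ j) *s (w $ j *s axis i 1 - w $ i *s axis j 1)"
  have r: "bil w r = 0" "bil u r = 1"
    using j by (simp_all add: r_def bil_simps bil_axis mult.commute)
  have "x \<in> vec.span (eigenvectors A)" for x
  proof -
    have "x - bil u x *s r \<in> vec.span (eigenvectors A)"
      by (rule orthogonal_eigenvectors[OF ad u]) (simp add: bil_simps r)
    moreover have "bil u x *s r \<in> vec.span (eigenvectors A)"
      by (rule orthogonal_eigenvectors[OF ad w0 w(1)]) (simp add: bil_simps r)
    ultimately show ?thesis using vec.span_add by fastforce
  qed
  then show ?thesis by blast
qed

text \<open>Eigenvectors for different eigenvalues are independent; the eigenvalues themselves index the family.\<close>

lemma eigenvectors_independent:
  "finite F \<Longrightarrow> (\<And>c. c \<in> F \<Longrightarrow> app A (g c) = c *s g c) \<Longrightarrow> (\<Sum>c\<in>F. g c) = 0 \<Longrightarrow> c \<in> F \<Longrightarrow> g c = 0"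
proof (induction F arbitrary: g c rule: finite_induct)
  case (insert d F)
  have sum: "g d + (\<Sum>c\<in>F. g c) = 0" using insert by simp
  then have "app A (g d + (\<Sum>c\<in>F. g c)) = 0" by (simp add: app_simps)
  then have "d *s g d + (\<Sum>c\<in>F. c *s g c) = 0"
    using insert.prems by (simp add: app_simps app_sum_right)
  moreover have "d *s g d + (\<Sum>c\<in>F. d *s g c) = 0"
    using arg_cong[OF sum, of "\<lambda>x. d *s x"] by (simp add: vec.scale_right_distrib vec.scale_sum_right)
  ultimately have "(\<Sum>c\<in>F. c *s g c) - (\<Sum>c\<in>F. d *s g c) = 0"
    by (simp only: right_minus_eq) (metis add_left_imp_eq)
  then have "(\<Sum>c\<in>F. (c - d) *s g c) = 0" by (simp add: vec.scale_left_diff_distrib sum_subtractf)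
  moreover have "app A ((c - d) *s g c) = c *s ((c - d) *s g c)" if "c \<in> F" for c
    using insert.prems(1)[of c] that by (simp add: app_simps mult.commute)
  ultimately have "(c - d) *s g c = 0" if "c \<in> F" for c
    using insert.IH[of "\<lambda>c. (c - d) *s g c"] that by blast
  then have F0: "g c = 0" if "c \<in> F" for c
    using that insert.hyps by (metis eq_iff_diff_eq_0 vec.scale_eq_0_iff)
  then have "g d = 0" using sum by simp
  then show ?case using F0 insert.prems by auto
qed simp

lemma eigenvector_decomposition:
  assumes "v \<in> vec.span (eigenvectors A)"
  shows "\<exists>F g. finite F \<and> v = (\<Sum>c\<in>F. g c) \<and> (\<forall>c. app A (g c) = c *s g c) \<and> (\<forall>c. c \<notin> F \<longrightarrow> g c = 0)"
  using assms
proof (induction rule: vec.span_induct_alt)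
  case base
  show ?case by (rule exI[of _ "{}"], rule exI[of _ "\<lambda>_. 0"]) (simp add: app_simps)
next
  case (step a x y)
  then obtain d where d: "app A x = d *s x" by auto
  obtain F g where F: "finite F" "y = (\<Sum>c\<in>F. g c)" "\<forall>c. app A (g c) = c *s g c"
    "\<forall>c. c \<notin> F \<longrightarrow> g c = 0" using step by blast
  let ?g = "\<lambda>c. g c + (if c = d then a *s x else 0)"
  have "y = (\<Sum>c\<in>insert d F. g c)" using F by (cases "d \<in> F") (simp_all add: insert_absorb)
  then have "a *s x + y = (\<Sum>c\<in>insert d F. ?g c)" using F by (simp add: sum.distrib)
  moreover have "\<forall>c. app A (?g c) = c *s ?g c"
    using F d by (simp add: app_simps vec.scale_right_distrib mult.commute)
  ultimately show ?case
    using F by (intro exI[of _ "insert d F"] exI[of _ ?g]) auto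
qed

lemma simultaneously_diagonalizable:
  assumes "finite S"
    and "\<And>A B. A \<in> S \<Longrightarrow> B \<in> S \<Longrightarrow> lie A B = 0"
    and "\<And>A. A \<in> S \<Longrightarrow> vec.span (eigenvectors A) = UNIV"
  shows "vec.span {v. \<forall>A\<in>S. v \<in> eigenvectors A} = UNIV"
  using assms
proof (induction S rule: finite_induct)
  case (insert A S)
  have "v \<in> vec.span {v. \<forall>A\<in>insert A S. v \<in> eigenvectors A}" if v: "\<forall>B\<in>S. v \<in> eigenvectors B" for v
  proof -
    have "v \<in> vec.span (eigenvectors A)" using insert.prems(2)[of A] by simp
    from eigenvector_decomposition[OF this] obtain F g where
      F: "finite F" "v = (\<Sum>c\<in>F. g c)" "\<forall>c. app A (g c) = c *s g c"
      by (elim exE conjE) (rule that)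
    have "g c \<in> eigenvectors B" if B: "B \<in> S" and c: "c \<in> F" for B c
    proof -
      obtain m where m: "app B v = m *s v" using v B by blast
      have comm: "app A (app B x) = app B (app A x)" for x
        using app_lie[of A B x] insert.prems(1)[of A B] B by (simp add: app_simps)
      have "(\<Sum>c\<in>F. app B (g c) - m *s g c) = 0"
        using m unfolding F(2) by (simp add: app_sum_right sum_subtractf vec.scale_sum_right)
      moreover have "app A (app B (g c) - m *s g c) = c *s (app B (g c) - m *s g c)" for c
        using F(3) by (simp add: app_simps comm vec.scale_right_diff_distrib mult.commute)
      ultimately have "app B (g c) - m *s g c = 0"
        using eigenvectors_independent[of F A "\<lambda>c. app B (g c) - m *s g c", OF F(1)] c by blast
      then show ?thesis by auto
    qed
    then have "g c \<in> vec.span {v. \<forall>A\<in>insert A S. v \<in> eigenvectors A}" if "c \<in> F" for c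
      using F(3) that by (intro vec.span_base) blast
    then show ?thesis unfolding F(2) by (rule vec.span_sum)
  qed
  then have "vec.span {v. \<forall>B\<in>S. v \<in> eigenvectors B} \<subseteq> vec.span {v. \<forall>A\<in>insert A S. v \<in> eigenvectors A}"
    by (intro vec.span_minimal subsetI) (auto simp: vec.subspace_span)
  moreover have "vec.span {v. \<forall>B\<in>S. v \<in> eigenvectors B} = UNIV"
    using insert.IH insert.prems by blast
  ultimately show ?case by blast
qed simp

section \<open>Witt bases of weight vectors\<close>

abbreviation weight_vectors :: "so8 set \<Rightarrow> (complex^8) set" where
  "weight_vectors h \<equiv> {v. \<forall>A\<in>h. v \<in> eigenvectors A}"

text \<open>Invariance of the form forces opposite weights on two weight vectors that are not orthogonal.\<close>

definition weight_pair :: "so8 set \<Rightarrow> complex^8 \<Rightarrow> complex^8 \<Rightarrow> bool" where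
  "weight_pair h e f \<longleftrightarrow> (\<forall>A\<in>h. \<exists>c. app A e = c *s e \<and> app A f = (- c) *s f)"

lemma bil_axis_left: "bil (axis i 1) u = u $ i"
  by (simp only: bil_commute[of "axis i 1"] bil_axis)

lemma finite_spanning: "\<exists>T. finite T \<and> cvs.span T = (UNIV :: so8 set)"
proof (intro exI conjI)
  let ?T = "range (\<lambda>(i::8, j::8). wedge (axis i 1) (axis j 1))"
  show "finite ?T" by simp
  have *: "wedge u (axis j 1) \<in> cvs.span ?T" for u j
  proof -
    have "wedge u (axis j 1) = wedge (\<Sum>i\<in>UNIV. u $ i *s axis i 1) (axis j 1)"
      by (simp only: basis_expansion)
    also have "\<dots> = (\<Sum>i\<in>UNIV. u $ i *\<^sub>C wedge (axis i 1) (axis j 1))"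
    proof -
      have "wedge (\<Sum>i\<in>I. u $ i *s axis i 1) w = (\<Sum>i\<in>I. u $ i *\<^sub>C wedge (axis i 1) w)" for I w
        by (induction I rule: infinite_finite_induct) (simp_all add: wedge_simps)
      then show ?thesis .
    qed
    also have "\<dots> \<in> cvs.span ?T"
    proof (intro cvs.span_sum cvs.span_scale cvs.span_base)
      show "wedge (axis i 1) (axis j 1) \<in> ?T" for i by (rule range_eqI[of _ _ "(i, j)"]) simp
    qed
    finally show ?thesis .
  qed
  have "A \<in> cvs.span ?T" for A
  proof -
    have "A = (1/2) *\<^sub>C (\<Sum>j\<in>UNIV. wedge (app A (axis j 1)) (axis j 1))"
    proof (rule app_eqI)
      fix x
      have sum: "app (\<Sum>j\<in>I. g j) x = (\<Sum>j\<in>I. app (g j) x)" for g :: "8 \<Rightarrow> so8" and I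
        by (induction I rule: infinite_finite_induct) (simp_all add: app_simps)
      have "app (\<Sum>j\<in>UNIV. wedge (app A (axis j 1)) (axis j 1)) x
          = (\<Sum>j\<in>UNIV. x $ j *s app A (axis j 1)) + (\<Sum>j\<in>UNIV. app A x $ j *s axis j 1)"
        by (simp only: sum app_wedge bil_app bil_axis_left vec.scale_minus_left diff_minus_eq_add
            sum.distrib)
      also have "(\<Sum>j\<in>UNIV. x $ j *s app A (axis j 1)) = app A (\<Sum>j\<in>UNIV. x $ j *s axis j 1)"
        by (simp only: app_sum_right app_scale_right)
      finally show "app A x = app ((1/2) *\<^sub>C (\<Sum>j\<in>UNIV. wedge (app A (axis j 1)) (axis j 1))) x"
        by (simp add: basis_expansion app_simps vec_eq_iff)
    qed
    moreover have "\<dots> \<in> cvs.span ?T" by (intro cvs.span_scale cvs.span_sum *)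
    ultimately show ?thesis by (simp only:)
  qed
  then show "cvs.span ?T = UNIV" by blast
qed

lemma finite_spanning_subset:
  fixes h :: "so8 set"
  shows "\<exists>S. finite S \<and> S \<subseteq> h \<and> h \<subseteq> cvs.span S"
proof -
  obtain T where T: "finite T" "cvs.span T = (UNIV :: so8 set)" using finite_spanning by blast
  obtain S where S: "S \<subseteq> h" "cvs.independent S" "h \<subseteq> cvs.span S"
    using cvs.maximal_independent_subset[of h] by metis
  then have "finite S" using cvs.independent_span_bound[OF T(1) S(2)] T(2) by simp
  then show ?thesis using S by blast
qed

lemma weight_vectors_span:
  assumes h: "cartan_subalgebra h"
  shows "vec.span (weight_vectors h) = UNIV"
proof -
  obtain S where S: "finite S" "S \<subseteq> h" "h \<subseteq> cvs.span S" using finite_spanning_subset by blast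
  have "vec.span (weight_vectors S) = UNIV"
  proof (rule simultaneously_diagonalizable[OF S(1)])
    fix A assume "A \<in> S"
    then have "A \<in> h" using S by blast
    then show "vec.span (eigenvectors A) = UNIV"
      using h by (intro diagonalizable) (unfold cartan_subalgebra_def, blast)
  next
    fix A B assume "A \<in> S" "B \<in> S"
    then show "lie A B = 0" using h S(2) unfolding cartan_subalgebra_def by blast
  qed
  moreover have "weight_vectors S \<subseteq> weight_vectors h"
  proof safe
    fix v A assume v: "\<forall>A\<in>S. v \<in> eigenvectors A" and "A \<in> h"
    then have "A \<in> cvs.span S" using S by blast
    then show "\<exists>c. app A v = c *s v"
    proof (induction rule: cvs.span_induct_alt)
      case base
      show ?case by (rule exI[of _ 0]) (simp add: app_simps)
    next
      case (step a B C)
      then obtain b c where "app B v = b *s v" "app C v = c *s v" using v by blast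
      then show ?case
        by (intro exI[of _ "a * b + c"]) (simp add: app_simps vec.scale_left_distrib)
    qed
  qed
  ultimately show ?thesis using vec.span_mono by blast
qed

definition hyperbolic_system ::
  "so8 set \<Rightarrow> nat \<Rightarrow> (nat \<Rightarrow> complex^8) \<Rightarrow> (nat \<Rightarrow> complex^8) \<Rightarrow> bool" where
  "hyperbolic_system h k e f \<longleftrightarrow>
     (\<forall>i<k. \<forall>j<k. bil (e i) (e j) = 0 \<and> bil (f i) (f j) = 0 \<and> bil (e i) (f j) = (if i = j then 1 else 0)) \<and>
     (\<forall>i<k. weight_pair h (e i) (f i))"

text \<open>Project two further weight vectors to the orthogonal complement of the system. An anisotropic weight
  vector has weight zero, so if neither projection is isotropic, then every combination of the two is
  again a weight vector, and some combination is isotropic. Its partner is corrected by a multiple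
  of it to become isotropic as well. For three pairs or fewer there is room for two new vectors.\<close>

lemma hyperbolic_system_extend:
  assumes span: "vec.span (weight_vectors h) = UNIV" and sys: "hyperbolic_system h k e f" and k: "k < 4"
  shows "\<exists>e' f'. hyperbolic_system h (Suc k) (e(k := e')) (f(k := f'))"
proof -
  have ee: "bil (e i) (e j) = 0" and ff: "bil (f i) (f j) = 0"
    and ef: "bil (e i) (f j) = (if i = j then 1 else 0)"
    and fe: "bil (f i) (e j) = (if i = j then 1 else 0)"
    and wt: "weight_pair h (e i) (f i)" if "i < k" "j < k" for i j
    using sys that bil_commute[of "f i" "e j"] by (auto simp: hyperbolic_system_def)
  define proj where "proj v = v - (\<Sum>i<k. bil v (f i) *s e i + bil v (e i) *s f i)" for v
  have proj_e: "bil (proj v) (e j) = 0" and proj_f: "bil (proj v) (f j) = 0" if "j < k" for v j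
  proof -
    have "(\<Sum>i<k. bil (bil v (f i) *s e i + bil v (e i) *s f i) (e j)) = (\<Sum>i<k. if i = j then bil v (e i) else 0)"
      "(\<Sum>i<k. bil (bil v (f i) *s e i + bil v (e i) *s f i) (f j)) = (\<Sum>i<k. if i = j then bil v (f i) else 0)"
      by (rule sum.cong; use that in \<open>simp add: bil_simps ee ff ef fe\<close>)+
    then show "bil (proj v) (e j) = 0" "bil (proj v) (f j) = 0"
      using that by (simp_all add: proj_def bil_diff_left bil_sum_left)
  qed
  have proj_orth: "bil w (proj v) = bil w v" if "\<And>i. i < k \<Longrightarrow> bil w (e i) = 0 \<and> bil w (f i) = 0" for v w
  proof -
    have "bil (\<Sum>i<k. bil v (f i) *s e i + bil v (e i) *s f i) w = 0"
      unfolding bil_sum_left by (rule sum.neutral) (use that in \<open>simp add: bil_simps bil_commute[of _ w]\<close>)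
    then show ?thesis by (simp add: proj_def bil_diff_right bil_commute[of w])
  qed
  have proj_weight: "app A (proj v) = c *s proj v" if A: "A \<in> h" and v: "app A v = c *s v" for A v c
  proof -
    have "app A (bil v (f i) *s e i + bil v (e i) *s f i) = c *s (bil v (f i) *s e i + bil v (e i) *s f i)"
      if i: "i < k" for i
    proof -
      obtain d where d: "app A (e i) = d *s e i" "app A (f i) = (- d) *s f i"
        using wt[OF i i] A by (auto simp: weight_pair_def)
      have eqs: "bil v (f i) * d = c * bil v (f i)" "bil v (e i) * - d = c * bil v (e i)"
        using bil_app[of A v "f i"] bil_app[of A v "e i"] by (auto simp: v d bil_simps mult.commute)
      show ?thesis
        by (simp only: app_add_right app_scale_right d vec.scale_right_distrib vec.scale_scale eqs)
    qed
    then have "(\<Sum>i<k. app A (bil v (f i) *s e i + bil v (e i) *s f i))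
        = c *s (\<Sum>i<k. bil v (f i) *s e i + bil v (e i) *s f i)"
      unfolding vec.scale_sum_right by (intro sum.cong) auto
    then show ?thesis
      by (simp only: proj_def app_diff_right app_sum_right v vec.scale_right_diff_distrib)
  qed
  let ?S = "e ` {..<k} \<union> f ` {..<k}"
  have S: "finite ?S" "card ?S \<le> 6"
    using card_Un_le[of "e ` {..<k}" "f ` {..<k}"] card_image_le[of "{..<k}" e]
      card_image_le[of "{..<k}" f] k by auto
  have outside: "\<exists>w\<in>weight_vectors h. w \<notin> vec.span R" if "finite R" "card R < 8" for R
  proof (rule ccontr)
    assume "\<not> ?thesis"
    then have "vec.span (weight_vectors h) \<subseteq> vec.span R"
      by (intro vec.span_minimal vec.subspace_span) blast
    then have "vec.dim (UNIV :: (complex^8) set) \<le> card R"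
      using that span by (intro vec.dim_le_card) auto
    then show False using that vec_dim_card[where 'a = complex and 'n = 8] by simp
  qed
  have proj_diff: "v - proj v \<in> vec.span ?S" for v
  proof -
    have "v - proj v = (\<Sum>i<k. bil v (f i) *s e i + bil v (e i) *s f i)" by (simp add: proj_def)
    also have "\<dots> \<in> vec.span ?S"
      by (intro vec.span_sum vec.span_add vec.span_scale vec.span_base) auto
    finally show ?thesis .
  qed
  obtain w1 where w1: "w1 \<in> weight_vectors h" "w1 \<notin> vec.span ?S"
    using outside[of ?S] S by auto
  have "card (insert w1 ?S) \<le> 7" using S card_insert_le_m1 by (simp add: card_insert_if)
  then obtain w2 where w2: "w2 \<in> weight_vectors h" "w2 \<notin> vec.span (insert w1 ?S)"
    using outside[of "insert w1 ?S"] S by auto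
  let ?u = "proj w1" and ?v = "proj w2"
  have u0: "?u \<noteq> 0" using w1(2) proj_diff[of w1] by auto
  have v0: "?v \<noteq> c *s ?u" for c
  proof
    assume eq: "?v = c *s ?u"
    have span: "x - proj x \<in> vec.span (insert w1 ?S)" for x
      using proj_diff[of x] vec.span_mono[of ?S "insert w1 ?S"] by blast
    have "w1 \<in> vec.span (insert w1 ?S)" by (simp add: vec.span_base)
    then have "(w2 - ?v) + c *s (w1 - (w1 - ?u)) \<in> vec.span (insert w1 ?S)"
      by (intro vec.span_add vec.span_scale vec.span_diff span)
    then show False using w2(2) eq by simp
  qed
  have wu: "proj w \<in> weight_vectors h" if "w \<in> weight_vectors h" for w
    using that proj_weight by blast
  have nonisotropic: "app A w = 0" if "w \<in> weight_vectors h" "bil w w \<noteq> 0" "A \<in> h" for w A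
  proof -
    obtain c where c: "app A w = c *s w" using \<open>w \<in> weight_vectors h\<close> \<open>A \<in> h\<close> by blast
    have "c * bil w w = - c * bil w w"
      using bil_app[of A w w] by (simp add: c bil_simps)
    then have "c = 0" using that by simp
    then show ?thesis using c by simp
  qed
  have "\<exists>e'. e' \<noteq> 0 \<and> bil e' e' = 0 \<and> e' \<in> weight_vectors h \<and>
     (\<forall>i<k. bil e' (e i) = 0 \<and> bil e' (f i) = 0)"
  proof (cases "bil ?u ?u = 0 \<or> bil ?v ?v = 0")
    case True
    then obtain w where w: "w \<in> {w1, w2}" "bil (proj w) (proj w) = 0" by auto
    moreover have "proj w \<noteq> 0" using w u0 v0[of 0] by auto
    moreover have "proj w \<in> weight_vectors h" using w wu w1(1) w2(1) by blast
    ultimately show ?thesis using proj_e proj_f by blast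
  next
    case False
    define t where "t = (- bil ?u ?v + csqrt ((bil ?u ?v)\<^sup>2 - bil ?u ?u * bil ?v ?v)) / bil ?v ?v"
    let ?e = "?u + t *s ?v"
    have "?e \<noteq> 0"
    proof
      assume e0: "?e = 0"
      show False
      proof (cases "t = 0")
        case True
        then show False using e0 u0 by simp
      next
        case False
        have "?v = (- inverse t) *s ?u"
          using arg_cong[OF e0, of "\<lambda>x. inverse t *s x"] False
          by (simp add: vec.scale_right_distrib vec.scale_minus_left add_eq_0_iff)
        then show False using v0 by blast
      qed
    qed
    moreover have "bil ?e ?e = 0"
    proof -
      have t: "t * bil ?v ?v = - bil ?u ?v + csqrt ((bil ?u ?v)\<^sup>2 - bil ?u ?u * bil ?v ?v)"
        using False by (simp add: t_def)
      have "(t * bil ?v ?v + bil ?u ?v)\<^sup>2 = (bil ?u ?v)\<^sup>2 - bil ?u ?u * bil ?v ?v"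
        unfolding t by simp
      then have "bil ?v ?v * (bil ?u ?u + 2 * t * bil ?u ?v + t * t * bil ?v ?v) = 0"
        by (simp add: power2_eq_square algebra_simps)
      then have "bil ?u ?u + 2 * t * bil ?u ?v + t * t * bil ?v ?v = 0" using False by simp
      then show ?thesis by (simp add: bil_simps bil_commute[of ?v ?u] algebra_simps)
    qed
    moreover have "?e \<in> weight_vectors h"
    proof safe
      fix A assume "A \<in> h"
      then have "app A ?e = 0 *s ?e"
        using False nonisotropic[OF wu[OF w1(1)], of A] nonisotropic[OF wu[OF w2(1)], of A]
        by (simp add: app_simps)
      then show "\<exists>c. app A ?e = c *s ?e" by blast
    qed
    moreover have "\<forall>i<k. bil ?e (e i) = 0 \<and> bil ?e (f i) = 0"
      using proj_e proj_f by (simp add: bil_simps)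
    ultimately show ?thesis by blast
  qed
  then obtain e' where e': "e' \<noteq> 0" "bil e' e' = 0" "e' \<in> weight_vectors h"
    "\<And>i. i < k \<Longrightarrow> bil e' (e i) = 0 \<and> bil e' (f i) = 0" by blast
  have "\<exists>w\<in>weight_vectors h. bil e' w \<noteq> 0"
  proof (rule ccontr)
    assume "\<not> ?thesis"
    then have orth: "bil e' w = 0" if "w \<in> weight_vectors h" for w using that by blast
    have "bil e' x = 0" for x
    proof -
      have "x \<in> vec.span (weight_vectors h)" using span by simp
      then show ?thesis
        by (induction rule: vec.span_induct_alt) (use orth in \<open>auto simp: bil_simps\<close>)
    qed
    then show False using bil_eqI[of e' 0] e'(1) by (simp add: bil_simps)
  qed
  then obtain w where w: "w \<in> weight_vectors h" "bil e' w \<noteq> 0" by blast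
  define w' where "w' = inverse (bil e' w) *s proj w"
  have w': "bil e' w' = 1" using w proj_orth[OF e'(4)] by (simp add: w'_def bil_simps)
  define f' where "f' = w' - (bil w' w' / 2) *s e'"
  have e'w': "bil w' e' = 1" using w' by (simp add: bil_commute)
  have f'1: "bil e' f' = 1" "bil f' f' = 0"
    by (simp_all add: f'_def bil_simps w' e'w' e'(2))
  have f'2: "bil f' (e i) = 0" "bil f' (f i) = 0" if "i < k" for i
    using that e'(4) by (simp_all add: f'_def w'_def bil_simps proj_e proj_f)
  have "weight_pair h e' f'"
    unfolding weight_pair_def
  proof
    fix A assume A: "A \<in> h"
    obtain c where c: "app A e' = c *s e'" using e'(3) A by blast
    obtain d where "app A w = d *s w" using w(1) A by blast
    then have "app A (proj w) = d *s proj w" by (rule proj_weight[OF A])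
    then have d: "app A w' = d *s w'" by (simp add: w'_def app_simps mult.commute)
    have cd: "c = - d" using bil_app[of A e' w'] by (simp add: c d bil_simps w')
    have dw: "d * bil w' w' = 0" using bil_app[of A w' w'] by (simp add: d bil_simps)
    have "app A f' = (- c) *s f'"
      using dw by (auto simp: f'_def app_simps c d cd vec.scale_right_diff_distrib)
    then show "\<exists>c. app A e' = c *s e' \<and> app A f' = (- c) *s f'" using c by blast
  qed
  then have "hyperbolic_system h (Suc k) (e(k := e')) (f(k := f'))"
    using f'1 f'2 e' ee ff ef wt by (auto simp: hyperbolic_system_def less_Suc_eq bil_commute)
  then show ?thesis by blast
qed

lemma hyperbolic_system_exists:
  assumes span: "vec.span (weight_vectors h) = UNIV"
  shows "k \<le> 4 \<Longrightarrow> \<exists>e f. hyperbolic_system h k e f"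
proof (induction k)
  case 0
  then show ?case by (simp add: hyperbolic_system_def)
next
  case (Suc k)
  then show ?case using hyperbolic_system_extend[OF span] by (metis Suc_leD Suc_le_lessD)
qed

definition signed_indices :: "int set" where
  "signed_indices = {- 4, - 3, - 2, - 1, 1, 2, 3, 4}"

locale witt_basis =
  fixes v :: "int \<Rightarrow> complex^8"
  assumes bil_v: "s \<in> signed_indices \<Longrightarrow> t \<in> signed_indices \<Longrightarrow> bil (v s) (v t) = (if s + t = 0 then 1 else 0)"

text \<open>In the basis \<open>v\<close> the elements of \<open>h\<close> are precisely the diagonal ones: a Cartan subalgebra
  contains every element that commutes with it.\<close>

locale cartan_basis = witt_basis +
  fixes h :: "so8 set"
  assumes h_iff: "A \<in> h \<longleftrightarrow> (\<forall>s\<in>signed_indices. \<exists>c. app A (v s) = c *s v s)"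

context witt_basis
begin

lemma finite_signed: "finite signed_indices" and card_signed: "card signed_indices = 8"
  and signed_uminus: "- s \<in> signed_indices \<longleftrightarrow> s \<in> signed_indices"
  and signed_nonzero: "s \<in> signed_indices \<Longrightarrow> s \<noteq> 0"
  by (auto simp: signed_indices_def)

lemma orthogonal_imp_zero:
  assumes "\<And>s. s \<in> signed_indices \<Longrightarrow> bil x (v s) = 0"
  shows "x = 0"
proof -
  have inj: "inj_on v signed_indices"
  proof (rule inj_onI)
    fix s t assume st: "s \<in> signed_indices" "t \<in> signed_indices" "v s = v t"
    have "bil (v s) (v (- s)) = 1" using bil_v[OF st(1), of "- s"] st by (simp add: signed_uminus)
    moreover have "bil (v t) (v (- s)) = (if t + - s = 0 then 1 else 0)"
      by (rule bil_v) (use st in \<open>simp_all add: signed_uminus\<close>)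
    ultimately have "t + - s = 0" using st(3) by (metis zero_neq_one)
    then show "s = t" by simp
  qed
  have "vec.independent (v ` signed_indices)"
  proof (rule vec.independent_if_scalars_zero)
    show "finite (v ` signed_indices)" by (simp add: finite_signed)
    fix f w assume sum: "(\<Sum>w\<in>v ` signed_indices. f w *s w) = 0" and "w \<in> v ` signed_indices"
    then obtain s where s: "s \<in> signed_indices" "w = v s" by blast
    have "0 = bil (\<Sum>t\<in>signed_indices. f (v t) *s v t) (v (- s))"
      using sum by (simp add: sum.reindex[OF inj] bil_simps)
    also have "\<dots> = (\<Sum>t\<in>signed_indices. if t = s then f (v s) else 0)"
      unfolding bil_sum_left using s by (intro sum.cong) (auto simp: bil_simps bil_v signed_uminus)
    finally show "f w = 0" using s by (simp add: finite_signed)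
  qed
  moreover have "card (v ` signed_indices) = 8" by (simp add: card_image[OF inj] card_signed)
  ultimately have "vec.span (v ` signed_indices) = UNIV"
    using vec.card_ge_dim_independent[of "v ` signed_indices" UNIV]
      vec_dim_card[where 'a = complex and 'n = 8] by auto
  then have "bil x w = 0" for w
  proof -
    have "w \<in> vec.span (v ` signed_indices)"
      using \<open>vec.span (v ` signed_indices) = UNIV\<close> by blast
    then show ?thesis
      by (induction rule: vec.span_induct_alt) (use assms in \<open>auto simp: bil_simps\<close>)
  qed
  then show ?thesis using bil_eqI[of x 0] by (simp add: bil_simps)
qed

lemma basis_eqI: "(\<And>s. s \<in> signed_indices \<Longrightarrow> bil x (v s) = bil y (v s)) \<Longrightarrow> x = y"
  using orthogonal_imp_zero[of "x - y"] by (simp add: bil_simps)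

lemma app_basis_eqI:
  assumes "\<And>s. s \<in> signed_indices \<Longrightarrow> app A (v s) = app B (v s)"
  shows "A = B"
  by (rule app_eqI, rule basis_eqI) (simp add: bil_app assms)

end

lemma witt_basis_exists:
  assumes h: "cartan_subalgebra h"
  shows "\<exists>v. cartan_basis v h"
proof -
  obtain e f where ef: "hyperbolic_system h 4 e f"
    using hyperbolic_system_exists[OF weight_vectors_span[OF h], of 4] by blast
  define v where "v s = (if s > 0 then e (nat (s - 1)) else f (nat (- s - 1)))" for s :: int
  have ef1: "bil (e i) (e j) = 0" "bil (f i) (f j) = 0" "bil (e i) (f j) = (if i = j then 1 else 0)"
    "bil (f i) (e j) = (if i = j then 1 else 0)" if "i < 4" "j < 4" for i j
    using ef that by (auto simp: hyperbolic_system_def bil_commute[of "f i" "e j"])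
  interpret witt_basis v
  proof
    fix s t :: int
    assume "s \<in> signed_indices" "t \<in> signed_indices"
    then show "bil (v s) (v t) = (if s + t = 0 then 1 else 0)"
      unfolding signed_indices_def v_def by (auto simp: ef1)
  qed
  have wp: "weight_pair h (e i) (f i)" if "i < 4" for i
    using ef that by (simp add: hyperbolic_system_def)
  have diag: "\<exists>c. app A (v s) = c *s v s" if "s \<in> signed_indices" "A \<in> h" for s A
  proof -
    have "nat (s - 1) < 4" "nat (- s - 1) < 4" using that by (auto simp: signed_indices_def)
    from this[THEN wp] that(2) show ?thesis unfolding v_def weight_pair_def
      by (cases "s > 0", simp_all only: if_True if_False) blast+
  qed
  have "cartan_basis v h"
  proof
    fix A
    show "A \<in> h \<longleftrightarrow> (\<forall>s\<in>signed_indices. \<exists>c. app A (v s) = c *s v s)"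
    proof
      assume A: "\<forall>s\<in>signed_indices. \<exists>c. app A (v s) = c *s v s"
      have "lie B A = 0" if B: "B \<in> h" for B
      proof (rule app_basis_eqI)
        fix s assume s: "s \<in> signed_indices"
        obtain b c where "app A (v s) = c *s v s" "app B (v s) = b *s v s"
          using A diag[OF s B] s by blast
        then show "app (lie B A) (v s) = app 0 (v s)"
          by (simp add: app_lie app_simps mult.commute)
      qed
      then show "A \<in> h" using h unfolding cartan_subalgebra_def by blast
    qed (use diag in blast)
  qed
  then show ?thesis by blast
qed

section \<open>Roots of a Cartan subalgebra\<close>

context witt_basis
begin

text \<open>The coefficient of \<open>wedge (v s) (v t)\<close>, cf. \<open>entry_wedge\<close>.\<close>

definition entry :: "so8 \<Rightarrow> int \<Rightarrow> int \<Rightarrow> complex" where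
  "entry A s t = bil (app A (v (- t))) (v (- s))"

lemma entry_add: "entry (A + B) s t = entry A s t + entry B s t"
  and entry_scale: "entry (c *\<^sub>C A) s t = c * entry A s t"
  and entry_diff: "entry (A - B) s t = entry A s t - entry B s t"
  and entry_minus: "entry (- A) s t = - entry A s t"
  and entry_zero: "entry 0 s t = 0"
  by (simp_all add: entry_def app_simps bil_simps)

lemmas entry_simps = entry_add entry_scale entry_diff entry_minus entry_zero

lemma entry_swap: "entry A t s = - entry A s t"
proof -
  have "bil (app A (v (- s))) (v (- t)) = - bil (v (- s)) (app A (v (- t)))" by (rule bil_app)
  then show ?thesis unfolding entry_def bil_commute[of "v (- s)"] .
qed

lemma bil_v_uminus:
  assumes "s \<in> signed_indices" "t \<in> signed_indices"
  shows "bil (v s) (v (- t)) = (if s = t then 1 else 0)"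
  using bil_v[of s "- t"] assms by (simp add: signed_uminus)

lemma entry_wedge:
  assumes "s \<in> signed_indices" "t \<in> signed_indices" "p \<in> signed_indices" "q \<in> signed_indices"
  shows "entry (wedge (v s) (v t)) p q =
    (if s = p \<and> t = q then 1 else 0) - (if s = q \<and> t = p then 1 else 0)"
proof -
  have "entry (wedge (v s) (v t)) p q =
      (if t = q then 1 else 0) * (if s = p then 1 else 0) - (if s = q then 1 else 0) * (if t = p then 1 else 0)"
    using assms by (simp only: entry_def app_wedge bil_diff_left bil_scale_left bil_v_uminus)
  then show ?thesis by (simp only: mult_1_left mult_1_right mult_zero_left mult_zero_right split: if_split) simp
qed

lemma entry_eqI:
  assumes "\<And>s t. s \<in> signed_indices \<Longrightarrow> t \<in> signed_indices \<Longrightarrow> entry A s t = entry B s t"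
  shows "A = B"
proof (rule app_basis_eqI, rule basis_eqI)
  fix s t assume "s \<in> signed_indices" "t \<in> signed_indices"
  then show "bil (app A (v s)) (v t) = bil (app B (v s)) (v t)"
    using assms[of "- t" "- s"] by (simp add: entry_def signed_uminus)
qed

lemma app_wedge_basis:
  assumes "s \<in> signed_indices" "t \<in> signed_indices" "p \<in> signed_indices"
  shows "app (wedge (v s) (v t)) (v p) = (if t + p = 0 then v s else 0) - (if s + p = 0 then v t else 0)"
  using assms by (simp add: app_wedge bil_v)

end

context cartan_basis
begin

definition eps :: "int \<Rightarrow> so8 \<Rightarrow> complex" where
  "eps s A = (if A \<in> h then bil (app A (v s)) (v (- s)) else 0)"

definition torus :: "int \<Rightarrow> so8" where
  "torus s = wedge (v s) (v (- s))"

lemma app_h: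
  assumes A: "A \<in> h" and s: "s \<in> signed_indices"
  shows "app A (v s) = eps s A *s v s"
proof -
  obtain c where c: "app A (v s) = c *s v s" using A s h_iff by blast
  have "bil (v s) (v (- s)) = 1" using bil_v[OF s, of "- s"] s by (simp add: signed_uminus)
  then have "eps s A = c" using A by (simp add: eps_def c bil_simps)
  then show ?thesis using c by simp
qed

lemma eps_uminus: "eps (- s) = - eps s"
proof
  show "eps (- s) A = (- eps s) A" for A
    using bil_app[of A "v (- s)" "v s"] by (simp add: eps_def bil_commute)
qed

lemma h_add: "A \<in> h \<Longrightarrow> B \<in> h \<Longrightarrow> A + B \<in> h"
proof -
  assume AB: "A \<in> h" "B \<in> h"
  show "A + B \<in> h"
    unfolding h_iff
  proof
    fix s assume s: "s \<in> signed_indices"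
    show "\<exists>c. app (A + B) (v s) = c *s v s"
      by (rule exI[of _ "eps s A + eps s B"])
        (simp add: app_simps app_h[OF AB(1) s] app_h[OF AB(2) s] vec.scale_left_distrib)
  qed
qed

lemma h_scale: "A \<in> h \<Longrightarrow> c *\<^sub>C A \<in> h"
proof -
  assume A: "A \<in> h"
  show "c *\<^sub>C A \<in> h"
    unfolding h_iff
  proof
    fix s assume s: "s \<in> signed_indices"
    show "\<exists>d. app (c *\<^sub>C A) (v s) = d *s v s"
      by (rule exI[of _ "c * eps s A"]) (simp add: app_simps app_h[OF A s])
  qed
qed

lemma eps_add: "A \<in> h \<Longrightarrow> B \<in> h \<Longrightarrow> eps s (A + B) = eps s A + eps s B"
  and eps_scale: "A \<in> h \<Longrightarrow> eps s (c *\<^sub>C A) = c * eps s A"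
  and eps_outside: "A \<notin> h \<Longrightarrow> eps s A = 0"
  by (simp_all add: eps_def h_add h_scale app_simps bil_simps)

lemma torus_h: "s \<in> signed_indices \<Longrightarrow> torus s \<in> h"
proof -
  assume s: "s \<in> signed_indices"
  show "torus s \<in> h"
    unfolding h_iff torus_def
  proof
    fix t assume "t \<in> signed_indices"
    then show "\<exists>c. app (wedge (v s) (v (- s))) (v t) = c *s v t"
      using s app_wedge_basis[of s "- s" t] signed_nonzero[OF s]
      by (intro exI[of _ "if t = s then 1 else if t = - s then - 1 else 0"])
        (auto simp: signed_uminus)
  qed
qed

lemma eps_torus:
  assumes "s \<in> signed_indices" "t \<in> signed_indices"
  shows "eps t (torus s) = (if t = s then 1 else 0) - (if t = - s then 1 else 0)"
  using assms torus_h[OF assms(1)] app_wedge_basis[of s "- s" t] signed_nonzero[OF assms(1)]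
  by (auto simp: eps_def torus_def bil_simps bil_v signed_uminus)

lemma entry_lie_h:
  assumes A: "A \<in> h" and st: "s \<in> signed_indices" "t \<in> signed_indices"
  shows "entry (lie A C) s t = (eps s A + eps t A) * entry C s t"
proof -
  have "bil (app A (app C (v (- t)))) (v (- s)) = eps s A * entry C s t"
    using app_h[OF A, of "- s"] st
    by (simp add: bil_app[of A] entry_def signed_uminus eps_uminus bil_simps)
  moreover have "bil (app C (app A (v (- t)))) (v (- s)) = - eps t A * entry C s t"
    using app_h[OF A, of "- t"] st by (simp add: entry_def signed_uminus eps_uminus app_simps bil_simps)
  ultimately show ?thesis by (simp add: entry_def app_lie bil_simps distrib_right)
qed

lemma lie_h_wedge:
  "A \<in> h \<Longrightarrow> s \<in> signed_indices \<Longrightarrow> t \<in> signed_indices \<Longrightarrow>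
    lie A (wedge (v s) (v t)) = (eps s A + eps t A) *\<^sub>C wedge (v s) (v t)"
  by (simp add: lie_wedge app_h wedge_simps cscale_simps)

definition root_pair :: "int \<Rightarrow> int \<Rightarrow> bool" where
  "root_pair s t \<longleftrightarrow> s \<in> signed_indices \<and> t \<in> signed_indices \<and> s \<noteq> t \<and> s \<noteq> - t"

lemma root_pair_uminus: "root_pair s t \<Longrightarrow> root_pair (- s) (- t)"
  by (auto simp: root_pair_def signed_uminus)

lemma wedge_nonzero: "root_pair s t \<Longrightarrow> wedge (v s) (v t) \<noteq> 0"
  using entry_wedge[of s t s t] by (auto simp: root_pair_def entry_simps)

text \<open>Evaluation at \<open>torus s\<close> and \<open>torus t\<close> recovers the unordered pair from the weight.\<close>

lemma eps_sum_eqD: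
  assumes st: "root_pair s t" and pq: "p \<in> signed_indices" "q \<in> signed_indices"
    and eq: "\<And>A. A \<in> h \<Longrightarrow> eps s A + eps t A = eps p A + eps q A"
  shows "p = s \<and> q = t \<or> p = t \<and> q = s"
proof -
  have "s \<in> signed_indices" "t \<in> signed_indices" "s \<noteq> t" "s \<noteq> - t" "t \<noteq> - s"
    using st by (auto simp: root_pair_def)
  moreover have "s \<noteq> - s" "t \<noteq> - t" using calculation signed_nonzero by auto
  ultimately have "eps p (torus s) + eps q (torus s) = 1" "eps p (torus t) + eps q (torus t) = 1"
    using eq[OF torus_h[of s]] eq[OF torus_h[of t]] by (simp_all add: eps_torus)
  then have "p = s \<or> q = s" "p = t \<or> q = t"
    using pq \<open>s \<in> signed_indices\<close> \<open>t \<in> signed_indices\<close> by (auto simp: eps_torus split: if_splits)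
  then show ?thesis using \<open>s \<noteq> t\<close> by auto
qed

lemma eps_sum_dual: "eps s + eps t \<in> dual_space h"
  by (simp add: dual_space_def eps_add eps_scale eps_outside algebra_simps)

lemma root_space_entry:
  assumes "A \<in> root_space h \<alpha>" "y \<in> h" "s \<in> signed_indices" "t \<in> signed_indices" "entry A s t \<noteq> 0"
  shows "\<alpha> y = eps s y + eps t y"
proof -
  have "lie y A = \<alpha> y *\<^sub>C A" using assms by (simp add: root_space_def)
  then have "(eps s y + eps t y) * entry A s t = \<alpha> y * entry A s t"
    using entry_lie_h[OF assms(2-4), of A] by (auto simp: entry_simps)
  then show ?thesis using assms(5) by (metis mult_right_cancel)
qed

lemma root_space_eq:
  assumes st: "root_pair s t"
  shows "root_space h (eps s + eps t) = {c *\<^sub>C wedge (v s) (v t) | c. True}"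
proof safe
  fix A assume A: "A \<in> root_space h (eps s + eps t)"
  have I: "s \<in> signed_indices" "t \<in> signed_indices" "s \<noteq> t" using st by (auto simp: root_pair_def)
  have "A = entry A s t *\<^sub>C wedge (v s) (v t)"
  proof (rule entry_eqI)
    fix p q assume pq: "p \<in> signed_indices" "q \<in> signed_indices"
    show "entry A p q = entry (entry A s t *\<^sub>C wedge (v s) (v t)) p q"
    proof (cases "p = s \<and> q = t \<or> p = t \<and> q = s")
      case True
      then show ?thesis using I entry_swap[of A t s] by (auto simp: entry_simps entry_wedge)
    next
      case False
      then have "entry A p q = 0"
        using root_space_entry[OF A _ pq] eps_sum_eqD[OF st pq] by fastforce
      then show ?thesis using False I pq by (auto simp: entry_simps entry_wedge)
    qed
  qed
  then show "\<exists>c. A = c *\<^sub>C wedge (v s) (v t) \<and> True" by blast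
next
  fix c
  show "c *\<^sub>C wedge (v s) (v t) \<in> root_space h (eps s + eps t)"
    using st by (simp add: root_space_def lie_cscale_right lie_h_wedge root_pair_def cscale_simps mult.commute)
qed

lemma roots_eq: "roots h = {eps s + eps t | s t. root_pair s t}"
proof safe
  fix \<alpha> assume \<alpha>: "\<alpha> \<in> roots h"
  have "lie y 0 = (0 :: so8)" for y using lie_cscale_right[of y 0 0] by (simp add: cscale_simps)
  then have "0 \<in> root_space h \<alpha>" by (simp add: root_space_def cscale_simps)
  then obtain A where A: "A \<in> root_space h \<alpha>" "A \<noteq> 0" using \<alpha> by (auto simp: roots_def)
  then obtain s t where st: "s \<in> signed_indices" "t \<in> signed_indices" "entry A s t \<noteq> 0"
    using entry_eqI[of A 0] by (auto simp: entry_simps)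
  have eq: "\<alpha> y = eps s y + eps t y" if "y \<in> h" for y
    using root_space_entry[OF A(1) that st] .
  moreover have "\<alpha> y = 0" if "y \<notin> h" for y using \<alpha> that by (simp add: roots_def dual_space_def)
  ultimately have "\<alpha> y = (eps s + eps t) y" for y by (cases "y \<in> h") (simp_all add: eps_outside)
  then have "\<alpha> = eps s + eps t" by blast
  moreover have "s \<noteq> t" using st entry_swap[of A s s] by auto
  moreover have "s \<noteq> - t"
  proof
    assume "s = - t"
    then have "\<alpha> = 0" using \<open>\<alpha> = _\<close> eps_uminus[of t] by simp
    then show False using \<alpha> by (simp add: roots_def)
  qed
  ultimately show "\<exists>s t. \<alpha> = eps s + eps t \<and> root_pair s t"
    using st by (auto simp: root_pair_def)
next
  fix s t assume st: "root_pair s t"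
  have "1 *\<^sub>C wedge (v s) (v t) \<in> root_space h (eps s + eps t)" using root_space_eq[OF st] by blast
  then have "root_space h (eps s + eps t) \<noteq> {0}"
    using wedge_nonzero[OF st] by (auto simp: cscale_simps)
  moreover have "(eps s + eps t) (torus s) = 1"
    using st signed_nonzero[of s] by (auto simp: root_pair_def eps_torus)
  then have "eps s + eps t \<noteq> 0" by (metis zero_fun_apply zero_neq_one)
  ultimately show "eps s + eps t \<in> roots h" using eps_sum_dual by (simp add: roots_def)
qed

lemma finite_roots: "finite (roots h)"
proof -
  have "roots h \<subseteq> (\<lambda>(s, t). eps s + eps t) ` (signed_indices \<times> signed_indices)"
    by (auto simp: roots_eq root_pair_def)
  then show ?thesis using finite_signed by (auto intro: finite_subset)
qed

lemma root_obtain: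
  assumes "\<alpha> \<in> roots h" obtains s t where "root_pair s t" "\<alpha> = eps s + eps t"
  using assms roots_eq by blast

lemma root_pair_root: "root_pair s t \<Longrightarrow> eps s + eps t \<in> roots h"
  using roots_eq by blast

lemma root_value:
  assumes "root_pair s t" "root_pair p q"
  shows "(eps p + eps q) (torus s + torus t) =
    (if p = s then 1 else 0) - (if p = - s then 1 else 0) + ((if p = t then 1 else 0) - (if p = - t then 1 else 0))
    + ((if q = s then 1 else 0) - (if q = - s then 1 else 0) + ((if q = t then 1 else 0) - (if q = - t then 1 else 0)))"
  using assms by (simp add: root_pair_def eps_add torus_h eps_torus)

text \<open>At an obtuse angle one of the four indices is the negative of an index of the other pair, and these
  two cancel in the sum.\<close>

lemma obtuse_roots:
  assumes st: "root_pair s t" and pq: "root_pair p q"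
    and obtuse: "Re ((eps p + eps q) (torus s + torus t)) < 0"
  shows "(eps p + eps q) + (eps s + eps t) \<in> roots h \<or> (eps p + eps q) + (eps s + eps t) = 0"
proof -
  have *: "(eps p + eps q) + (eps s + eps t) \<in> roots h \<or> (eps p + eps q) + (eps s + eps t) = 0"
    if st: "root_pair s t" and pq: "root_pair p q" and p: "p = - s"
      and obtuse: "Re ((eps p + eps q) (torus s + torus t)) < 0" for p q s t
  proof -
    have "eps p = - eps s" unfolding p by (rule eps_uminus)
    then have sum: "(eps p + eps q) + (eps s + eps t) = eps q + eps t"
      by (simp add: fun_eq_iff)
    have ne: "q \<noteq> t"
    proof
      assume q: "q = t"
      have I: "s \<in> signed_indices" "t \<in> signed_indices" "s \<noteq> t" "s \<noteq> - t"
        using st unfolding root_pair_def by blast+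
      have "- s \<noteq> s" "- s \<noteq> t" "t \<noteq> s" "t \<noteq> - s" "t \<noteq> - t" "- s \<noteq> - t"
        using I signed_nonzero[OF I(1)] signed_nonzero[OF I(2)] by presburger+
      then have "(eps p + eps q) (torus s + torus t) = 0"
        by (subst root_value[OF st pq]) (simp add: p q)
      then show False using obtuse by simp
    qed
    show ?thesis
    proof (cases "q = - t")
      case True
      then show ?thesis unfolding sum by (simp add: eps_uminus)
    next
      case False
      then have "root_pair q t" using ne st pq by (simp add: root_pair_def)
      then show ?thesis unfolding sum using root_pair_root by blast
    qed
  qed
  have swap: "root_pair t s" "root_pair q p" using st pq by (auto simp: root_pair_def)
  have "p = - s \<or> p = - t \<or> q = - s \<or> q = - t"
    using obtuse unfolding root_value[OF st pq] by (auto split: if_splits)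
  moreover have obt: "Re ((eps p + eps q) (torus t + torus s)) < 0"
    "Re ((eps q + eps p) (torus s + torus t)) < 0" "Re ((eps q + eps p) (torus t + torus s)) < 0"
    using obtuse by (simp_all only: add.commute)
  ultimately have "(eps p + eps q) + (eps s + eps t) \<in> roots h \<union> {0} \<or>
      (eps p + eps q) + (eps t + eps s) \<in> roots h \<union> {0} \<or>
      (eps q + eps p) + (eps s + eps t) \<in> roots h \<union> {0} \<or>
      (eps q + eps p) + (eps t + eps s) \<in> roots h \<union> {0}"
    using *[OF st pq _ obtuse] *[OF swap(1) pq _ obt(1)] *[OF st swap(2) _ obt(2)]
      *[OF swap _ obt(3)] by blast
  then show ?thesis by (simp only: add.commute[of "eps t"] add.commute[of "eps q"]) blast
qed

end

section \<open>Positive systems and the highest root\<close>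

lemma sum_list_apply: "sum_list xs x = (\<Sum>f\<leftarrow>xs. f x)" for xs :: "('a \<Rightarrow> complex) list"
  by (induction xs) simp_all

lemma nat_combination_list:
  fixes k :: "('a \<Rightarrow> complex) \<Rightarrow> nat"
  assumes "finite S"
  shows "\<exists>xs. set xs \<subseteq> S \<and> sum_list xs = (\<lambda>x. \<Sum>\<sigma>\<in>S. of_nat (k \<sigma>) * \<sigma> x)"
  using assms
proof (induction S rule: finite_induct)
  case empty
  show ?case by (rule exI[of _ "[]"]) (simp add: fun_eq_iff)
next
  case (insert a S)
  then obtain xs where xs: "set xs \<subseteq> S" "sum_list xs = (\<lambda>x. \<Sum>\<sigma>\<in>S. of_nat (k \<sigma>) * \<sigma> x)" by blast
  have "sum_list (replicate n a @ xs) = (\<lambda>x. of_nat n * a x + (\<Sum>\<sigma>\<in>S. of_nat (k \<sigma>) * \<sigma> x))" for n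
    by (induction n) (simp_all add: xs fun_eq_iff algebra_simps)
  then have "sum_list (replicate (k a) a @ xs) = (\<lambda>x. \<Sum>\<sigma>\<in>insert a S. of_nat (k \<sigma>) * \<sigma> x)"
    using insert.hyps by simp
  moreover have "set (replicate (k a) a @ xs) \<subseteq> insert a S" using xs by auto
  ultimately show ?case by blast
qed

lemma list_int_combination:
  fixes xs :: "('a \<Rightarrow> complex) list"
  assumes "finite S" "set xs \<subseteq> S"
  shows "sum_list xs = (\<lambda>x. \<Sum>\<sigma>\<in>S. of_int (int (count_list xs \<sigma>)) * \<sigma> x)"
  using assms(2)
proof (induction xs)
  case Nil
  then show ?case by (simp add: fun_eq_iff)
next
  case (Cons a xs)
  show ?case
  proof
    fix x
    have "(\<Sum>\<sigma>\<in>S. of_int (int (count_list (a # xs) \<sigma>)) * \<sigma> x)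
        = (\<Sum>\<sigma>\<in>S. (if \<sigma> = a then a x else 0) + of_int (int (count_list xs \<sigma>)) * \<sigma> x)"
      by (rule sum.cong) (auto simp: algebra_simps)
    also have "\<dots> = a x + sum_list xs x"
      using Cons assms(1) by (simp add: sum.distrib)
    finally show "sum_list (a # xs) x = (\<Sum>\<sigma>\<in>S. of_int (int (count_list (a # xs) \<sigma>)) * \<sigma> x)"
      by simp
  qed
qed

locale root_datum = cartan_basis +
  fixes P :: "(so8 \<Rightarrow> complex) set" and B :: "so8 \<Rightarrow> so8 \<Rightarrow> complex"
    and X H :: "(so8 \<Rightarrow> complex) \<Rightarrow> so8" and \<gamma> :: "so8 \<Rightarrow> complex"
  assumes pos: "positive_system h P"
    and root_vectors: "normalized_root_vectors B h P X H"
    and high: "highest_root h P \<gamma>"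
begin

lemma P_roots: "\<alpha> \<in> P \<Longrightarrow> \<alpha> \<in> roots h"
  and P_uminus: "\<alpha> \<in> roots h \<Longrightarrow> \<alpha> \<in> P \<longleftrightarrow> - \<alpha> \<notin> P"
  and P_add: "\<alpha> \<in> P \<Longrightarrow> \<beta> \<in> P \<Longrightarrow> \<alpha> + \<beta> \<in> roots h \<Longrightarrow> \<alpha> + \<beta> \<in> P"
  using pos unfolding positive_system_def by blast+

lemma finite_P: "finite P" and finite_simple: "finite (simple_roots P)"
  using P_roots finite_roots by (auto intro: finite_subset simp: simple_roots_def)

lemma simple_P: "simple_roots P \<subseteq> P"
  by (auto simp: simple_roots_def)

text \<open>The triple relation \<open>[H, X] = 2 X\<close> fixes the product of the two scalars by which the root vectors differ
  from the vectors \<open>wedge (v s) (v t)\<close> and \<open>wedge (v (- s)) (v (- t))\<close>. It is vacuous if \<open>X = 0\<close>, and this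
  case is excluded by the squared length two of the roots.\<close>

lemma X_positive:
  assumes st: "root_pair s t" and P: "eps s + eps t \<in> P"
  shows "H (eps s + eps t) = torus s + torus t"
    and "\<exists>k. k \<noteq> 0 \<and> X (eps s + eps t) = k *\<^sub>C wedge (v s) (v t) \<and>
          X (eps (- s) + eps (- t)) = (- 1 / k) *\<^sub>C wedge (v (- s)) (v (- t))"
proof -
  let ?\<alpha> = "eps s + eps t"
  have neg: "- ?\<alpha> = eps (- s) + eps (- t)" by (simp add: eps_uminus)
  have root: "?\<alpha> \<in> roots h" "eps (- s) + eps (- t) \<in> roots h"
    using st root_pair_uminus root_pair_root by blast+
  have I: "s \<in> signed_indices" "t \<in> signed_indices" "s \<noteq> t" "s \<noteq> - t" using st by (auto simp: root_pair_def)
  have ne: "t \<noteq> - s" "s \<noteq> - s" "t \<noteq> - t" using I signed_nonzero[of s] signed_nonzero[of t] by auto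
  obtain k where k: "X ?\<alpha> = k *\<^sub>C wedge (v s) (v t)"
    using root_vectors root(1) root_space_eq[OF st] unfolding normalized_root_vectors_def by blast
  obtain m where m: "X (- ?\<alpha>) = m *\<^sub>C wedge (v (- s)) (v (- t))"
    using root_vectors root(2) root_space_eq[OF root_pair_uminus[OF st]]
    unfolding normalized_root_vectors_def neg by blast
  have "lie (wedge (v s) (v t)) (wedge (v (- s)) (v (- t))) = - (torus s + torus t)"
    using I ne by (simp add: lie_wedge app_wedge_basis signed_uminus torus_def wedge_simps
        wedge_commute[of "v (- s)" "v s"])
  then have Heq: "H ?\<alpha> = (- (k * m)) *\<^sub>C (torus s + torus t)"
    using root_vectors P unfolding normalized_root_vectors_def
    by (metis (no_types, lifting) cscale_cscale cscale_minus_left cscale_minus_right k lie_cscale_left lie_cscale_right m)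
  have Hh: "torus s + torus t \<in> h" using I by (simp add: h_add torus_h)
  have two: "(eps s + eps t) (torus s + torus t) = 2"
    using I ne by (subst root_value[OF st st]) auto
  have "lie (H ?\<alpha>) (X ?\<alpha>) = 2 *\<^sub>C X ?\<alpha>"
    using root_vectors P unfolding normalized_root_vectors_def by blast
  then have "entry (lie (H ?\<alpha>) (X ?\<alpha>)) s t = entry (2 *\<^sub>C X ?\<alpha>) s t" by simp
  moreover have "entry (wedge (v s) (v t)) s t = 1" using I by (simp add: entry_wedge)
  moreover have "eps s (torus s + torus t) + eps t (torus s + torus t) = 2" using two by simp
  ultimately have "k * (- (k * m) * (2 * 1)) = 2 * (k * 1)"
    by (simp only: Heq k lie_cscale_left lie_cscale_right lie_h_wedge[OF Hh I(1,2)] entry_scale)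
  then have "k * (k * m + 1) = 0" by algebra
  moreover have "k \<noteq> 0"
  proof
    assume "k = 0"
    then have H0: "H ?\<alpha> = 0" using Heq by (simp add: cscale_simps)
    have "lie (H ?\<alpha>) (X (- ?\<alpha>)) = (- 2) *\<^sub>C X (- ?\<alpha>)" "\<forall>\<beta>\<in>roots h. \<beta> (H ?\<alpha>) = dual_form B h \<beta> ?\<alpha>"
      "dual_form B h ?\<alpha> ?\<alpha> = 2"
      using root_vectors P root unfolding normalized_root_vectors_def by blast+
    then have "?\<alpha> 0 = 2" using H0 root(1) by metis
    moreover have "?\<alpha> 0 = 0" by (simp add: eps_def app_simps bil_simps)
    ultimately show False by simp
  qed
  ultimately have km: "k * m = - 1" by (simp add: eq_neg_iff_add_eq_0)
  then show "H (eps s + eps t) = torus s + torus t" using Heq by (simp add: cscale_simps)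
  have "m = - 1 / k" using km \<open>k \<noteq> 0\<close> by (simp add: field_simps)
  then show "\<exists>k. k \<noteq> 0 \<and> X (eps s + eps t) = k *\<^sub>C wedge (v s) (v t) \<and>
          X (eps (- s) + eps (- t)) = (- 1 / k) *\<^sub>C wedge (v (- s)) (v (- t))"
    using k m \<open>k \<noteq> 0\<close> unfolding neg by blast
qed

lemma X_root:
  assumes st: "root_pair s t"
  shows "\<exists>k. k \<noteq> 0 \<and> X (eps s + eps t) = k *\<^sub>C wedge (v s) (v t) \<and>
          X (eps (- s) + eps (- t)) = (- 1 / k) *\<^sub>C wedge (v (- s)) (v (- t))"
proof (cases "eps s + eps t \<in> P")
  case True
  then show ?thesis by (rule X_positive(2)[OF st])
next
  case False
  have "- (eps s + eps t) = eps (- s) + eps (- t)" by (simp add: eps_uminus)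
  then have "eps (- s) + eps (- t) \<in> P"
    using False P_uminus root_pair_root[OF st] by metis
  from X_positive(2)[OF root_pair_uminus[OF st] this] obtain k where
    "k \<noteq> 0" "X (eps (- s) + eps (- t)) = k *\<^sub>C wedge (v (- s)) (v (- t))"
    "X (eps s + eps t) = (- 1 / k) *\<^sub>C wedge (v s) (v t)" by auto
  then show ?thesis by (intro exI[of _ "- 1 / k"]) simp
qed

lemma value_int: "\<alpha> \<in> roots h \<Longrightarrow> \<beta> \<in> P \<Longrightarrow> \<exists>n. \<alpha> (H \<beta>) = of_int n"
proof -
  assume "\<alpha> \<in> roots h" "\<beta> \<in> P"
  obtain s t where st: "root_pair s t" "\<beta> = eps s + eps t"
    using root_obtain[OF P_roots[OF \<open>\<beta> \<in> P\<close>]] by blast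
  obtain p q where pq: "root_pair p q" "\<alpha> = eps p + eps q" using root_obtain[OF \<open>\<alpha> \<in> roots h\<close>] by blast
  have "\<alpha> (H \<beta>) \<in> \<int>"
    unfolding st(2) pq(2) X_positive(1)[OF st(1) \<open>\<beta> \<in> P\<close>[unfolded st(2)]] root_value[OF st(1) pq(1)]
    by (intro Ints_add Ints_diff) simp_all
  then show ?thesis by (auto elim: Ints_cases)
qed

lemma P_sum:
  assumes \<alpha>: "\<alpha> \<in> roots h" and \<beta>: "\<beta> \<in> P" and neg: "Re (\<alpha> (H \<beta>)) < 0"
  shows "\<alpha> + \<beta> \<in> roots h \<or> \<alpha> + \<beta> = 0"
proof -
  obtain s t where st: "root_pair s t" "\<beta> = eps s + eps t"
    using root_obtain[OF P_roots[OF \<beta>]] by blast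
  obtain p q where pq: "root_pair p q" "\<alpha> = eps p + eps q" using root_obtain[OF \<alpha>] by blast
  show ?thesis
    using obtuse_roots[OF st(1) pq(1)] neg X_positive(1)[OF st(1)] \<beta> st pq by simp
qed

lemma value_self: "\<beta> \<in> P \<Longrightarrow> \<beta> (H \<beta>) = 2"
  using root_vectors P_roots unfolding normalized_root_vectors_def by metis

text \<open>In a shortest vanishing sum of positive roots the first root makes an obtuse angle with another one, and the two can be merged.\<close>

lemma sum_positive_nonzero: "set xs \<subseteq> P \<Longrightarrow> xs \<noteq> [] \<Longrightarrow> sum_list xs \<noteq> 0"
proof (induction xs rule: length_induct)
  case (1 xs)
  show ?case
  proof
    assume zero: "sum_list xs = 0"
    obtain \<beta> ys where xs: "xs = \<beta> # ys" using 1(3) by (cases xs) auto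
    have \<beta>: "\<beta> \<in> P" "set ys \<subseteq> P" using 1(2) xs by auto
    have "2 + (\<Sum>\<alpha>\<leftarrow>ys. \<alpha> (H \<beta>)) = 0"
      using arg_cong[OF zero, of "\<lambda>f. f (H \<beta>)"] value_self[OF \<beta>(1)] by (simp add: xs sum_list_apply)
    moreover have "0 \<le> Re (\<Sum>\<alpha>\<leftarrow>ys. \<alpha> (H \<beta>))" if "\<forall>\<alpha>\<in>set ys. \<not> Re (\<alpha> (H \<beta>)) < 0"
      using that by (induction ys) auto
    moreover have "Re (\<Sum>\<alpha>\<leftarrow>ys. \<alpha> (H \<beta>)) = - 2"
      using arg_cong[OF calculation(1), of Re] by simp
    ultimately obtain \<alpha> where \<alpha>: "\<alpha> \<in> set ys" "Re (\<alpha> (H \<beta>)) < 0" by force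
    then have "\<alpha> \<in> P" using \<beta> by blast
    have "\<alpha> + \<beta> \<noteq> 0"
    proof
      assume "\<alpha> + \<beta> = 0"
      then have "- \<alpha> \<in> P" using \<beta> by (metis add_eq_0_iff)
      then show False using P_uminus P_roots \<open>\<alpha> \<in> P\<close> by blast
    qed
    then have sum: "\<alpha> + \<beta> \<in> P" using P_sum[OF P_roots[OF \<open>\<alpha> \<in> P\<close>] \<beta>(1) \<alpha>(2)] P_add \<beta> \<open>\<alpha> \<in> P\<close> by blast
    obtain us vs where ys: "ys = us @ \<alpha> # vs" using \<alpha>(1) by (meson split_list)
    have "sum_list ((\<alpha> + \<beta>) # us @ vs) = sum_list xs" by (simp add: xs ys add_ac)
    moreover have "set ((\<alpha> + \<beta>) # us @ vs) \<subseteq> P" using sum \<beta> ys by auto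
    moreover have "length ((\<alpha> + \<beta>) # us @ vs) < length xs" by (simp add: xs ys)
    ultimately show False using 1(1) zero by (metis list.distinct(1))
  qed
qed

lemma high_difference:
  assumes "\<alpha> \<in> roots h"
  shows "\<exists>xs. set xs \<subseteq> P \<and> \<gamma> - \<alpha> = sum_list xs"
proof -
  obtain k :: "(so8 \<Rightarrow> complex) \<Rightarrow> nat" where
    "\<gamma> - \<alpha> = (\<lambda>x. \<Sum>\<sigma>\<in>simple_roots P. of_nat (k \<sigma>) * \<sigma> x)"
    using high assms unfolding highest_root_def by blast
  then show ?thesis using nat_combination_list[OF finite_simple, of k] simple_P by (metis order_trans)
qed

lemma \<gamma>_root: "\<gamma> \<in> roots h"
  using high by (simp add: highest_root_def)

lemma \<gamma>_P: "\<gamma> \<in> P"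
proof (rule ccontr)
  assume "\<gamma> \<notin> P"
  then have neg: "- \<gamma> \<in> P" using P_uminus \<gamma>_root by blast
  obtain xs where xs: "set xs \<subseteq> P" "\<gamma> - - \<gamma> = sum_list xs" using high_difference[OF P_roots[OF neg]] by blast
  have "sum_list (- \<gamma> # - \<gamma> # xs) = 0" by (simp add: xs(2)[symmetric])
  then show False using sum_positive_nonzero[of "- \<gamma> # - \<gamma> # xs"] neg xs(1) by auto
qed

text \<open>Otherwise \<open>\<beta> + \<gamma>\<close> would be a root above the highest one.\<close>

lemma dominant:
  assumes \<beta>: "\<beta> \<in> P"
  shows "0 \<le> Re (\<beta> (H \<gamma>))"
proof (rule ccontr)
  assume "\<not> ?thesis"
  then have "\<beta> + \<gamma> \<in> roots h \<or> \<beta> + \<gamma> = 0" using P_sum[OF P_roots[OF \<beta>] \<gamma>_P] by simp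
  moreover have "\<beta> + \<gamma> \<noteq> 0" using sum_positive_nonzero[of "[\<beta>, \<gamma>]"] \<beta> \<gamma>_P by simp
  ultimately obtain xs where xs: "set xs \<subseteq> P" "\<gamma> - (\<beta> + \<gamma>) = sum_list xs" using high_difference by blast
  have "sum_list (\<beta> # xs) = 0" by (simp add: xs(2)[symmetric])
  then show False using sum_positive_nonzero[of "\<beta> # xs"] \<beta> xs(1) by auto
qed

text \<open>Splitting a root that is not simple terminates: a cycle would be a vanishing sum of positive roots.\<close>

lemma simple_decomposition:
  assumes "\<alpha> \<in> P"
  shows "\<exists>xs. set xs \<subseteq> simple_roots P \<and> \<alpha> = sum_list xs"
proof -
  define R where "R = {(\<beta>, \<alpha>). \<beta> \<in> P \<and> \<alpha> \<in> P \<and> (\<exists>\<beta>'\<in>P. \<alpha> = \<beta> + \<beta>')}"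
  have "finite R" by (rule finite_subset[of _ "P \<times> P"]) (auto simp: R_def finite_P)
  moreover have path: "\<exists>ys. ys \<noteq> [] \<and> set ys \<subseteq> P \<and> b = a + sum_list ys" if "(a, b) \<in> R\<^sup>+" for a b
    using that
  proof (induction rule: trancl_induct)
    case (base b)
    then obtain \<beta>' where "\<beta>' \<in> P" "b = a + \<beta>'" by (auto simp: R_def)
    then show ?case by (intro exI[of _ "[\<beta>']"]) simp
  next
    case (step b c)
    obtain \<beta>' where "\<beta>' \<in> P" "c = b + \<beta>'" using step.hyps(2) unfolding R_def by blast
    moreover obtain ys where "ys \<noteq> []" "set ys \<subseteq> P" "b = a + sum_list ys" using step.IH by blast
    ultimately show ?case by (intro exI[of _ "ys @ [\<beta>']"]) (simp add: add.assoc)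
  qed
  have "acyclic R"
    unfolding acyclic_def using path sum_positive_nonzero by fastforce
  ultimately have "wf R" by (rule finite_acyclic_wf)
  then show ?thesis using assms
  proof (induction \<alpha> rule: wf_induct_rule)
    case (less \<alpha>)
    show ?case
    proof (cases "\<alpha> \<in> simple_roots P")
      case True
      then show ?thesis by (intro exI[of _ "[\<alpha>]"]) simp
    next
      case False
      then obtain \<beta> \<beta>' where \<beta>: "\<beta> \<in> P" "\<beta>' \<in> P" "\<alpha> = \<beta> + \<beta>'"
        using less.prems unfolding simple_roots_def by blast
      then have "(\<beta>, \<alpha>) \<in> R" "(\<beta>', \<alpha>) \<in> R"
        using less.prems add.commute[of \<beta> \<beta>'] unfolding R_def by blast+
      then obtain xs ys where "set xs \<subseteq> simple_roots P" "\<beta> = sum_list xs"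
        "set ys \<subseteq> simple_roots P" "\<beta>' = sum_list ys"
        using less.IH \<beta> by metis
      then show ?thesis using \<beta>(3) by (intro exI[of _ "xs @ ys"]) simp
    qed
  qed
qed

text \<open>The values \<open>\<sigma> (H \<gamma>)\<close> at simple roots are non-negative, so a positive root that vanishes on \<open>H \<gamma>\<close> involves
  only simple roots with the same property.\<close>

lemma levi_roots_eq:
  assumes \<Theta>: "\<Theta> = {\<alpha> \<in> simple_roots P. dual_form B h \<alpha> \<gamma> = 0}"
  shows "levi_roots h \<Theta> = {\<alpha> \<in> roots h. \<alpha> (H \<gamma>) = 0}"
proof -
  have dual: "\<alpha> (H \<gamma>) = dual_form B h \<alpha> \<gamma>" if "\<alpha> \<in> roots h" for \<alpha>
    using root_vectors that \<gamma>_root unfolding normalized_root_vectors_def by blast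
  have simple_roots: "\<sigma> \<in> roots h" if "\<sigma> \<in> simple_roots P" for \<sigma> using that simple_P P_roots by blast
  have \<Theta>': "\<Theta> = {\<alpha> \<in> simple_roots P. \<alpha> (H \<gamma>) = 0}"
    unfolding \<Theta> using dual simple_roots by auto
  have "finite \<Theta>" unfolding \<Theta> using finite_simple by simp
  have pos_levi: "\<exists>k. \<alpha> = (\<lambda>x. \<Sum>\<sigma>\<in>\<Theta>. of_int (k \<sigma> :: int) * \<sigma> x)"
    if \<alpha>: "\<alpha> \<in> P" "\<alpha> (H \<gamma>) = 0" for \<alpha>
  proof -
    obtain xs where xs: "set xs \<subseteq> simple_roots P" "\<alpha> = sum_list xs"
      using simple_decomposition[OF \<alpha>(1)] by blast
    have nonneg: "0 \<le> Re (\<sigma> (H \<gamma>))" if "\<sigma> \<in> set xs" for \<sigma>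
      using that xs simple_P dominant by blast
    have "(\<Sum>\<sigma>\<leftarrow>xs. Re (\<sigma> (H \<gamma>))) = Re (\<Sum>\<sigma>\<leftarrow>xs. \<sigma> (H \<gamma>))" by (induction xs) auto
    also have "\<dots> = 0" using \<alpha>(2) by (simp add: xs sum_list_apply)
    finally have "\<forall>x\<in>set (map (\<lambda>\<sigma>. Re (\<sigma> (H \<gamma>))) xs). x = 0"
      using nonneg by (subst (asm) sum_list_nonneg_eq_0_iff) auto
    then have "\<sigma> (H \<gamma>) = 0" if "\<sigma> \<in> set xs" for \<sigma>
      using value_int[OF simple_roots \<gamma>_P, of \<sigma>] that xs(1) by force
    then have "set xs \<subseteq> \<Theta>" using xs(1) \<Theta>' by blast
    from list_int_combination[OF \<open>finite \<Theta>\<close> this] show ?thesis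
      unfolding xs(2) by (rule exI[of _ "\<lambda>\<sigma>. int (count_list xs \<sigma>)"])
  qed
  show ?thesis
  proof safe
    fix \<alpha> assume \<alpha>: "\<alpha> \<in> levi_roots h \<Theta>"
    then show "\<alpha> \<in> roots h" by (simp add: levi_roots_def)
    obtain k where "\<alpha> = (\<lambda>x. \<Sum>\<sigma>\<in>\<Theta>. of_int (k \<sigma> :: int) * \<sigma> x)" using \<alpha> by (auto simp: levi_roots_def)
    moreover have "(\<Sum>\<sigma>\<in>\<Theta>. of_int (k \<sigma>) * \<sigma> (H \<gamma>)) = 0"
      by (rule sum.neutral) (simp add: \<Theta>')
    ultimately show "\<alpha> (H \<gamma>) = 0" by simp
  next
    fix \<alpha> assume \<alpha>: "\<alpha> \<in> roots h" "\<alpha> (H \<gamma>) = 0"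
    have "\<exists>k. \<alpha> = (\<lambda>x. \<Sum>\<sigma>\<in>\<Theta>. of_int (k \<sigma> :: int) * \<sigma> x)"
    proof (cases "\<alpha> \<in> P")
      case True
      then show ?thesis using pos_levi \<alpha> by blast
    next
      case False
      then have "- \<alpha> \<in> P" using P_uminus \<alpha>(1) by blast
      then obtain k where k: "- \<alpha> = (\<lambda>x. \<Sum>\<sigma>\<in>\<Theta>. of_int (k \<sigma> :: int) * \<sigma> x)"
        using pos_levi[of "- \<alpha>"] \<alpha>(2) by auto
      have "\<alpha> x = (\<Sum>\<sigma>\<in>\<Theta>. of_int (- k \<sigma>) * \<sigma> x)" for x
        using fun_cong[OF k, of x] by (simp add: sum_negf) (metis minus_equation_iff)
      then show ?thesis by (intro exI[of _ "\<lambda>\<sigma>. - k \<sigma>"]) blast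
    qed
    then show "\<alpha> \<in> levi_roots h \<Theta>" using \<alpha>(1) by (simp add: levi_roots_def)
  qed
qed

lemma positive_outside_levi:
  assumes \<Theta>: "\<Theta> = {\<alpha> \<in> simple_roots P. dual_form B h \<alpha> \<gamma> = 0}"
  shows "P - levi_roots h \<Theta> = {\<alpha> \<in> roots h. 0 < Re (\<alpha> (H \<gamma>))}"
proof safe
  fix \<alpha> assume \<alpha>: "\<alpha> \<in> P" "\<alpha> \<notin> levi_roots h \<Theta>"
  then show "\<alpha> \<in> roots h" using P_roots by blast
  then have "\<alpha> (H \<gamma>) \<noteq> 0" using \<alpha>(2) levi_roots_eq[OF \<Theta>] by blast
  moreover obtain n where "\<alpha> (H \<gamma>) = of_int n" using value_int[OF \<open>\<alpha> \<in> roots h\<close> \<gamma>_P] by blast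
  ultimately show "0 < Re (\<alpha> (H \<gamma>))" using dominant[OF \<alpha>(1)] by auto
next
  fix \<alpha> assume \<alpha>: "\<alpha> \<in> roots h" "0 < Re (\<alpha> (H \<gamma>))"
  show "\<alpha> \<in> P"
  proof (rule ccontr)
    assume "\<alpha> \<notin> P"
    then have "- \<alpha> \<in> P" using P_uminus \<alpha>(1) by blast
    then show False using dominant[of "- \<alpha>"] \<alpha>(2) by simp
  qed
  assume "\<alpha> \<in> levi_roots h \<Theta>"
  then show False using levi_roots_eq[OF \<Theta>] \<alpha>(2) by simp
qed

end

section \<open>Computations in the enveloping algebra\<close>

lemma uea_of_add: "uea_of (x + y) = uea_of x + uea_of y"
proof (transfer, goal_cases)
  case (1 x y)
  show ?case using rel_add[of x y] by (simp add: diff_diff_eq)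
qed

lemma uea_of_cscale: "uea_of (c *\<^sub>C x) = uea_const c * uea_of x"
  by transfer (rule rel_cscale)

lemma uea_of_lie: "uea_of x * uea_of y = uea_of y * uea_of x + uea_of (lie x y)"
proof (transfer, goal_cases)
  case (1 x y)
  show ?case using rel_lie[of x y] by (simp add: diff_diff_eq)
qed

lemma uea_const_commute: "u * uea_const c = uea_const c * u"
proof (transfer, goal_cases)
  case (1 u c)
  have "u * free_const c = free_const c * u"
    by (induction u rule: poly_mapping_induct_add) (simp_all add: mult_single distrib_left distrib_right mult.commute)
  then show ?case by (simp add: uea_ideal_zero)
qed

lemma uea_const_add: "uea_const (c + d) = uea_const c + uea_const d"
  and uea_const_mult: "uea_const (c * d) = uea_const c * uea_const d"
  and uea_const_minus: "uea_const (- c) = - uea_const c"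
  and uea_const_0 [simp]: "uea_const 0 = 0"
  and uea_const_1 [simp]: "uea_const 1 = 1"
  by (transfer; simp add: single_add mult_single single_uminus single_diff uea_ideal_zero)+

lemma uea_const_numeral [simp]: "uea_const (numeral n) = numeral n"
proof -
  have "uea_const (of_nat m) = of_nat m" for m by (induction m) (simp_all add: uea_const_add)
  from this[of "numeral n"] show ?thesis by simp
qed

lemma uea_of_0 [simp]: "uea_of 0 = 0"
  using uea_of_cscale[of 0 0] by (simp add: cscale_simps)

lemma uea_of_minus: "uea_of (- x) = - uea_of x"
  using uea_of_cscale[of "- 1" x] by (simp add: cscale_simps uea_const_minus)

lemma uea_of_diff: "uea_of (x - y) = uea_of x - uea_of y"
  using uea_of_add[of x "- y"] by (simp add: uea_of_minus)

lemma const_left_commute: "u * (uea_const c * w) = uea_const c * (u * w)"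
  by (simp only: mult.assoc[symmetric] uea_const_commute)

context witt_basis
begin

definition mid_indices :: "int set" where "mid_indices = {3, 4, - 3, - 4}"

definition mid :: "(complex^8) set" where
  "mid = {d. \<forall>s\<in>{1, 2, - 1, - 2}. bil d (v s) = 0}"

lemma mid_signed: "s \<in> mid_indices \<Longrightarrow> s \<in> signed_indices"
  and mid_uminus: "- s \<in> mid_indices \<longleftrightarrow> s \<in> mid_indices"
  and finite_mid: "finite mid_indices"
  by (auto simp: mid_indices_def signed_indices_def)

lemma other_mid_index:
  obtains p where "p \<in> mid_indices" "p \<noteq> s" "p \<noteq> - s"
proof (cases "s = 3 \<or> s = - 3")
  case True
  then show ?thesis using that[of 4] by (auto simp: mid_indices_def)
next
  case False
  then show ?thesis using that[of 3] by (auto simp: mid_indices_def)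
qed

lemma mid_bil: "d \<in> mid \<Longrightarrow> bil d (v 1) = 0" "d \<in> mid \<Longrightarrow> bil d (v 2) = 0"
  "d \<in> mid \<Longrightarrow> bil d (v (- 1)) = 0" "d \<in> mid \<Longrightarrow> bil d (v (- 2)) = 0"
  "d \<in> mid \<Longrightarrow> bil (v 1) d = 0" "d \<in> mid \<Longrightarrow> bil (v 2) d = 0"
  "d \<in> mid \<Longrightarrow> bil (v (- 1)) d = 0" "d \<in> mid \<Longrightarrow> bil (v (- 2)) d = 0"
  by (simp_all add: mid_def bil_commute[of "v _"])

lemma mid_add: "c \<in> mid \<Longrightarrow> d \<in> mid \<Longrightarrow> c + d \<in> mid"
  and mid_scale: "d \<in> mid \<Longrightarrow> k *s d \<in> mid"
  and mid_minus: "d \<in> mid \<Longrightarrow> - d \<in> mid"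
  and mid_diff: "c \<in> mid \<Longrightarrow> d \<in> mid \<Longrightarrow> c - d \<in> mid"
  and mid_zero: "0 \<in> mid"
  by (simp_all add: mid_def bil_simps)

lemma bil_v_concrete:
  "bil (v 1) (v 1) = 0" "bil (v 1) (v 2) = 0" "bil (v 1) (v (- 1)) = 1" "bil (v 1) (v (- 2)) = 0"
  "bil (v 2) (v 1) = 0" "bil (v 2) (v 2) = 0" "bil (v 2) (v (- 1)) = 0" "bil (v 2) (v (- 2)) = 1"
  "bil (v (- 1)) (v 1) = 1" "bil (v (- 1)) (v 2) = 0" "bil (v (- 1)) (v (- 1)) = 0" "bil (v (- 1)) (v (- 2)) = 0"
  "bil (v (- 2)) (v 1) = 0" "bil (v (- 2)) (v 2) = 1" "bil (v (- 2)) (v (- 1)) = 0" "bil (v (- 2)) (v (- 2)) = 0"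
  by (simp_all add: bil_v signed_indices_def)

lemma v_mid: "s \<in> mid_indices \<Longrightarrow> v s \<in> mid"
  unfolding mid_def by (auto simp: bil_v mid_indices_def signed_indices_def)

lemma sum_mid: "(\<Sum>s\<in>mid_indices. F s) = F 3 + F 4 + F (- 3) + (F (- 4) :: 'b::comm_monoid_add)"
  by (simp add: mid_indices_def add.assoc)

lemma sum_mid_uminus: "(\<Sum>s\<in>mid_indices. F (- s)) = (\<Sum>s\<in>mid_indices. F s :: 'b::comm_monoid_add)"
  by (simp add: sum_mid add_ac)

lemma mid_expand: "d \<in> mid \<Longrightarrow> d = (\<Sum>s\<in>mid_indices. bil d (v (- s)) *s v s)"
proof (rule basis_eqI)
  fix t assume d: "d \<in> mid" and t: "t \<in> signed_indices"
  have "bil (\<Sum>s\<in>mid_indices. bil d (v (- s)) *s v s) (v t)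
      = (\<Sum>s\<in>mid_indices. if s = - t then bil d (v t) else 0)"
    unfolding bil_sum_left using t
    by (intro sum.cong) (auto simp: bil_simps bil_v mid_signed)
  also have "\<dots> = bil d (v t)"
    using d t by (auto simp: mid_indices_def signed_indices_def mid_bil)
  finally show "bil d (v t) = bil (\<Sum>s\<in>mid_indices. bil d (v (- s)) *s v s) (v t)" by simp
qed

text \<open>Contraction against the tensor of the quadratic form on the middle block.\<close>

lemma contract:
  fixes F :: "complex^8 \<Rightarrow> so8 uea"
  assumes add: "\<And>c d. F (c + d) = F c + F d" and scale: "\<And>k d. F (k *s d) = uea_const k * F d"
    and d: "d \<in> mid"
  shows "(\<Sum>s\<in>mid_indices. uea_const (bil d (v (- s))) * F (v s)) = F d"
    and "(\<Sum>s\<in>mid_indices. uea_const (bil d (v s)) * F (v (- s))) = F d"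
proof -
  have "F 0 = 0" using scale[of 0 0] by simp
  then have sum: "F (\<Sum>s\<in>I. g s) = (\<Sum>s\<in>I. F (g s))" for g :: "int \<Rightarrow> complex^8" and I
    by (induction I rule: infinite_finite_induct) (simp_all add: add)
  show *: "(\<Sum>s\<in>mid_indices. uea_const (bil d (v (- s))) * F (v s)) = F d"
    by (subst (2) mid_expand[OF d]) (simp only: sum scale)
  show "(\<Sum>s\<in>mid_indices. uea_const (bil d (v s)) * F (v (- s))) = F d"
    using sum_mid_uminus[of "\<lambda>s. uea_const (bil d (v (- s))) * F (v s)"] * by simp
qed

text \<open>The generators in the grading by \<open>H \<gamma>\<close>: \<open>ua\<close>, \<open>ub\<close> in degree \<open>- 1\<close>, the central \<open>uz\<close> in degree \<open>- 2\<close>, the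
  rotations \<open>ur\<close> of the middle block and the matrix units \<open>ue\<close> of \<open>gl(2)\<close> in degree \<open>0\<close>, and \<open>ux\<close>, \<open>uy\<close> in
  degree \<open>1\<close>.\<close>

definition ua where "ua c = uea_of (wedge (v (- 1)) c)"
definition ub where "ub c = uea_of (wedge (v (- 2)) c)"
definition uz where "uz = uea_of (wedge (v (- 1)) (v (- 2)))"
definition ux where "ux c = uea_of (wedge (v 1) c)"
definition uy where "uy c = uea_of (wedge (v 2) c)"
definition ur where "ur c d = uea_of (wedge c d)"
definition ue where "ue i j = uea_of (wedge (v i) (v (- j)))"

lemma ua_linear: "ua (c + d) = ua c + ua d" "ua (k *s d) = uea_const k * ua d"
    "ua (c - d) = ua c - ua d" "ua (- d) = - ua d"
  and ub_linear: "ub (c + d) = ub c + ub d" "ub (k *s d) = uea_const k * ub d"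
    "ub (c - d) = ub c - ub d" "ub (- d) = - ub d"
  by (simp_all add: ua_def ub_def wedge_simps uea_of_add uea_of_cscale uea_of_minus uea_of_diff)

lemma lie_wedge_wedge: "lie (wedge p q) (wedge c d) =
    wedge (bil q c *s p - bil p c *s q) d + wedge c (bil q d *s p - bil p d *s q)"
  by (simp add: lie_wedge app_wedge)

lemma bracket:
  "uea_of (wedge p q) * uea_of (wedge c d) = uea_of (wedge c d) * uea_of (wedge p q)
    + (uea_const (bil q c) * uea_of (wedge p d) - uea_const (bil p c) * uea_of (wedge q d)
    + uea_const (bil q d) * uea_of (wedge c p) - uea_const (bil p d) * uea_of (wedge c q))"
  by (subst uea_of_lie)
    (simp add: lie_wedge app_wedge wedge_simps uea_of_add uea_of_diff uea_of_cscale)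

lemma uea_of_wedge_swap: "uea_of (wedge c d) = - uea_of (wedge d c)"
  by (subst wedge_commute) (rule uea_of_minus)

lemma comm:
  assumes "c \<in> mid" "d \<in> mid"
  shows "ua c * ua d = ua d * ua c" "ub c * ub d = ub d * ub c"
    "ub d * ua c = ua c * ub d + uea_const (bil c d) * uz"
    "ux c * ua d = ua d * ux c + ur d c - uea_const (bil c d) * ue 1 1"
    "ux c * ub d = ub d * ux c - uea_const (bil c d) * ue 1 2"
    "uy c * ua d = ua d * uy c - uea_const (bil c d) * ue 2 1"
    "uy c * ub d = ub d * uy c + ur d c - uea_const (bil c d) * ue 2 2"
  unfolding ua_def ub_def uz_def ux_def uy_def ur_def ue_def
  using uea_of_wedge_swap[of c d] uea_of_wedge_swap[of "v (- 1)" "v 1"] uea_of_wedge_swap[of "v (- 1)" "v 2"]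
    uea_of_wedge_swap[of "v (- 2)" "v 1"] uea_of_wedge_swap[of "v (- 2)" "v 2"]
  by (subst bracket; simp add: bil_v_concrete mid_bil assms wedge_simps bil_commute[of d c])+

lemma comm_single:
  assumes "d \<in> mid"
  shows "uz * ua d = ua d * uz" "uz * ub d = ub d * uz"
    "ue 1 1 * ua d = ua d * ue 1 1 - ua d" "ue 1 1 * ub d = ub d * ue 1 1"
    "ue 2 2 * ua d = ua d * ue 2 2" "ue 2 2 * ub d = ub d * ue 2 2 - ub d"
    "ue 1 2 * ua d = ua d * ue 1 2 - ub d" "ue 1 2 * ub d = ub d * ue 1 2"
    "ue 2 1 * ua d = ua d * ue 2 1" "ue 2 1 * ub d = ub d * ue 2 1 - ua d"
    "ue 1 2 * uz = uz * ue 1 2"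
  unfolding ua_def ub_def uz_def ue_def
  by (subst bracket; simp add: bil_v_concrete mid_bil assms wedge_simps)+

lemma comm_ur:
  assumes "p \<in> mid" "q \<in> mid" "d \<in> mid"
  shows "ur p q * ua d = ua d * ur p q + uea_const (bil q d) * ua p - uea_const (bil p d) * ua q"
    "ur p q * ub d = ub d * ur p q + uea_const (bil q d) * ub p - uea_const (bil p d) * ub q"
    "ur p q * uz = uz * ur p q" "ur p q * ue 1 2 = ue 1 2 * ur p q"
  unfolding ua_def ub_def uz_def ur_def ue_def
  by (subst bracket; simp add: bil_v_concrete mid_bil assms wedge_simps add_diff_eq)+

lemma comm_ue:
  assumes "c \<in> mid"
  shows "ue 1 1 * ue 1 2 = ue 1 2 * ue 1 1 + ue 1 2" "ue 2 2 * ue 1 2 = ue 1 2 * ue 2 2 - ue 1 2"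
    "ue 2 1 * ue 1 2 = ue 1 2 * ue 2 1 + ue 2 2 - ue 1 1"
    "ux c * ue 1 2 = ue 1 2 * ux c" "uy c * ue 1 2 = ue 1 2 * uy c - ux c"
    "ue 1 1 * uz = uz * ue 1 1 - uz" "ue 2 2 * uz = uz * ue 2 2 - uz" "ue 2 1 * uz = uz * ue 2 1"
  unfolding ua_def ub_def uz_def ux_def uy_def ur_def ue_def
  using uea_of_wedge_swap[of "v (- 1)" "v 1"] uea_of_wedge_swap[of c "v 1"] uea_of_wedge_swap[of "v (- 2)" "v (- 1)"]
  by (subst bracket; simp add: bil_v_concrete mid_bil assms wedge_simps)+

end

section \<open>Singular vectors\<close>

lemma numeral_expand:
  fixes u :: "'a::ring_1"
  shows "2 * u = u + u" "3 * u = u + u + u" "4 * u = u + u + u + u"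
    "- 2 * u = - u - u" "- 3 * u = - u - u - u"
proof -
  show 2: "2 * u = u + u" by (rule mult_2)
  have "3 * u = (2 + 1) * u" "4 * u = (2 + 2) * u" by simp_all
  then show "3 * u = u + u + u" "4 * u = u + u + u + u"
    by (simp_all only: distrib_right 2 mult_1_left add.assoc)
  then show "- 2 * u = - u - u" "- 3 * u = - u - u - u" using 2 by simp_all
qed

lemma assoc_rule: "a * b = c \<Longrightarrow> a * (b * m) = c * (m :: 'a::complex_lie_algebra uea)"
  by (simp add: mult.assoc[symmetric])

lemma left_commute_rule: "a * b = b * a \<Longrightarrow> a * (b * m) = b * (a * (m :: 'a::complex_lie_algebra uea))"
  by (simp add: mult.assoc[symmetric])

context witt_basis
begin

text \<open>Only instances that move a scalar past a generator terminate as rewrite rules.\<close>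

lemmas const_left_commutes = const_left_commute[of "ua c" for c] const_left_commute[of "ub c" for c]
  const_left_commute[of uz] const_left_commute[of "ux c" for c] const_left_commute[of "uy c" for c]
  const_left_commute[of "ur c d" for c d] const_left_commute[of "ue i j" for i j]

lemmas comm_assoc = comm(1,2)[THEN left_commute_rule] comm(3-7)[THEN assoc_rule] comm_single[THEN assoc_rule] comm_ur[THEN assoc_rule]
lemmas normal_order = comm comm_single comm_ur comm_assoc mult.assoc distrib_left distrib_right
  left_diff_distrib right_diff_distrib const_left_commutes

text \<open>The entries of the Gram matrix of the two rows of \<open>V\<^sup>-\<close>, as elements of the enveloping algebra.\<close>

definition uA where "uA = (\<Sum>s\<in>mid_indices. ua (v s) * ua (v (- s)))"
definition uB where "uB = (\<Sum>s\<in>mid_indices. ub (v s) * ub (v (- s)))"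
definition uC where "uC = (\<Sum>s\<in>mid_indices. ua (v s) * ub (v (- s)))"

lemma v_uminus_mid: "s \<in> mid_indices \<Longrightarrow> v (- s) \<in> mid"
  by (rule v_mid) (simp add: mid_uminus)

lemma bil_v_mid: "s \<in> mid_indices \<Longrightarrow> bil (v s) (v (- s)) = 1" "s \<in> mid_indices \<Longrightarrow> bil (v (- s)) (v s) = 1"
  using mid_signed[of s] bil_v[of s "- s"] bil_commute by (simp_all add: mid_signed mid_uminus)

lemma sum_mid_const: "(\<Sum>s\<in>mid_indices. u) = 4 * (u :: 'b::ring_1)"
proof -
  have "4 * u = (u + u) + (u + u)" by (simp flip: mult_2 add: mult.assoc[symmetric])
  then show ?thesis unfolding sum_mid by (simp only: add.assoc)
qed

lemmas contract_ua = contract[of ua, OF ua_linear(1,2)]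
lemmas contract_ub = contract[of ub, OF ub_linear(1,2)]

lemma contract_mult:
  fixes F :: "complex^8 \<Rightarrow> so8 uea"
  assumes lin: "\<And>c d. F (c + d) = F c + F d" "\<And>k d. F (k *s d) = uea_const k * F d" and d: "d \<in> mid"
  shows "(\<Sum>s\<in>mid_indices. uea_const (bil d (v (- s))) * (F (v s) * w)) = F d * w"
    and "(\<Sum>s\<in>mid_indices. uea_const (bil d (v s)) * (F (v (- s)) * w)) = F d * w"
    and "(\<Sum>s\<in>mid_indices. uea_const (bil d (v (- s))) * (w * F (v s))) = w * F d"
    and "(\<Sum>s\<in>mid_indices. uea_const (bil d (v s)) * (w * F (v (- s)))) = w * F d"
  by (rule contract[of "\<lambda>c. F c * w"] contract[of "\<lambda>c. w * F c"];
      simp add: lin distrib_left distrib_right mult.assoc const_left_commute d)+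

lemmas contract_ua_mult = contract_mult[of ua, OF ua_linear(1,2)]
lemmas contract_ub_mult = contract_mult[of ub, OF ub_linear(1,2)]

lemma ux_uA:
  assumes c: "c \<in> mid"
  shows "ux c * uA = uA * ux c + 2 * (\<Sum>s\<in>mid_indices. ua (v (- s)) * ur (v s) c) - 2 * (ua c * ue 1 1) - 2 * ua c"
proof -
  have "ux c * (ua p * ua q) = ua p * ua q * ux c + ua p * ur q c + ua q * ur p c
      - uea_const (bil c q) * (ua p * ue 1 1) - uea_const (bil c p) * (ua q * ue 1 1)
      + uea_const (bil c q) * ua p - uea_const (bil p q) * ua c + uea_const (bil c p) * ua q"
    if "p \<in> mid" "q \<in> mid" for p q
    using that c by (simp add: normal_order algebra_simps)
  then have "ux c * uA = (\<Sum>s\<in>mid_indices. ua (v s) * ua (v (- s)) * ux c + ua (v s) * ur (v (- s)) c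
      + ua (v (- s)) * ur (v s) c
      - uea_const (bil c (v (- s))) * (ua (v s) * ue 1 1) - uea_const (bil c (v s)) * (ua (v (- s)) * ue 1 1)
      + uea_const (bil c (v (- s))) * ua (v s) - ua c + uea_const (bil c (v s)) * ua (v (- s)))"
    unfolding uA_def sum_distrib_left
    by (intro sum.cong refl) (simp add: v_mid v_uminus_mid bil_v_mid)
  also have "\<dots> = uA * ux c + (\<Sum>s\<in>mid_indices. ua (v s) * ur (v (- s)) c)
      + (\<Sum>s\<in>mid_indices. ua (v (- s)) * ur (v s) c) - ua c * ue 1 1 - ua c * ue 1 1 + ua c - 4 * ua c + ua c"
    by (simp only: sum.distrib sum_subtractf contract_ua_mult[OF c] contract_ua[OF c] sum_mid_const
        uA_def sum_distrib_right)
  also have "(\<Sum>s\<in>mid_indices. ua (v s) * ur (v (- s)) c) = (\<Sum>s\<in>mid_indices. ua (v (- s)) * ur (v s) c)"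
    using sum_mid_uminus[of "\<lambda>s. ua (v (- s)) * ur (v s) c"] by simp
  also have "uA * ux c + (\<Sum>s\<in>mid_indices. ua (v (- s)) * ur (v s) c)
      + (\<Sum>s\<in>mid_indices. ua (v (- s)) * ur (v s) c) - ua c * ue 1 1 - ua c * ue 1 1 + ua c - 4 * ua c + ua c
    = uA * ux c + 2 * (\<Sum>s\<in>mid_indices. ua (v (- s)) * ur (v s) c) - 2 * (ua c * ue 1 1) - 2 * ua c"
    by (simp add: numeral_expand algebra_simps)
  finally show ?thesis .
qed

lemma uy_uA:
  assumes c: "c \<in> mid"
  shows "uy c * uA = uA * uy c - 2 * (ua c * ue 2 1)"
proof -
  have "uy c * (ua p * ua q) = ua p * ua q * uy c
      - uea_const (bil c q) * (ua p * ue 2 1) - uea_const (bil c p) * (ua q * ue 2 1)"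
    if "p \<in> mid" "q \<in> mid" for p q
    using that c by (simp add: normal_order algebra_simps)
  then have "uy c * uA = (\<Sum>s\<in>mid_indices. ua (v s) * ua (v (- s)) * uy c
      - uea_const (bil c (v (- s))) * (ua (v s) * ue 2 1) - uea_const (bil c (v s)) * (ua (v (- s)) * ue 2 1))"
    unfolding uA_def sum_distrib_left
    by (intro sum.cong refl) (simp add: v_mid v_uminus_mid)
  also have "\<dots> = uA * uy c - ua c * ue 2 1 - ua c * ue 2 1"
    by (simp only: sum_subtractf contract_ua_mult[OF c] uA_def sum_distrib_right)
  finally show ?thesis by (simp add: algebra_simps flip: mult_2)
qed

lemma uC_swap: "(\<Sum>s\<in>mid_indices. ub (v s) * ua (v (- s))) = uC + 4 * uz"
  "(\<Sum>s\<in>mid_indices. ua (v (- s)) * ub (v s)) = uC"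
proof -
  show 2: "(\<Sum>s\<in>mid_indices. ua (v (- s)) * ub (v s)) = uC"
    unfolding uC_def using sum_mid_uminus[of "\<lambda>s. ua (v s) * ub (v (- s))"] by simp
  have "(\<Sum>s\<in>mid_indices. ub (v s) * ua (v (- s))) = (\<Sum>s\<in>mid_indices. ua (v (- s)) * ub (v s) + uz)"
    by (intro sum.cong refl) (simp add: comm v_mid v_uminus_mid bil_v_mid)
  then show "(\<Sum>s\<in>mid_indices. ub (v s) * ua (v (- s))) = uC + 4 * uz"
    by (simp only: sum.distrib 2 sum_mid_const)
qed

lemma ur_uC:
  assumes p: "p \<in> mid" and q: "q \<in> mid"
  shows "ur p q * uC = uC * ur p q"
proof -
  have "ur p q * (ua c * ub d) = ua c * ub d * ur p q
      + uea_const (bil q c) * (ua p * ub d) - uea_const (bil p c) * (ua q * ub d)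
      + uea_const (bil q d) * (ua c * ub p) - uea_const (bil p d) * (ua c * ub q)"
    if "c \<in> mid" "d \<in> mid" for c d
    using that p q by (simp add: normal_order algebra_simps)
  then have "ur p q * uC = (\<Sum>s\<in>mid_indices. ua (v s) * ub (v (- s)) * ur p q
      + uea_const (bil q (v s)) * (ua p * ub (v (- s))) - uea_const (bil p (v s)) * (ua q * ub (v (- s)))
      + uea_const (bil q (v (- s))) * (ua (v s) * ub p) - uea_const (bil p (v (- s))) * (ua (v s) * ub q))"
    unfolding uC_def sum_distrib_left
    by (intro sum.cong refl) (simp add: v_mid v_uminus_mid)
  also have "\<dots> = uC * ur p q + ua p * ub q - ua q * ub p + ua q * ub p - ua p * ub q"
    by (simp only: sum.distrib sum_subtractf contract_ua_mult[OF q] contract_ua_mult[OF p]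
        contract_ub_mult[OF q] contract_ub_mult[OF p] uC_def sum_distrib_right)
  finally show ?thesis by simp
qed

lemma ue_sums:
  "ue 1 1 * uC = uC * ue 1 1 - uC" "ue 2 2 * uC = uC * ue 2 2 - uC"
  "ue 2 1 * uC = uC * ue 2 1 - uA" "ue 1 2 * uC = uC * ue 1 2 - uB"
  "ue 1 1 * uA = uA * ue 1 1 - 2 * uA" "ue 2 2 * uA = uA * ue 2 2" "ue 2 1 * uA = uA * ue 2 1"
  "ue 1 2 * uA = uA * ue 1 2 - 2 * uC - 4 * uz" "ue 1 2 * uB = uB * ue 1 2"
proof -
  note [simp] = v_mid v_uminus_mid bil_v_mid
  have "ue 1 1 * uC = (\<Sum>s\<in>mid_indices. ua (v s) * ub (v (- s)) * ue 1 1 - ua (v s) * ub (v (- s)))"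
    "ue 2 2 * uC = (\<Sum>s\<in>mid_indices. ua (v s) * ub (v (- s)) * ue 2 2 - ua (v s) * ub (v (- s)))"
    "ue 2 1 * uC = (\<Sum>s\<in>mid_indices. ua (v s) * ub (v (- s)) * ue 2 1 - ua (v s) * ua (v (- s)))"
    "ue 1 2 * uC = (\<Sum>s\<in>mid_indices. ua (v s) * ub (v (- s)) * ue 1 2 - ub (v s) * ub (v (- s)))"
    "ue 1 1 * uA = (\<Sum>s\<in>mid_indices. ua (v s) * ua (v (- s)) * ue 1 1 - ua (v s) * ua (v (- s)) - ua (v s) * ua (v (- s)))"
    "ue 2 2 * uA = (\<Sum>s\<in>mid_indices. ua (v s) * ua (v (- s)) * ue 2 2)"
    "ue 2 1 * uA = (\<Sum>s\<in>mid_indices. ua (v s) * ua (v (- s)) * ue 2 1)"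
    "ue 1 2 * uA = (\<Sum>s\<in>mid_indices. ua (v s) * ua (v (- s)) * ue 1 2 - ua (v s) * ub (v (- s)) - ub (v s) * ua (v (- s)))"
    "ue 1 2 * uB = (\<Sum>s\<in>mid_indices. ub (v s) * ub (v (- s)) * ue 1 2)"
    unfolding uA_def uB_def uC_def sum_distrib_left
    by (intro sum.cong refl; simp add: normal_order algebra_simps)+
  then show "ue 1 1 * uC = uC * ue 1 1 - uC" "ue 2 2 * uC = uC * ue 2 2 - uC"
    "ue 2 1 * uC = uC * ue 2 1 - uA" "ue 1 2 * uC = uC * ue 1 2 - uB"
    "ue 1 1 * uA = uA * ue 1 1 - 2 * uA" "ue 2 2 * uA = uA * ue 2 2" "ue 2 1 * uA = uA * ue 2 1"
    "ue 1 2 * uA = uA * ue 1 2 - 2 * uC - 4 * uz" "ue 1 2 * uB = uB * ue 1 2"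
    by (simp_all only: sum_subtractf uA_def[symmetric] uB_def[symmetric] uC_def[symmetric]
        sum_distrib_right[symmetric] uC_swap) (simp_all add: mult_2 algebra_simps)
qed

text \<open>The symbols of \<open>uw d\<close> and \<open>uw' d\<close> are, up to the factors \<open>2\<close> and \<open>- 2\<close>, the derivatives of \<open>uA * uB - uC\<^sup>2\<close> with
  respect to the coordinates \<open>ub d\<close> and \<open>ua d\<close>. The term with \<open>uz\<close> accounts for the order of the factors;
  it is the one for which \<open>ue12_uw\<close> holds.\<close>

definition uw where "uw d = uA * ub d - ua d * uC"
definition uw' where "uw' d = uC * ub d - ua d * uB + 3 * (uz * ub d)"

lemma uw_linear: "uw (c + d) = uw c + uw d" "uw (k *s d) = uea_const k * uw d"
  and uw'_linear: "uw' (c + d) = uw' c + uw' d" "uw' (k *s d) = uea_const k * uw' d"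
proof -
  have "uz * (uea_const k * (u::so8 uea)) = uea_const k * (uz * u)" "3 * (uea_const k * (u::so8 uea)) = uea_const k * (3 * u)" for u
    by (rule const_left_commute)+
  then show "uw (c + d) = uw c + uw d" "uw (k *s d) = uea_const k * uw d"
    "uw' (c + d) = uw' c + uw' d" "uw' (k *s d) = uea_const k * uw' d"
    by (simp_all add: uw_def uw'_def ua_linear ub_linear algebra_simps const_left_commutes
        const_left_commute[of uA] const_left_commute[of uC])
qed

lemma ub_uA: "d \<in> mid \<Longrightarrow> ub d * uA = uA * ub d + 2 * (uz * ua d)"
proof -
  assume d: "d \<in> mid"
  have "ub d * (ua p * ua q) = ua p * ua q * ub d
      + uea_const (bil d q) * (uz * ua p) + uea_const (bil d p) * (uz * ua q)"
    if "p \<in> mid" "q \<in> mid" for p q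
    using that d by (simp add: normal_order algebra_simps bil_commute[of d])
  then have "ub d * uA = (\<Sum>s\<in>mid_indices. ua (v s) * ua (v (- s)) * ub d
      + uea_const (bil d (v (- s))) * (uz * ua (v s)) + uea_const (bil d (v s)) * (uz * ua (v (- s))))"
    unfolding uA_def sum_distrib_left
    by (intro sum.cong refl) (simp add: v_mid v_uminus_mid)
  also have "\<dots> = uA * ub d + uz * ua d + uz * ua d"
    by (simp only: sum.distrib contract_ua_mult[OF d] uA_def sum_distrib_right)
  finally show ?thesis by (simp add: mult_2 add.assoc)
qed

lemma ub_uC: "d \<in> mid \<Longrightarrow> ub d * uC = uC * ub d + uz * ub d"
proof -
  assume d: "d \<in> mid"
  have "ub d * (ua p * ub q) = ua p * ub q * ub d + uea_const (bil d p) * (uz * ub q)"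
    if "p \<in> mid" "q \<in> mid" for p q
    using that d by (simp add: normal_order algebra_simps bil_commute[of d])
  then have "ub d * uC = (\<Sum>s\<in>mid_indices. ua (v s) * ub (v (- s)) * ub d
      + uea_const (bil d (v s)) * (uz * ub (v (- s))))"
    unfolding uC_def sum_distrib_left
    by (intro sum.cong refl) (simp add: v_mid v_uminus_mid)
  also have "\<dots> = uC * ub d + uz * ub d"
    by (simp only: sum.distrib contract_ub_mult[OF d] uC_def sum_distrib_right)
  finally show ?thesis .
qed

lemma ub_uB: "d \<in> mid \<Longrightarrow> ub d * uB = uB * ub d"
  unfolding uB_def sum_distrib_left sum_distrib_right
  by (intro sum.cong refl) (simp add: normal_order v_mid v_uminus_mid)

lemma ue12_uw:
  assumes d: "d \<in> mid"
  shows "ue 1 2 * uw d = uw d * ue 1 2 - uw' d"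
proof -
  have "ue 1 2 * uw d = (ue 1 2 * uA) * ub d - (ue 1 2 * ua d) * uC"
    by (simp add: uw_def right_diff_distrib mult.assoc)
  also have "\<dots> = (uA * ue 1 2 - 2 * uC - 4 * uz) * ub d - (ua d * ue 1 2 - ub d) * uC"
    using d by (simp only: ue_sums comm_single)
  also have "\<dots> = uA * (ue 1 2 * ub d) - 2 * (uC * ub d) - 4 * (uz * ub d) - ua d * (ue 1 2 * uC) + ub d * uC"
    by (simp add: algebra_simps)
  also have "\<dots> = uw d * ue 1 2 - uw' d"
    using d by (simp only: ue_sums comm_single ub_uC uw_def uw'_def)
      (simp add: algebra_simps numeral_expand)
  finally show ?thesis .
qed

lemma ue12_uw':
  assumes d: "d \<in> mid"
  shows "ue 1 2 * uw' d = uw' d * ue 1 2"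
proof -
  have "ue 1 2 * uw' d = (ue 1 2 * uC) * ub d - (ue 1 2 * ua d) * uB + 3 * ((ue 1 2 * uz) * ub d)"
    using const_left_commute[of "ue 1 2" 3] by (simp add: uw'_def right_diff_distrib distrib_left mult.assoc)
  also have "\<dots> = (uC * ue 1 2 - uB) * ub d - (ua d * ue 1 2 - ub d) * uB + 3 * ((uz * ue 1 2) * ub d)"
    using d by (simp only: ue_sums comm_single)
  also have "\<dots> = uC * (ue 1 2 * ub d) - uB * ub d - ua d * (ue 1 2 * uB) + ub d * uB + 3 * (uz * (ue 1 2 * ub d))"
    by (simp add: algebra_simps)
  also have "\<dots> = uw' d * ue 1 2"
    using d by (simp only: ue_sums comm_single ub_uB uw'_def) (simp add: algebra_simps comm_assoc d)
  finally show ?thesis .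
qed

end

text \<open>Relations in the left ideal annihilating the generator of the generalized Verma module, on which the diagonal
  elements \<open>ue 1 1\<close> and \<open>ue 2 2\<close> have eigenvalue \<open>- 1\<close>.\<close>

locale verma_ideal = witt_basis +
  fixes J :: "so8 uea set"
  assumes J_add: "u \<in> J \<Longrightarrow> w \<in> J \<Longrightarrow> u + w \<in> J"
    and J_mult: "w \<in> J \<Longrightarrow> u * w \<in> J"
    and J_levi: "p \<in> mid \<Longrightarrow> q \<in> mid \<Longrightarrow> ur p q \<in> J" "ue 1 2 \<in> J" "ue 2 1 \<in> J"
      "ue 1 1 + 1 \<in> J" "ue 2 2 + 1 \<in> J"
    and J_nil: "c \<in> mid \<Longrightarrow> ux c \<in> J" "c \<in> mid \<Longrightarrow> uy c \<in> J"
begin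

definition eqv :: "so8 uea \<Rightarrow> so8 uea \<Rightarrow> bool" (infix "\<doteq>" 50) where
  "u \<doteq> w \<longleftrightarrow> u - w \<in> J"

lemma J_zero: "0 \<in> J" and J_uminus: "u \<in> J \<Longrightarrow> - u \<in> J"
  using J_mult[OF J_levi(2), of 0] J_mult[of u "- 1"] by simp_all

lemma eqv_refl: "u \<doteq> u"
  by (simp add: eqv_def J_zero)

lemma eqv_sym: "u \<doteq> w \<Longrightarrow> w \<doteq> u"
  using J_uminus[of "u - w"] by (simp add: eqv_def)

lemma eqv_trans [trans]: "u \<doteq> w \<Longrightarrow> w \<doteq> t \<Longrightarrow> u \<doteq> t"
  using J_add[of "u - w" "w - t"] by (simp add: eqv_def)

lemma eqv_eq_trans [trans]: "u \<doteq> w \<Longrightarrow> w = t \<Longrightarrow> u \<doteq> t" "u = w \<Longrightarrow> w \<doteq> t \<Longrightarrow> u \<doteq> t"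
  by simp_all

lemma eqv_add: "u \<doteq> u' \<Longrightarrow> w \<doteq> w' \<Longrightarrow> u + w \<doteq> u' + w'"
  using J_add[of "u - u'" "w - w'"] by (simp add: eqv_def algebra_simps)

lemma eqv_uminus: "u \<doteq> u' \<Longrightarrow> - u \<doteq> - u'"
  using J_uminus[of "u - u'"] by (simp add: eqv_def)

lemma eqv_diff: "u \<doteq> u' \<Longrightarrow> w \<doteq> w' \<Longrightarrow> u - w \<doteq> u' - w'"
  using eqv_add[OF _ eqv_uminus] by fastforce

lemma eqv_mult: "u \<doteq> u' \<Longrightarrow> t * u \<doteq> t * u'"
  using J_mult[of "u - u'" t] by (simp add: eqv_def right_diff_distrib)

lemma eqv_sum: "(\<And>s. s \<in> I \<Longrightarrow> f s \<doteq> g s) \<Longrightarrow> (\<Sum>s\<in>I. f s) \<doteq> (\<Sum>s\<in>I. g s)"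
  by (induction I rule: infinite_finite_induct) (simp_all add: eqv_refl eqv_add)

lemma eqv_J: "u \<doteq> w \<Longrightarrow> w \<in> J \<Longrightarrow> u \<in> J"
  using J_add[of "u - w" w] by (simp add: eqv_def)

lemma eqv_0: "u \<in> J \<longleftrightarrow> u \<doteq> 0"
  by (simp add: eqv_def)

lemmas eqv_intros = eqv_refl eqv_add eqv_diff eqv_uminus eqv_mult

lemma cyclic:
  "p \<in> mid \<Longrightarrow> q \<in> mid \<Longrightarrow> ur p q \<doteq> 0" "ue 1 2 \<doteq> 0" "ue 2 1 \<doteq> 0" "ue 1 1 \<doteq> - 1" "ue 2 2 \<doteq> - 1"
  "c \<in> mid \<Longrightarrow> ux c \<doteq> 0" "c \<in> mid \<Longrightarrow> uy c \<doteq> 0"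
  using J_levi J_nil by (simp_all add: eqv_def)

lemma degree_one:
  assumes c: "c \<in> mid" and d: "d \<in> mid"
  shows "ux c * ub d \<doteq> 0" "uy c * ub d \<doteq> uea_const (bil c d)"
    "ue 1 1 * ub d \<doteq> - ub d" "ue 2 2 * ub d \<doteq> - 2 * ub d" "ue 2 1 * ub d \<doteq> - ua d"
    "ue 1 2 * ub d \<doteq> 0"
proof -
  have "ux c * ub d \<doteq> ub d * 0 - uea_const (bil c d) * 0"
    unfolding comm(5)[OF c d] by (intro eqv_intros cyclic c d)
  then show "ux c * ub d \<doteq> 0" by simp
  have "uy c * ub d \<doteq> ub d * 0 + 0 - uea_const (bil c d) * (- 1)"
    unfolding comm(7)[OF c d] by (intro eqv_intros cyclic c d)
  then show "uy c * ub d \<doteq> uea_const (bil c d)" by simp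
  have "ub d * ue 1 1 \<doteq> ub d * (- 1)" by (intro eqv_intros cyclic)
  then show "ue 1 1 * ub d \<doteq> - ub d" using comm_single(4)[OF d] by simp
  have "ub d * ue 2 2 - ub d \<doteq> ub d * (- 1) - ub d" by (intro eqv_intros cyclic)
  then show "ue 2 2 * ub d \<doteq> - 2 * ub d" using comm_single(6)[OF d] by (simp add: mult_2)
  have "ub d * ue 2 1 - ua d \<doteq> ub d * 0 - ua d" by (intro eqv_intros cyclic)
  then show "ue 2 1 * ub d \<doteq> - ua d" using comm_single(10)[OF d] by simp
  have "ub d * ue 1 2 \<doteq> ub d * 0" by (intro eqv_intros cyclic)
  then show "ue 1 2 * ub d \<doteq> 0" using comm_single(8)[OF d] by simp
qed

lemma ur_ub:
  assumes p: "p \<in> mid" and q: "q \<in> mid" and d: "d \<in> mid"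
  shows "ur p q * ub d \<doteq> uea_const (bil q d) * ub p - uea_const (bil p d) * ub q"
proof -
  have "ub d * ur p q + uea_const (bil q d) * ub p - uea_const (bil p d) * ub q
      \<doteq> ub d * 0 + uea_const (bil q d) * ub p - uea_const (bil p d) * ub q"
    by (intro eqv_intros cyclic p q)
  then show ?thesis using comm_ur(2)[OF p q d] by simp
qed

text \<open>The contributions of the two terms of \<open>uw d\<close> are both \<open>2 * (bil c d * uC - ua d * ub c)\<close>. That they agree
  depends on the dimension of the middle block, which enters as the factor \<open>4\<close> of \<open>sum_mid_const\<close>, and on
  the eigenvalue \<open>- 1\<close> of the generator.\<close>

lemma ux_uw:
  assumes c: "c \<in> mid" and d: "d \<in> mid"
  shows "ux c * uw d \<in> J"
proof -
  let ?k = "uea_const (bil c d)"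
  have "ux c * (uA * ub d) = uA * (ux c * ub d) + 2 * (\<Sum>s\<in>mid_indices. ua (v (- s)) * (ur (v s) c * ub d))
      - 2 * (ua c * (ue 1 1 * ub d)) - 2 * (ua c * ub d)"
  proof -
    have "ux c * (uA * ub d) = (ux c * uA) * ub d" by (simp only: mult.assoc)
    then show ?thesis
      by (simp add: ux_uA[OF c] mult.assoc distrib_right left_diff_distrib sum_distrib_right)
  qed
  also have "\<dots> \<doteq> uA * 0 + 2 * (\<Sum>s\<in>mid_indices. ua (v (- s)) * (uea_const (bil c d) * ub (v s) - uea_const (bil (v s) d) * ub c))
      - 2 * (ua c * (- ub d)) - 2 * (ua c * ub d)"
    by (intro eqv_intros eqv_sum ur_ub degree_one[OF c] c d v_mid)
  also have "\<dots> = 2 * (\<Sum>s\<in>mid_indices. ?k * (ua (v (- s)) * ub (v s)) - uea_const (bil d (v s)) * (ua (v (- s)) * ub c))"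
    by (simp add: right_diff_distrib const_left_commutes bil_commute[of d])
  also have "\<dots> = 2 * (?k * uC - ua d * ub c)"
    by (simp only: sum_subtractf contract_ua_mult[OF d] uC_swap sum_distrib_left[symmetric])
  finally have 1: "ux c * (uA * ub d) \<doteq> 2 * (?k * uC - ua d * ub c)" .
  have x: "ux c * uC \<doteq> - 2 * ub c"
  proof -
    have "ux c * uC = (\<Sum>s\<in>mid_indices. ua (v s) * (ux c * ub (v (- s))) + ur (v s) c * ub (v (- s))
        - uea_const (bil c (v s)) * (ue 1 1 * ub (v (- s))))"
      unfolding uC_def sum_distrib_left
      by (intro sum.cong refl)
        (simp add: mult.assoc[symmetric] comm(4)[OF c] v_mid distrib_right left_diff_distrib)
    also have "\<dots> \<doteq> (\<Sum>s\<in>mid_indices. ua (v s) * 0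
        + (uea_const (bil c (v (- s))) * ub (v s) - uea_const (bil (v s) (v (- s))) * ub c)
        - uea_const (bil c (v s)) * (- ub (v (- s))))"
      by (intro eqv_sum eqv_intros ur_ub degree_one[OF c] c v_mid v_uminus_mid)
    also have "\<dots> = (\<Sum>s\<in>mid_indices. uea_const (bil c (v (- s))) * ub (v s) - ub c
        + uea_const (bil c (v s)) * ub (v (- s)))"
      by (intro sum.cong refl) (simp add: bil_v_mid)
    also have "\<dots> = ub c - 4 * ub c + ub c"
      by (simp only: sum.distrib sum_subtractf contract_ub[OF c] sum_mid_const)
    also have "\<dots> = - 2 * ub c" by (simp add: algebra_simps flip: mult_2)
    finally show ?thesis .
  qed
  have e: "ue 1 1 * uC \<doteq> - 2 * uC" 
  proof -
    have "uC * ue 1 1 - uC \<doteq> uC * (- 1) - uC" by (intro eqv_intros cyclic)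
    then show ?thesis by (simp add: ue_sums mult_2)
  qed
  have r: "ur d c * uC \<doteq> 0"
  proof -
    have "uC * ur d c \<doteq> uC * 0" by (intro eqv_intros cyclic c d)
    then show ?thesis by (simp add: ur_uC[OF d c])
  qed
  have "ux c * (ua d * uC) = ua d * (ux c * uC) + ur d c * uC - ?k * (ue 1 1 * uC)"
    by (simp add: mult.assoc[symmetric] comm(4)[OF c d] distrib_right left_diff_distrib)
  also have "\<dots> \<doteq> ua d * (- 2 * ub c) + 0 - ?k * (- 2 * uC)"
    by (intro eqv_intros x e r)
  also have "\<dots> = 2 * (?k * uC - ua d * ub c)"
    by (simp add: numeral_expand algebra_simps)
  finally have 2: "ux c * (ua d * uC) \<doteq> 2 * (?k * uC - ua d * ub c)" .
  from eqv_diff[OF 1 2] show ?thesis by (simp add: uw_def right_diff_distrib eqv_0)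
qed

lemma uy_uw:
  assumes c: "c \<in> mid" and d: "d \<in> mid"
  shows "uy c * uw d \<in> J"
proof -
  let ?k = "uea_const (bil c d)"
  have "uy c * (uA * ub d) = uA * (uy c * ub d) - 2 * (ua c * (ue 2 1 * ub d))"
    by (simp add: uy_uA[OF c] mult.assoc[symmetric] left_diff_distrib)
  also have "\<dots> \<doteq> uA * ?k - 2 * (ua c * (- ua d))"
    by (intro eqv_intros degree_one[OF c] d)
  also have "\<dots> = ?k * uA + 2 * (ua d * ua c)"
    by (simp add: uea_const_commute comm(1)[OF c d])
  finally have 1: "uy c * (uA * ub d) \<doteq> ?k * uA + 2 * (ua d * ua c)" .
  have y: "uy c * uC \<doteq> 2 * ua c"
  proof -
    have "uy c * uC = (\<Sum>s\<in>mid_indices. ua (v s) * (uy c * ub (v (- s)))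
        - uea_const (bil c (v s)) * (ue 2 1 * ub (v (- s))))"
      unfolding uC_def sum_distrib_left
      by (intro sum.cong refl)
        (simp add: mult.assoc[symmetric] comm(6)[OF c] v_mid distrib_right left_diff_distrib)
    also have "\<dots> \<doteq> (\<Sum>s\<in>mid_indices. ua (v s) * uea_const (bil c (v (- s)))
        - uea_const (bil c (v s)) * (- ua (v (- s))))"
      by (intro eqv_sum eqv_intros degree_one[OF c] v_uminus_mid)
    also have "\<dots> = (\<Sum>s\<in>mid_indices. uea_const (bil c (v (- s))) * ua (v s) + uea_const (bil c (v s)) * ua (v (- s)))"
      by (simp add: uea_const_commute)
    also have "\<dots> = ua c + ua c"
      by (simp only: sum.distrib contract_ua[OF c])
    finally show ?thesis by (simp add: mult_2)
  qed
  have e: "ue 2 1 * uC \<doteq> - uA"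
  proof -
    have "uC * ue 2 1 - uA \<doteq> uC * 0 - uA" by (intro eqv_intros cyclic)
    then show ?thesis by (simp add: ue_sums)
  qed
  have "uy c * (ua d * uC) = ua d * (uy c * uC) - ?k * (ue 2 1 * uC)"
    by (simp add: mult.assoc[symmetric] comm(6)[OF c d] left_diff_distrib)
  also have "\<dots> \<doteq> ua d * (2 * ua c) - ?k * (- uA)"
    by (intro eqv_intros y e)
  also have "\<dots> = ?k * uA + 2 * (ua d * ua c)"
    using const_left_commute[of "ua d" 2] by simp
  finally have 2: "uy c * (ua d * uC) \<doteq> ?k * uA + 2 * (ua d * ua c)" .
  from eqv_diff[OF 1 2] show ?thesis by (simp add: uw_def right_diff_distrib eqv_0)
qed

lemma uw'_eqv: "d \<in> mid \<Longrightarrow> uw' d \<doteq> - (ue 1 2 * uw d)"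
proof -
  assume d: "d \<in> mid"
  have "- (uw d * ue 1 2 - uw' d) \<doteq> - (uw d * 0 - uw' d)" by (intro eqv_intros cyclic)
  then have "- (ue 1 2 * uw d) \<doteq> uw' d" by (simp add: ue12_uw[OF d])
  then show ?thesis by (rule eqv_sym)
qed

text \<open>By \<open>ue12_uw\<close> the second row is the image of the first under \<open>ue 1 2\<close>, which normalizes the nilradical.\<close>

lemma ux_uw': "c \<in> mid \<Longrightarrow> d \<in> mid \<Longrightarrow> ux c * uw' d \<in> J"
  and uy_uw': "c \<in> mid \<Longrightarrow> d \<in> mid \<Longrightarrow> uy c * uw' d \<in> J"
proof -
  assume c: "c \<in> mid" and d: "d \<in> mid"
  have "ux c * (ue 1 2 * uw d) = ue 1 2 * (ux c * uw d)"
    by (simp add: mult.assoc[symmetric] comm_ue[OF c])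
  also have "\<dots> \<in> J" by (intro J_mult ux_uw c d)
  finally have x: "ux c * (ue 1 2 * uw d) \<in> J" .
  have "uy c * (ue 1 2 * uw d) = ue 1 2 * (uy c * uw d) + - (ux c * uw d)"
    by (simp add: mult.assoc[symmetric] comm_ue[OF c] left_diff_distrib)
  also have "\<dots> \<in> J" by (intro J_add J_uminus J_mult ux_uw uy_uw c d)
  finally have y: "uy c * (ue 1 2 * uw d) \<in> J" .
  show "ux c * uw' d \<in> J" using eqv_J[OF eqv_mult[OF uw'_eqv[OF d]]] J_uminus[OF x] by simp
  show "uy c * uw' d \<in> J" using eqv_J[OF eqv_mult[OF uw'_eqv[OF d]]] J_uminus[OF y] by simp
qed

text \<open>The Levi factor acts on the vectors \<open>uw d\<close>, \<open>uw' d\<close> as on the two rows of the tensor product of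
  the standard representations of its two factors, up to a character.\<close>

lemma levi_uw:
  assumes d: "d \<in> mid"
  shows "ue 1 1 * uw d \<doteq> - 3 * uw d" "ue 2 2 * uw d \<doteq> - 2 * uw d" "ue 2 1 * uw d \<doteq> 0"
    "ue 1 2 * uw d \<doteq> - uw' d"
proof -
  have "ue 1 1 * uw d = (ue 1 1 * uA) * ub d - (ue 1 1 * ua d) * uC"
    by (simp add: uw_def right_diff_distrib mult.assoc)
  also have "\<dots> = uA * (ue 1 1 * ub d) - 2 * (uA * ub d) - (ua d * (ue 1 1 * uC) - ua d * uC)"
    using d by (simp add: ue_sums(5) comm_single left_diff_distrib mult.assoc)
  also have "\<dots> = uw d * ue 1 1 - 2 * uw d"
    using d by (simp only: ue_sums comm_single uw_def) (simp add: algebra_simps mult_2)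
  also have "\<dots> \<doteq> uw d * (- 1) - 2 * uw d" by (intro eqv_intros cyclic)
  also have "\<dots> = - 3 * uw d" by (simp add: numeral_expand algebra_simps)
  finally show "ue 1 1 * uw d \<doteq> - 3 * uw d" .
  have "ue 2 2 * uw d = (ue 2 2 * uA) * ub d - (ue 2 2 * ua d) * uC"
    by (simp add: uw_def right_diff_distrib mult.assoc)
  also have "\<dots> = uA * (ue 2 2 * ub d) - ua d * (ue 2 2 * uC)"
    using d by (simp only: ue_sums comm_single mult.assoc)
  also have "\<dots> = uw d * ue 2 2 - uw d"
    using d by (simp only: ue_sums comm_single uw_def) (simp add: algebra_simps)
  also have "\<dots> \<doteq> uw d * (- 1) - uw d" by (intro eqv_intros cyclic)
  also have "\<dots> = - 2 * uw d" by (simp add: mult_2)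
  finally show "ue 2 2 * uw d \<doteq> - 2 * uw d" .
  have "ue 2 1 * uw d = (ue 2 1 * uA) * ub d - (ue 2 1 * ua d) * uC"
    by (simp add: uw_def right_diff_distrib mult.assoc)
  also have "\<dots> = uA * (ue 2 1 * ub d) - ua d * (ue 2 1 * uC)"
    using d by (simp only: ue_sums comm_single mult.assoc)
  also have "\<dots> = uw d * ue 2 1 - uA * ua d + ua d * uA"
    using d by (simp only: ue_sums comm_single uw_def) (simp add: algebra_simps)
  also have "uA * ua d = ua d * uA"
    unfolding uA_def sum_distrib_left sum_distrib_right
    by (intro sum.cong refl) (simp add: d comm comm_assoc mult.assoc v_mid v_uminus_mid)
  also have "uw d * ue 2 1 - ua d * uA + ua d * uA \<doteq> uw d * 0 - ua d * uA + ua d * uA"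
    by (intro eqv_intros cyclic)
  also have "\<dots> = 0" by simp
  finally show "ue 2 1 * uw d \<doteq> 0" .
  show "ue 1 2 * uw d \<doteq> - uw' d"
    using eqv_uminus[OF eqv_sym[OF uw'_eqv[OF d]]] by simp
qed

lemma levi_uw':
  assumes d: "d \<in> mid"
  shows "ue 1 1 * uw' d \<doteq> - 2 * uw' d" "ue 2 2 * uw' d \<doteq> - 3 * uw' d" "ue 2 1 * uw' d \<doteq> - uw d"
    "ue 1 2 * uw' d \<doteq> 0"
proof -
  have "ue 1 1 * uw' d \<doteq> ue 1 1 * - (ue 1 2 * uw d)" by (intro eqv_intros uw'_eqv d)
  also have "\<dots> = - (ue 1 2 * (ue 1 1 * uw d) + ue 1 2 * uw d)"
    by (simp add: mult.assoc[symmetric] comm_ue[OF d] distrib_right)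
  also have "\<dots> \<doteq> - (ue 1 2 * (- 3 * uw d) + ue 1 2 * uw d)" by (intro eqv_intros levi_uw d)
  also have "\<dots> = 2 * (ue 1 2 * uw d)"
    by (simp add: numeral_expand algebra_simps)
  also have "\<dots> \<doteq> 2 * - uw' d" by (intro eqv_intros levi_uw d)
  finally show "ue 1 1 * uw' d \<doteq> - 2 * uw' d" by simp
  have "ue 2 2 * uw' d \<doteq> ue 2 2 * - (ue 1 2 * uw d)" by (intro eqv_intros uw'_eqv d)
  also have "\<dots> = - (ue 1 2 * (ue 2 2 * uw d) - ue 1 2 * uw d)"
    by (simp add: mult.assoc[symmetric] comm_ue[OF d] left_diff_distrib)
  also have "\<dots> \<doteq> - (ue 1 2 * (- 2 * uw d) - ue 1 2 * uw d)" by (intro eqv_intros levi_uw d)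
  also have "\<dots> = 3 * (ue 1 2 * uw d)"
    by (simp add: numeral_expand algebra_simps)
  also have "\<dots> \<doteq> 3 * - uw' d" by (intro eqv_intros levi_uw d)
  finally show "ue 2 2 * uw' d \<doteq> - 3 * uw' d" by simp
  have "ue 2 1 * uw' d \<doteq> ue 2 1 * - (ue 1 2 * uw d)" by (intro eqv_intros uw'_eqv d)
  also have "\<dots> = - (ue 1 2 * (ue 2 1 * uw d) + ue 2 2 * uw d - ue 1 1 * uw d)"
    by (simp add: mult.assoc[symmetric] comm_ue[OF d] distrib_right left_diff_distrib)
  also have "\<dots> \<doteq> - (ue 1 2 * 0 + - 2 * uw d - - 3 * uw d)" by (intro eqv_intros levi_uw d)
  also have "\<dots> = - uw d" by (simp add: numeral_expand algebra_simps)
  finally show "ue 2 1 * uw' d \<doteq> - uw d" .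
  have "uw' d * ue 1 2 \<doteq> uw' d * 0" by (intro eqv_intros cyclic)
  then show "ue 1 2 * uw' d \<doteq> 0" by (simp add: ue12_uw'[OF d])
qed

lemma ur_uw:
  assumes p: "p \<in> mid" and q: "q \<in> mid" and d: "d \<in> mid"
  shows "ur p q * uw d \<doteq> uw (bil q d *s p - bil p d *s q)"
    and "ur p q * uw' d \<doteq> uw' (bil q d *s p - bil p d *s q)"
proof -
  let ?d = "bil q d *s p - bil p d *s q"
  have mid: "?d \<in> mid" using p q by (intro mid_diff mid_scale)
  have ab: "ur p q * ua d = ua d * ur p q + ua ?d" "ur p q * ub d = ub d * ur p q + ub ?d"
    using comm_ur[OF p q d] by (simp_all add: ua_linear ub_linear add_diff_eq)
  have "ur p q * (ua c * ua e) = ua c * ua e * ur p q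
      + uea_const (bil q c) * (ua p * ua e) - uea_const (bil p c) * (ua q * ua e)
      + uea_const (bil q e) * (ua c * ua p) - uea_const (bil p e) * (ua c * ua q)"
    if "c \<in> mid" "e \<in> mid" for c e
    using that p q by (simp add: normal_order algebra_simps)
  then have "ur p q * uA = (\<Sum>s\<in>mid_indices. ua (v s) * ua (v (- s)) * ur p q
      + uea_const (bil q (v s)) * (ua p * ua (v (- s))) - uea_const (bil p (v s)) * (ua q * ua (v (- s)))
      + uea_const (bil q (v (- s))) * (ua (v s) * ua p) - uea_const (bil p (v (- s))) * (ua (v s) * ua q))"
    unfolding uA_def sum_distrib_left
    by (intro sum.cong refl) (simp add: v_mid v_uminus_mid)
  also have "\<dots> = uA * ur p q + ua p * ua q - ua q * ua p + ua q * ua p - ua p * ua q"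
    by (simp only: sum.distrib sum_subtractf contract_ua_mult[OF q] contract_ua_mult[OF p]
        uA_def sum_distrib_right)
  finally have A: "ur p q * uA = uA * ur p q" by simp
  have "ur p q * uw d = (ur p q * uA) * ub d - (ur p q * ua d) * uC"
    by (simp add: uw_def right_diff_distrib mult.assoc)
  also have "\<dots> = uA * (ur p q * ub d) - ua d * (ur p q * uC) - ua ?d * uC"
    by (simp add: A ab distrib_right distrib_left mult.assoc ur_uC[OF p q])
  also have "\<dots> = uw d * ur p q + uw ?d"
    by (simp only: ab ur_uC[OF p q] uw_def) (simp add: algebra_simps)
  finally have exact: "ur p q * uw d = uw d * ur p q + uw ?d" .
  have "uw d * ur p q + uw ?d \<doteq> uw d * 0 + uw ?d" by (intro eqv_intros cyclic p q)
  then show uw: "ur p q * uw d \<doteq> uw ?d" by (simp add: exact)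
  have "ur p q * uw' d \<doteq> ur p q * - (ue 1 2 * uw d)" by (intro eqv_intros uw'_eqv d)
  also have "\<dots> = - (ue 1 2 * (ur p q * uw d))"
    by (simp add: mult.assoc[symmetric] comm_ur(4)[OF p q d])
  also have "\<dots> \<doteq> - (ue 1 2 * uw ?d)" by (intro eqv_intros uw)
  also have "\<dots> \<doteq> - (- uw' ?d)" by (intro eqv_intros levi_uw mid)
  finally show "ur p q * uw' d \<doteq> uw' ?d" by simp
qed

end

section \<open>The Heisenberg parabolic subalgebra\<close>

text \<open>The Weyl group in disguise: permutations of the basis that commute with negation of the indices act
  transitively on the roots. The two remaining positive indices are chosen arbitrarily.\<close>

lemma relabelled_basis:
  assumes cb: "cartan_basis v h" and \<gamma>: "\<gamma> \<in> roots h"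
  shows "\<exists>w. cartan_basis w h \<and> \<gamma> = cartan_basis.eps w h 1 + cartan_basis.eps w h 2"
proof -
  interpret cartan_basis v h by (rule cb)
  obtain s t where st: "root_pair s t" and \<gamma>_eq: "\<gamma> = eps s + eps t" using root_obtain[OF \<gamma>] by blast
  have pick: "\<exists>c\<in>{1, 2, 3, 4}. c \<notin> S" if "finite S" "card S \<le> 3" for S :: "int set"
  proof (rule ccontr)
    assume "\<not> ?thesis"
    then have "card {1, 2, 3, 4 :: int} \<le> card S" using that(1) by (intro card_mono) auto
    then show False using that(2) by simp
  qed
  have "\<exists>c\<in>{1, 2, 3, 4}. c \<notin> {\<bar>s\<bar>, \<bar>t\<bar>}" by (rule pick) (simp_all add: card_insert_if)
  then obtain c where c: "c \<in> {1, 2, 3, 4}" "c \<notin> {\<bar>s\<bar>, \<bar>t\<bar>}" by (elim bexE)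
  have "\<exists>d\<in>{1, 2, 3, 4}. d \<notin> {\<bar>s\<bar>, \<bar>t\<bar>, c}" by (rule pick) (simp_all add: card_insert_if)
  then obtain d where d: "d \<in> {1, 2, 3, 4}" "d \<notin> {\<bar>s\<bar>, \<bar>t\<bar>, c}" by (elim bexE)
  define \<rho> where "\<rho> k = (if k = 1 then s else if k = 2 then t else if k = 3 then c else d)" for k :: int
  define \<pi> where "\<pi> k = (if 0 < k then \<rho> k else - \<rho> (- k))" for k
  have I: "s \<in> signed_indices" "t \<in> signed_indices" "s \<noteq> t" "s \<noteq> - t"
    using st by (auto simp: root_pair_def)
  have cd: "c \<in> signed_indices" "d \<in> signed_indices" "0 < c" "0 < d"
    using c d by (auto simp: signed_indices_def)
  have \<rho>_in: "\<rho> k \<in> signed_indices" for k using I cd by (simp add: \<rho>_def)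
  then have \<pi>_in: "\<pi> k \<in> signed_indices" for k by (simp add: \<pi>_def signed_uminus)
  have abs_ne: "\<bar>s\<bar> \<noteq> \<bar>t\<bar>" using I by presburger
  have \<rho>_inj: "k = l" if "\<bar>\<rho> k\<bar> = \<bar>\<rho> l\<bar>" "k \<in> {1, 2, 3, 4}" "l \<in> {1, 2, 3, 4}" for k l
  proof -
    obtain a b where eqs: "a = \<bar>s\<bar>" "b = \<bar>t\<bar>" by blast
    have ne: "a \<noteq> b" "a \<noteq> c" "a \<noteq> d" "b \<noteq> c" "b \<noteq> d" "c \<noteq> d"
      using abs_ne c(2) d(2) unfolding eqs by blast+
    have abs: "\<bar>\<rho> m\<bar> = (if m = 1 then a else if m = 2 then b else if m = 3 then c else d)" for m
      using cd(3,4) by (simp add: \<rho>_def eqs)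
    from that(2) have "k = 1 \<or> k = 2 \<or> k = 3 \<or> k = 4" by simp
    moreover from that(3) have "l = 1 \<or> l = 2 \<or> l = 3 \<or> l = 4" by simp
    ultimately show ?thesis
      using that(1) ne unfolding abs by presburger
  qed
  have \<pi>_sum: "\<pi> k + \<pi> l = 0 \<longleftrightarrow> k + l = 0" if kl: "k \<in> signed_indices" "l \<in> signed_indices" for k l
  proof
    assume "k + l = 0"
    then have "l = - k" "k \<noteq> 0" using signed_nonzero kl by auto
    then show "\<pi> k + \<pi> l = 0" by (simp add: \<pi>_def)
  next
    assume zero: "\<pi> k + \<pi> l = 0"
    have abs: "\<bar>\<pi> m\<bar> = \<bar>\<rho> \<bar>m\<bar>\<bar>" "\<bar>m\<bar> \<in> {1, 2, 3, 4}" if "m \<in> signed_indices" for m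
      using that by (auto simp: \<pi>_def signed_indices_def)
    have "\<bar>\<pi> k\<bar> = \<bar>\<pi> l\<bar>" using zero by presburger
    then have "\<bar>k\<bar> = \<bar>l\<bar>" using \<rho>_inj[of "\<bar>k\<bar>" "\<bar>l\<bar>"] abs[OF kl(1)] abs[OF kl(2)] by simp
    moreover have "k \<noteq> l" using zero signed_nonzero[OF \<pi>_in[of k]] by auto
    ultimately show "k + l = 0" by presburger
  qed
  have \<pi>_neg: "\<pi> (- k) = - \<pi> k" if "k \<in> signed_indices" for k
    using \<pi>_sum[of k "- k"] that signed_uminus by force
  define w where "w k = v (\<pi> k)" for k
  interpret w: witt_basis w
    by standard (simp add: w_def bil_v \<pi>_in \<pi>_sum)
  have "inj_on \<pi> signed_indices"
  proof (rule inj_onI)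
    fix k l assume kl: "k \<in> signed_indices" "l \<in> signed_indices" "\<pi> k = \<pi> l"
    then have "\<pi> k + \<pi> (- l) = 0" by (simp add: \<pi>_neg)
    then show "k = l" using \<pi>_sum[of k "- l"] kl by (simp add: signed_uminus)
  qed
  then have surj: "\<pi> ` signed_indices = signed_indices"
    using endo_inj_surj[OF finite_signed, of \<pi>] \<pi>_in by blast
  interpret w: cartan_basis w h
  proof
    fix A show "A \<in> h \<longleftrightarrow> (\<forall>s\<in>signed_indices. \<exists>c. app A (w s) = c *s w s)"
      unfolding h_iff w_def by (subst surj[symmetric]) (simp add: image_iff)
  qed
  have "w.eps k = eps (\<pi> k)" if "k \<in> signed_indices" for k
    using that by (auto simp: w.eps_def eps_def w_def \<pi>_neg fun_eq_iff)
  moreover have "\<pi> 1 = s" "\<pi> 2 = t" by (simp_all add: \<pi>_def \<rho>_def)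
  ultimately have "\<gamma> = w.eps 1 + w.eps 2"
    unfolding \<gamma>_eq by (simp add: signed_indices_def)
  then show ?thesis using w.cartan_basis_axioms by blast
qed

context witt_basis
begin

lemma mid_induct [consumes 1, case_names basis add scale]:
  assumes d: "d \<in> mid" and basis: "\<And>s. s \<in> mid_indices \<Longrightarrow> Q (v s)"
    and add: "\<And>c d. Q c \<Longrightarrow> Q d \<Longrightarrow> Q (c + d)" and scale: "\<And>k d. Q d \<Longrightarrow> Q (k *s d)"
  shows "Q d"
proof -
  have "Q (\<Sum>s\<in>mid_indices. bil d (v (- s)) *s v s)"
    unfolding sum_mid by (intro add scale basis) (simp_all add: mid_indices_def)
  then show ?thesis using mid_expand[OF d] by simp
qed

end

locale heisenberg = root_datum +
  fixes \<Theta> :: "(so8 \<Rightarrow> complex) set" and l n q :: "so8 set"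
  assumes \<gamma>_eps: "\<gamma> = eps 1 + eps 2"
    and \<Theta>: "\<Theta> = {\<alpha> \<in> simple_roots P. dual_form B h \<alpha> \<gamma> = 0}"
    and l: "l = std_levi h \<Theta>"
    and n: "n = std_nilradical h P \<Theta>"
    and q: "q = std_parabolic h P \<Theta>"
begin

lemma root_pair_12: "root_pair 1 2"
  by (simp add: root_pair_def signed_indices_def)

lemma H_\<gamma>: "H \<gamma> = torus 1 + torus 2"
  using X_positive(1)[OF root_pair_12] \<gamma>_P \<gamma>_eps by simp

lemma H_\<gamma>_h: "H \<gamma> \<in> h"
  unfolding H_\<gamma> by (intro h_add torus_h) (simp_all add: signed_indices_def)

lemma eps_H_\<gamma>:
  assumes "s \<in> signed_indices"
  shows "eps s (H \<gamma>) = (if s = 1 \<or> s = 2 then 1 else if s = - 1 \<or> s = - 2 then - 1 else 0)"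
proof -
  have "eps s (H \<gamma>) = eps s (torus 1) + eps s (torus 2)"
    unfolding H_\<gamma> by (intro eps_add torus_h) (simp_all add: signed_indices_def)
  then show ?thesis using assms by (simp add: eps_torus signed_indices_def)
qed

text \<open>The eigenvalue of \<open>H \<gamma>\<close> on \<open>v s\<close>, as an integer for the sake of case distinctions.\<close>

definition grade :: "int \<Rightarrow> int" where
  "grade s = (if s = 1 \<or> s = 2 then 1 else if s = - 1 \<or> s = - 2 then - 1 else 0)"

lemma eps_grade: "s \<in> signed_indices \<Longrightarrow> eps s (H \<gamma>) = of_int (grade s)"
  by (simp add: eps_H_\<gamma> grade_def)

lemma grade_mid: "s \<in> mid_indices \<Longrightarrow> grade s = 0"
  unfolding mid_indices_def grade_def by auto

lemma grade_zero_cases: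
  assumes "grade s + grade t = 0" "s \<in> signed_indices" "t \<in> signed_indices"
  shows "s \<in> {1, 2} \<and> t \<in> {- 1, - 2} \<or> s \<in> {- 1, - 2} \<and> t \<in> {1, 2} \<or> s \<in> mid_indices \<and> t \<in> mid_indices"
  using assms unfolding grade_def mid_indices_def signed_indices_def by (auto split: if_splits)

lemma grade_minus_cases:
  assumes "grade s + grade t = - 1" "s \<in> signed_indices" "t \<in> signed_indices"
  shows "s \<in> {- 1, - 2} \<and> t \<in> mid_indices \<or> s \<in> mid_indices \<and> t \<in> {- 1, - 2}"
  using assms unfolding grade_def mid_indices_def signed_indices_def by (auto split: if_splits)

lemma grade_positive_cases:
  assumes "0 < grade s + grade t" "s \<in> signed_indices" "t \<in> signed_indices"
  shows "s \<in> {1, 2} \<and> t \<in> {1, 2} \<or> s \<in> {1, 2} \<and> t \<in> mid_indices \<or> s \<in> mid_indices \<and> t \<in> {1, 2}"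
  using assms unfolding grade_def mid_indices_def signed_indices_def by (auto split: if_splits)

lemma l_span: "l = cvs.span (h \<union> (\<Union>\<alpha>\<in>{\<alpha> \<in> roots h. \<alpha> (H \<gamma>) = 0}. root_space h \<alpha>))"
  unfolding l std_levi_def levi_roots_eq[OF \<Theta>] by simp

lemma n_span: "n = cvs.span (\<Union>\<alpha>\<in>{\<alpha> \<in> roots h. 0 < Re (\<alpha> (H \<gamma>))}. root_space h \<alpha>)"
  unfolding n std_nilradical_def positive_outside_levi[OF \<Theta>] by simp

lemma l_add: "x \<in> l \<Longrightarrow> y \<in> l \<Longrightarrow> x + y \<in> l" and l_scale: "x \<in> l \<Longrightarrow> c *\<^sub>C x \<in> l"
  and l_zero: "0 \<in> l" and l_minus: "x \<in> l \<Longrightarrow> - x \<in> l" and l_diff: "x \<in> l \<Longrightarrow> y \<in> l \<Longrightarrow> x - y \<in> l"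
  and n_add: "x \<in> n \<Longrightarrow> y \<in> n \<Longrightarrow> x + y \<in> n" and n_scale: "x \<in> n \<Longrightarrow> c *\<^sub>C x \<in> n" and n_zero: "0 \<in> n"
  unfolding l_span n_span
  by (erule (1) cvs.span_add, erule cvs.span_scale, rule cvs.span_zero, erule cvs.span_neg,
      erule (1) cvs.span_diff, erule (1) cvs.span_add, erule cvs.span_scale, rule cvs.span_zero)

lemma l_subset_q: "x \<in> l \<Longrightarrow> x \<in> q" and n_subset_q: "x \<in> n \<Longrightarrow> x \<in> q"
  unfolding q std_parabolic_def l[symmetric] n[symmetric]
proof -
  show "x \<in> {x + y |x y. x \<in> l \<and> y \<in> n}" if "x \<in> l"
    using that n_zero add_0_right[of x] by (metis (mono_tags, lifting) mem_Collect_eq)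
  show "x \<in> {x + y |x y. x \<in> l \<and> y \<in> n}" if "x \<in> n"
    using that l_zero add_0_left[of x] by (metis (mono_tags, lifting) mem_Collect_eq)
qed

lemma q_cases: "x \<in> q \<Longrightarrow> \<exists>y z. x = y + z \<and> y \<in> l \<and> z \<in> n"
  unfolding q std_parabolic_def l[symmetric] n[symmetric] by blast

lemma root_vector_space: "root_pair s t \<Longrightarrow> wedge (v s) (v t) \<in> root_space h (eps s + eps t)"
proof -
  assume "root_pair s t"
  then have "1 *\<^sub>C wedge (v s) (v t) \<in> root_space h (eps s + eps t)" using root_space_eq by blast
  then show ?thesis by (simp add: cscale_simps)
qed

lemma wedge_in_l:
  assumes s: "s \<in> signed_indices" and t: "t \<in> signed_indices" and zero: "eps s (H \<gamma>) + eps t (H \<gamma>) = 0"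
  shows "wedge (v s) (v t) \<in> l"
proof -
  consider "s = t" | "s = - t" | "root_pair s t" using s t by (auto simp: root_pair_def)
  then show ?thesis
  proof cases
    case 1
    then show ?thesis by (simp add: wedge_simps l_zero)
  next
    case 2
    then have "wedge (v s) (v t) = torus s" by (simp add: torus_def)
    then show ?thesis using torus_h[OF s] unfolding l_span by (simp add: cvs.span_base)
  next
    case 3
    then have "eps s + eps t \<in> roots h" by (rule root_pair_root)
    moreover have "(eps s + eps t) (H \<gamma>) = 0" using zero by simp
    ultimately show ?thesis
      using root_vector_space[OF 3] unfolding l_span by (intro cvs.span_base) blast
  qed
qed

lemma levi_elements:
  "wedge (v 1) (v (- 1)) \<in> l" "wedge (v 1) (v (- 2)) \<in> l" "wedge (v 2) (v (- 1)) \<in> l" "wedge (v 2) (v (- 2)) \<in> l"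
  "c \<in> mid \<Longrightarrow> d \<in> mid \<Longrightarrow> wedge c d \<in> l"
proof -
  show "wedge (v 1) (v (- 1)) \<in> l" "wedge (v 1) (v (- 2)) \<in> l" "wedge (v 2) (v (- 1)) \<in> l"
    "wedge (v 2) (v (- 2)) \<in> l"
    by (rule wedge_in_l; simp add: eps_H_\<gamma> signed_indices_def)+
  have st: "wedge (v s) (v t) \<in> l" if "s \<in> mid_indices" "t \<in> mid_indices" for s t
    by (intro wedge_in_l) (simp_all add: mid_signed eps_grade grade_mid that)
  assume c: "c \<in> mid" and d: "d \<in> mid"
  have sd: "wedge (v s) d \<in> l" if s: "s \<in> mid_indices" for s
    using d by (induction rule: mid_induct) (simp_all add: wedge_simps st s l_add l_scale)
  show "wedge c d \<in> l"
    using c by (induction rule: mid_induct) (simp_all add: wedge_simps sd l_add l_scale)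
qed

lemma nil_elements:
  assumes d: "d \<in> mid"
  shows "wedge (v 1) d \<in> n" "wedge (v 2) d \<in> n"
proof -
  have st: "wedge (v i) (v s) \<in> n" if "i \<in> {1, 2}" "s \<in> mid_indices" for i s
  proof -
    have "root_pair i s" using that by (auto simp: root_pair_def signed_indices_def mid_indices_def)
    moreover have "i \<in> signed_indices" "grade i = 1" using that(1) by (auto simp: grade_def signed_indices_def)
    then have "0 < Re ((eps i + eps s) (H \<gamma>))"
      by (simp add: eps_grade mid_signed[OF that(2)] grade_mid[OF that(2)])
    ultimately show ?thesis
      using root_vector_space root_pair_root unfolding n_span by (intro cvs.span_base) blast
  qed
  have "wedge (v i) d \<in> n" if i: "i \<in> {1, 2}" for i
    using d by (induction rule: mid_induct) (simp_all add: wedge_simps st[OF i] n_add n_scale)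
  then show "wedge (v 1) d \<in> n" "wedge (v 2) d \<in> n" by simp_all
qed

lemma h_expand:
  assumes A: "A \<in> h"
  shows "A = eps 1 A *\<^sub>C torus 1 + eps 2 A *\<^sub>C torus 2 + eps 3 A *\<^sub>C torus 3 + eps 4 A *\<^sub>C torus 4"
proof (rule app_basis_eqI)
  fix s assume s: "s \<in> signed_indices"
  have t: "app (torus i) (v s) = (if s = i then v i else if s = - i then - v (- i) else 0)"
    if "i \<in> {1, 2, 3, 4}" for i
  proof -
    have i: "i \<in> signed_indices" using that by (auto simp: signed_indices_def)
    then show ?thesis
      using app_wedge_basis[of i "- i" s] s signed_nonzero[OF i] unfolding torus_def
      by (auto simp: signed_uminus)
  qed
  show "app A (v s) = app (eps 1 A *\<^sub>C torus 1 + eps 2 A *\<^sub>C torus 2 + eps 3 A *\<^sub>C torus 3 + eps 4 A *\<^sub>C torus 4) (v s)"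
    using s app_h[OF A s] fun_cong[OF eps_uminus, of _ A] t[of 1] t[of 2] t[of 3] t[of 4]
    by (auto simp: app_simps signed_indices_def)
qed

lemma l_induct [consumes 1, case_names zero add scale e11 e12 e21 e22 mid]:
  assumes Z: "Z \<in> l" and zero: "Q 0" and add: "\<And>x y. Q x \<Longrightarrow> Q y \<Longrightarrow> Q (x + y)"
    and scale: "\<And>c x. Q x \<Longrightarrow> Q (c *\<^sub>C x)"
    and e: "Q (wedge (v 1) (v (- 1)))" "Q (wedge (v 1) (v (- 2)))" "Q (wedge (v 2) (v (- 1)))"
      "Q (wedge (v 2) (v (- 2)))"
    and mid: "\<And>c d. c \<in> mid \<Longrightarrow> d \<in> mid \<Longrightarrow> Q (wedge c d)"
  shows "Q Z"
proof -
  have minus: "Q (- x)" if "Q x" for x using scale[OF that, of "- 1"] by (simp add: cscale_simps)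
  have torus: "Q (torus 1)" "Q (torus 2)" "Q (torus 3)" "Q (torus 4)"
    using e mid[OF v_mid v_mid] by (simp_all add: torus_def mid_indices_def)
  have gen: "Q x" if "x \<in> h \<union> (\<Union>\<alpha>\<in>{\<alpha> \<in> roots h. \<alpha> (H \<gamma>) = 0}. root_space h \<alpha>)" for x
    using that
  proof
    assume "x \<in> h"
    show "Q x" by (subst h_expand[OF \<open>x \<in> h\<close>]) (intro add scale torus)
  next
    assume "x \<in> (\<Union>\<alpha>\<in>{\<alpha> \<in> roots h. \<alpha> (H \<gamma>) = 0}. root_space h \<alpha>)"
    then obtain \<alpha> where \<alpha>: "\<alpha> \<in> roots h" "\<alpha> (H \<gamma>) = 0" "x \<in> root_space h \<alpha>" by blast
    obtain s t where st: "root_pair s t" "\<alpha> = eps s + eps t" using root_obtain[OF \<alpha>(1)] by blast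
    obtain c where x: "x = c *\<^sub>C wedge (v s) (v t)" using \<alpha>(3) root_space_eq[OF st(1)] st(2) by blast
    have I: "s \<in> signed_indices" "t \<in> signed_indices" using st by (auto simp: root_pair_def)
    have "of_int (grade s + grade t) = (0 :: complex)"
      using \<alpha>(2) st(2) I by (simp add: eps_grade)
    then have zero: "grade s + grade t = 0" by (simp only: of_int_eq_0_iff)
    have swap: "Q (wedge (v t) (v s))" if "Q (wedge (v s) (v t))" for s t
      using minus[OF that] wedge_commute[of "v t" "v s"] by simp
    have "Q (wedge (v s) (v t))"
      using grade_zero_cases[OF zero I] e swap[OF e(1)] swap[OF e(2)] swap[OF e(3)] swap[OF e(4)]
        mid[OF v_mid v_mid] by blast
    then show "Q x" unfolding x by (rule scale)
  qed
  show ?thesis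
    using Z unfolding l_span by (induction rule: cvs.span_induct_alt) (auto intro: zero add scale gen)
qed

lemma n_induct [consumes 1, case_names zero add scale top first second]:
  assumes Z: "Z \<in> n" and zero: "Q 0" and add: "\<And>x y. Q x \<Longrightarrow> Q y \<Longrightarrow> Q (x + y)"
    and scale: "\<And>c x. Q x \<Longrightarrow> Q (c *\<^sub>C x)" and top: "Q (wedge (v 1) (v 2))"
    and rows: "\<And>d. d \<in> mid \<Longrightarrow> Q (wedge (v 1) d)" "\<And>d. d \<in> mid \<Longrightarrow> Q (wedge (v 2) d)"
  shows "Q Z"
proof -
  have swap: "Q (wedge y x)" if "Q (wedge x y)" for x y
    using scale[OF that, of "- 1"] wedge_commute[of y x] by (simp add: cscale_simps)
  have gen: "Q x" if "x \<in> (\<Union>\<alpha>\<in>{\<alpha> \<in> roots h. 0 < Re (\<alpha> (H \<gamma>))}. root_space h \<alpha>)" for x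
  proof -
    obtain \<alpha> where \<alpha>: "\<alpha> \<in> roots h" "0 < Re (\<alpha> (H \<gamma>))" "x \<in> root_space h \<alpha>" using \<open>x \<in> _\<close> by blast
    obtain s t where st: "root_pair s t" "\<alpha> = eps s + eps t" using root_obtain[OF \<alpha>(1)] by blast
    obtain c where x: "x = c *\<^sub>C wedge (v s) (v t)" using \<alpha>(3) root_space_eq[OF st(1)] st(2) by blast
    have I: "s \<in> signed_indices" "t \<in> signed_indices" "s \<noteq> t" using st by (auto simp: root_pair_def)
    have "0 < Re (of_int (grade s + grade t))"
      using \<alpha>(2) st(2) I by (simp add: eps_grade)
    then have pos: "0 < grade s + grade t" by (simp only: complex_Re_of_int of_int_0_less_iff)
    have rows': "Q (wedge (v 1) (v s))" "Q (wedge (v 2) (v s))" "Q (wedge (v s) (v 1))" "Q (wedge (v s) (v 2))"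
      if "s \<in> mid_indices" for s
      using rows[OF v_mid[OF that]] swap by blast+
    have "Q (wedge (v s) (v t))"
      using grade_positive_cases[OF pos I(1,2)] I(3) rows' top swap[OF top] by blast
    then show "Q x" unfolding x by (rule scale)
  qed
  show ?thesis
    using Z unfolding n_span by (induction rule: cvs.span_induct_alt) (auto intro: zero add scale gen)
qed

lemma V_minus_eq:
  "ad_eigenspace (H \<gamma>) (- 1) = {wedge (v (- 1)) c + wedge (v (- 2)) d | c d. c \<in> mid \<and> d \<in> mid}"
proof safe
  fix Y assume Y: "Y \<in> ad_eigenspace (H \<gamma>) (- 1)"
  have zero: "(eps s (H \<gamma>) + eps t (H \<gamma>) + 1) * entry Y s t = 0"
    if "s \<in> signed_indices" "t \<in> signed_indices" for s t
  proof -
    have "entry (lie (H \<gamma>) Y) s t = entry ((- 1) *\<^sub>C Y) s t" using Y by (simp add: ad_eigenspace_def)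
    then show ?thesis
      unfolding entry_lie_h[OF H_\<gamma>_h that] entry_scale by (simp add: algebra_simps add_eq_0_iff)
  qed
  define c where "c = (\<Sum>s\<in>mid_indices. entry Y (- 1) s *s v s)"
  define d where "d = (\<Sum>s\<in>mid_indices. entry Y (- 2) s *s v s)"
  have mid: "c \<in> mid" "d \<in> mid"
    unfolding c_def d_def sum_mid by (intro mid_add mid_scale v_mid; simp add: mid_indices_def)+
  have coord: "bil c (v (- t)) = (if t \<in> mid_indices then entry Y (- 1) t else 0)"
    "bil d (v (- t)) = (if t \<in> mid_indices then entry Y (- 2) t else 0)" if t: "t \<in> signed_indices" for t
  proof -
    have "(\<Sum>s\<in>mid_indices. bil (entry Y i s *s v s) (v (- t))) = (\<Sum>s\<in>mid_indices. if s = t then entry Y i t else 0)" for i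
      by (intro sum.cong refl) (auto simp: bil_simps bil_v_uminus mid_signed t)
    then show "bil c (v (- t)) = (if t \<in> mid_indices then entry Y (- 1) t else 0)"
      "bil d (v (- t)) = (if t \<in> mid_indices then entry Y (- 2) t else 0)"
      unfolding c_def d_def bil_sum_left by (simp_all add: finite_mid)
  qed
  have "Y = wedge (v (- 1)) c + wedge (v (- 2)) d"
  proof (rule entry_eqI)
    fix s t assume st: "s \<in> signed_indices" "t \<in> signed_indices"
    have row: "entry (wedge (v i) x) s t = bil x (v (- t)) * (if i = s then 1 else 0) - (if i = t then 1 else 0) * bil x (v (- s))"
      if "i \<in> signed_indices" for i x
      using that st by (simp only: entry_def app_wedge bil_diff_left bil_scale_left bil_v_uminus)
    have I: "- 1 \<in> signed_indices" "- 2 \<in> signed_indices" by (simp_all add: signed_indices_def)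
    let ?R = "bil c (v (- t)) * (if - 1 = s then 1 else 0) - (if - 1 = t then 1 else 0) * bil c (v (- s))
      + (bil d (v (- t)) * (if - 2 = s then 1 else 0) - (if - 2 = t then 1 else 0) * bil d (v (- s)))"
    have mid_ne: "- 1 \<notin> mid_indices" "- 2 \<notin> mid_indices" by (simp_all add: mid_indices_def)
    consider (row1) "s = - 1" "t \<in> mid_indices" | (row2) "s = - 2" "t \<in> mid_indices"
      | (col1) "t = - 1" "s \<in> mid_indices" | (col2) "t = - 2" "s \<in> mid_indices"
      | (other) "\<not> (s \<in> {- 1, - 2} \<and> t \<in> mid_indices)" "\<not> (s \<in> mid_indices \<and> t \<in> {- 1, - 2})"
      by blast
    then have "entry Y s t = ?R"
    proof cases
      case row1
      then have "- 1 \<noteq> t" "- 2 \<noteq> t" using mid_ne by metis+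
      then show ?thesis using row1 coord(1)[OF st(2)] by simp
    next
      case row2
      then have "- 1 \<noteq> t" "- 2 \<noteq> t" using mid_ne by metis+
      then show ?thesis using row2 coord(2)[OF st(2)] by simp
    next
      case col1
      then have "- 1 \<noteq> s" "- 2 \<noteq> s" using mid_ne by metis+
      then show ?thesis using col1 coord(1)[OF st(1)] entry_swap[of Y s "- 1"] by simp
    next
      case col2
      then have "- 1 \<noteq> s" "- 2 \<noteq> s" using mid_ne by metis+
      then show ?thesis using col2 coord(2)[OF st(1)] entry_swap[of Y s "- 2"] by simp
    next
      case other
      have "grade s + grade t \<noteq> - 1" using grade_minus_cases[OF _ st] other by blast
      then have "of_int (grade s + grade t + 1) \<noteq> (0 :: complex)" by (simp only: of_int_eq_0_iff)
      moreover have "of_int (grade s + grade t + 1) * entry Y s t = 0"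
        using zero[OF st] by (simp add: eps_grade st)
      ultimately have "entry Y s t = 0" by simp
      moreover have "?R = 0"
        using other coord[OF st(1)] coord[OF st(2)] by (cases "s \<in> mid_indices"; cases "t \<in> mid_indices") auto
      ultimately show ?thesis by simp
    qed
    then show "entry Y s t = entry (wedge (v (- 1)) c + wedge (v (- 2)) d) s t"
      by (simp only: entry_add row[OF I(1)] row[OF I(2)])
  qed
  then show "\<exists>c d. Y = wedge (v (- 1)) c + wedge (v (- 2)) d \<and> c \<in> mid \<and> d \<in> mid" using mid by blast
next
  fix c d assume mid: "c \<in> mid" "d \<in> mid"
  have I: "- 1 \<in> signed_indices" "- 2 \<in> signed_indices" by (simp_all add: signed_indices_def)
  have "app (H \<gamma>) x = 0" if "x \<in> mid" for x
    using that
  proof (induction rule: mid_induct)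
    case (basis s)
    then show ?case
      using app_h[OF H_\<gamma>_h mid_signed[OF basis]] eps_H_\<gamma>[OF mid_signed[OF basis]] by (auto simp: mid_indices_def)
  qed (simp_all add: app_simps)
  then show "wedge (v (- 1)) c + wedge (v (- 2)) d \<in> ad_eigenspace (H \<gamma>) (- 1)"
    using mid app_h[OF H_\<gamma>_h I(1)] app_h[OF H_\<gamma>_h I(2)] eps_H_\<gamma>[OF I(1)] eps_H_\<gamma>[OF I(2)]
    by (simp add: ad_eigenspace_def lie_add_right lie_wedge wedge_simps cscale_simps)
qed

end

section \<open>The vectors \<open>\<omega>\<^sub>3(Y)\<close>\<close>

lemma uea_const_cancel: "c \<noteq> 0 \<Longrightarrow> uea_const (1 / c) * (uea_const c * u) = (u :: 'a::complex_lie_algebra uea)"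
  by (simp add: mult.assoc[symmetric] flip: uea_const_mult)

locale omega_setting = heisenberg +
  fixes DV :: "(so8 \<Rightarrow> complex) set"
    and N :: "(so8 \<Rightarrow> complex) \<Rightarrow> (so8 \<Rightarrow> complex) \<Rightarrow> complex"
    and Mc :: "(so8 \<Rightarrow> complex) \<Rightarrow> (so8 \<Rightarrow> complex) \<Rightarrow> so8 \<Rightarrow> complex"
    and u2 :: "so8 \<Rightarrow> so8 uea"
  assumes DV: "DV = {\<alpha> \<in> roots h. root_space h \<alpha> \<subseteq> ad_eigenspace (H \<gamma>) 1}"
    and N: "\<forall>\<beta>\<in>DV. lie (X \<beta>) (X (\<gamma> - \<beta>)) = N \<beta> (\<gamma> - \<beta>) *\<^sub>C X \<gamma>"
    and Mc: "\<forall>Z\<in>l. \<forall>\<alpha>\<in>DV. lie Z (X \<alpha>) = (\<Sum>\<beta>\<in>DV. Mc \<alpha> \<beta> Z *\<^sub>C X \<beta>)"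
    and u2_add: "\<forall>x\<in>l. \<forall>y\<in>l. u2 (x + y) = u2 x + u2 y"
    and u2_scale: "\<forall>c. \<forall>x\<in>l. u2 (c *\<^sub>C x) = uea_const c * u2 x"
    and u2_H: "u2 (H \<gamma>) = 0"
    and u2_derived: "\<forall>Z\<in>derived_algebra l. u2 Z =
      uea_const (- 1 / 2) * (\<Sum>\<alpha>\<in>DV. \<Sum>\<beta>\<in>DV.
        uea_const (N \<beta> (\<gamma> - \<beta>) * Mc \<alpha> (\<gamma> - \<beta>) Z) * uea_of (X (- \<alpha>)) * uea_of (X (- \<beta>)))"
begin

lemma DV_pair: "i \<in> {1, 2} \<Longrightarrow> s \<in> mid_indices \<Longrightarrow> root_pair i s"
  by (auto simp: root_pair_def signed_indices_def mid_indices_def)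

lemma grade_one_cases:
  assumes "grade s + grade t = 1" "s \<in> signed_indices" "t \<in> signed_indices"
  shows "s \<in> {1, 2} \<and> t \<in> mid_indices \<or> s \<in> mid_indices \<and> t \<in> {1, 2}"
  using assms unfolding grade_def mid_indices_def signed_indices_def by (auto split: if_splits)

lemma DV_eq: "DV = {eps i + eps s | i s. i \<in> {1, 2} \<and> s \<in> mid_indices}"
proof (intro equalityI subsetI)
  fix \<alpha> assume \<alpha>: "\<alpha> \<in> DV"
  then obtain s t where st: "root_pair s t" "\<alpha> = eps s + eps t" using root_obtain unfolding DV by blast
  have I: "s \<in> signed_indices" "t \<in> signed_indices" using st by (auto simp: root_pair_def)
  have "wedge (v s) (v t) \<in> ad_eigenspace (H \<gamma>) 1"
    using \<alpha> root_vector_space[OF st(1)] st(2) unfolding DV by blast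
  then have "(eps s (H \<gamma>) + eps t (H \<gamma>)) *\<^sub>C wedge (v s) (v t) = 1 *\<^sub>C wedge (v s) (v t)"
    unfolding ad_eigenspace_def using lie_h_wedge[OF H_\<gamma>_h I] by simp
  then have "(eps s (H \<gamma>) + eps t (H \<gamma>) - 1) *\<^sub>C wedge (v s) (v t) = 0" by (simp add: cscale_simps)
  then have "eps s (H \<gamma>) + eps t (H \<gamma>) = 1" using wedge_nonzero[OF st(1)] by (simp add: cvs.scale_eq_0_iff)
  then have "of_int (grade s + grade t) = (of_int 1 :: complex)" by (simp add: eps_grade I)
  then have "grade s + grade t = 1" by (simp only: of_int_eq_iff)
  then have "s \<in> {1, 2} \<and> t \<in> mid_indices \<or> s \<in> mid_indices \<and> t \<in> {1, 2}" by (rule grade_one_cases[OF _ I])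
  then show "\<alpha> \<in> {eps i + eps s | i s. i \<in> {1, 2} \<and> s \<in> mid_indices}"
    using st(2) add.commute[of "eps s" "eps t"] by blast
next
  fix \<alpha> assume "\<alpha> \<in> {eps i + eps s | i s. i \<in> {1, 2} \<and> s \<in> mid_indices}"
  then obtain i s where \<alpha>: "\<alpha> = eps i + eps s" and ps: "i \<in> {1, 2 :: int}" "s \<in> mid_indices"
    by blast
  have I: "i \<in> signed_indices" "s \<in> signed_indices" "grade i = 1"
    using ps mid_signed by (auto simp: signed_indices_def grade_def)
  have "lie (H \<gamma>) (wedge (v i) (v s)) = 1 *\<^sub>C wedge (v i) (v s)"
    using lie_h_wedge[OF H_\<gamma>_h I(1,2)] by (simp add: eps_grade I grade_mid[OF ps(2)])
  then have "root_space h (eps i + eps s) \<subseteq> ad_eigenspace (H \<gamma>) 1"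
    unfolding root_space_eq[OF DV_pair[OF ps]] ad_eigenspace_def
    by (auto simp: lie_cscale_right cscale_simps)
  then show "\<alpha> \<in> DV" unfolding DV \<alpha> using root_pair_root[OF DV_pair[OF ps]] by blast
qed

lemma DV_inj: "inj_on (\<lambda>(i, s). eps i + eps s) ({1, 2} \<times> mid_indices)"
proof (rule inj_onI, clarify)
  fix i s j t assume ps: "i \<in> {1, 2 :: int}" "s \<in> mid_indices" and jt: "j \<in> {1, 2 :: int}" "t \<in> mid_indices"
    and eq: "eps i + eps s = eps j + eps t"
  have "eps i A + eps s A = eps j A + eps t A" for A using fun_cong[OF eq, of A] by simp
  then have "j = i \<and> t = s \<or> j = s \<and> t = i"
    using eps_sum_eqD[OF DV_pair[OF ps]] DV_pair[OF jt] unfolding root_pair_def by blast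
  moreover have "s \<notin> {1, 2}" using ps(2) by (auto simp: mid_indices_def)
  ultimately show "i = j \<and> s = t" using jt(1) by blast
qed

lemma sum_DV: "(\<Sum>\<alpha>\<in>DV. F \<alpha>) = (\<Sum>i\<in>{1, 2}. \<Sum>s\<in>mid_indices. F (eps i + eps s) :: 'b::comm_monoid_add)"
proof -
  have "DV = (\<lambda>(i, s). eps i + eps s) ` ({1, 2} \<times> mid_indices)" unfolding DV_eq by force
  then have "sum F DV = sum (F \<circ> (\<lambda>(i, s). eps i + eps s)) ({1, 2} \<times> mid_indices)"
    by (simp only:) (rule sum.reindex[OF DV_inj])
  also have "\<dots> = (\<Sum>i\<in>{1, 2}. \<Sum>s\<in>mid_indices. F (eps i + eps s))"
    by (simp only: sum.cartesian_product o_def case_prod_unfold)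
  finally show ?thesis .
qed

text \<open>The unknown scalings of the root vectors \<open>X \<alpha>\<close> with \<open>\<alpha> \<in> DV\<close>; those of \<open>X (- \<alpha>)\<close> are the negative inverses.\<close>

definition k where "k i s = entry (X (eps i + eps s)) i s"

lemma X_DV:
  assumes "i \<in> {1, 2}" "s \<in> mid_indices"
  shows "k i s \<noteq> 0" "X (eps i + eps s) = k i s *\<^sub>C wedge (v i) (v s)"
    "X (- (eps i + eps s)) = (- 1 / k i s) *\<^sub>C wedge (v (- i)) (v (- s))"
proof -
  have rp: "root_pair i s" using DV_pair assms by blast
  obtain m where m: "m \<noteq> 0" "X (eps i + eps s) = m *\<^sub>C wedge (v i) (v s)"
    "X (eps (- i) + eps (- s)) = (- 1 / m) *\<^sub>C wedge (v (- i)) (v (- s))" using X_root[OF rp] by blast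
  have "k i s = m" using rp by (simp add: k_def m(2) entry_simps entry_wedge root_pair_def)
  moreover have "- (eps i + eps s) = eps (- i) + eps (- s)" by (simp add: eps_uminus)
  ultimately show "k i s \<noteq> 0" "X (eps i + eps s) = k i s *\<^sub>C wedge (v i) (v s)"
    "X (- (eps i + eps s)) = (- 1 / k i s) *\<^sub>C wedge (v (- i)) (v (- s))" using m by simp_all
qed

definition g where "g = entry (X \<gamma>) 1 2"

lemma X_\<gamma>: "g \<noteq> 0" "X \<gamma> = g *\<^sub>C wedge (v 1) (v 2)"
proof -
  obtain m where m: "m \<noteq> 0" "X \<gamma> = m *\<^sub>C wedge (v 1) (v 2)" using X_root[OF root_pair_12] \<gamma>_eps by blast
  then have "g = m" using root_pair_12 by (simp add: g_def entry_simps entry_wedge root_pair_def)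
  then show "g \<noteq> 0" "X \<gamma> = g *\<^sub>C wedge (v 1) (v 2)" using m by simp_all
qed

definition row where "row i c = uea_of (wedge (v (- i)) c)"
definition sgn_row :: "int \<Rightarrow> complex" where "sgn_row j = (if j = 1 then - 1 else 1)"

lemma row_simps: "row 1 = ua" "row 2 = ub"
  by (simp_all add: row_def ua_def ub_def fun_eq_iff)

lemma complement: "j \<in> {1, 2} \<Longrightarrow> \<gamma> - (eps j + eps t) = eps (3 - j) + eps (- t)"
  unfolding \<gamma>_eps by (auto simp: eps_uminus fun_eq_iff)

lemma N_value:
  assumes j: "j \<in> {1, 2}" and t: "t \<in> mid_indices"
  shows "N (eps j + eps t) (\<gamma> - (eps j + eps t)) = sgn_row j * (k j t * k (3 - j) (- t)) / g"
proof -
  have j': "3 - j \<in> {1, 2}" and t': "- t \<in> mid_indices" using j t by (auto simp: mid_uminus)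
  have br: "lie (wedge (v j) (v t)) (wedge (v (3 - j)) (v (- t))) = sgn_row j *\<^sub>C wedge (v 1) (v 2)"
    using j mid_bil[OF v_mid[OF t]] mid_bil[OF v_mid[OF t']] bil_v_mid[OF t]
    by (auto simp: lie_wedge_wedge bil_v_concrete wedge_simps sgn_row_def cscale_simps wedge_commute[of "v 2" "v 1"])
  have "eps j + eps t \<in> DV" unfolding DV_eq using j t by blast
  then have "N (eps j + eps t) (\<gamma> - (eps j + eps t)) *\<^sub>C X \<gamma>
      = lie (X (eps j + eps t)) (X (eps (3 - j) + eps (- t)))"
    using N complement[OF j] by metis
  then have "(N (eps j + eps t) (\<gamma> - (eps j + eps t)) * g) *\<^sub>C wedge (v 1) (v 2)
      = (k j t * k (3 - j) (- t) * sgn_row j) *\<^sub>C wedge (v 1) (v 2)"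
    unfolding X_DV(2)[OF j t] X_DV(2)[OF j' t'] X_\<gamma>(2) lie_cscale_left lie_cscale_right br
    by (simp add: cscale_simps mult_ac)
  then have "N (eps j + eps t) (\<gamma> - (eps j + eps t)) * g = k j t * k (3 - j) (- t) * sgn_row j"
    using wedge_nonzero[OF root_pair_12] by (simp add: cvs.scale_cancel_right)
  then show ?thesis using X_\<gamma>(1) by (simp add: field_simps)
qed

lemma Mc_value:
  assumes Z: "Z \<in> l" and i: "i \<in> {1, 2}" and s: "s \<in> mid_indices" and j: "j \<in> {1, 2}" and t: "t \<in> mid_indices"
  shows "Mc (eps i + eps s) (eps j + eps t) Z * k j t = k i s * entry (lie Z (wedge (v i) (v s))) j t"
proof -
  have "eps i + eps s \<in> DV" unfolding DV_eq using i s by blast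
  then have "lie Z (X (eps i + eps s)) = (\<Sum>\<beta>\<in>DV. Mc (eps i + eps s) \<beta> Z *\<^sub>C X \<beta>)" using Mc Z by blast
  moreover have entry_sum: "entry (\<Sum>\<beta>\<in>A. F \<beta>) j t = (\<Sum>\<beta>\<in>A. entry (F \<beta>) j t)" for F :: "(so8 \<Rightarrow> complex) \<Rightarrow> so8" and A
    by (induction A rule: infinite_finite_induct) (simp_all add: entry_simps)
  ultimately have "entry (lie Z (X (eps i + eps s))) j t
      = (\<Sum>\<beta>\<in>DV. Mc (eps i + eps s) \<beta> Z * entry (X \<beta>) j t)"
    by (simp only: entry_scale)
  then have "k i s * entry (lie Z (wedge (v i) (v s))) j t
      = (\<Sum>p\<in>{1, 2}. \<Sum>q\<in>mid_indices. Mc (eps i + eps s) (eps p + eps q) Z * entry (X (eps p + eps q)) j t)"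
    by (simp only: X_DV(2)[OF i s] lie_cscale_right entry_scale sum_DV)
  also have "\<dots> = (\<Sum>p\<in>{1, 2}. \<Sum>q\<in>mid_indices. if p = j \<and> q = t then Mc (eps i + eps s) (eps j + eps t) Z * k j t else 0)"
  proof (intro sum.cong refl)
    fix p q assume p: "p \<in> {1, 2 :: int}" and q: "q \<in> mid_indices"
    have I: "p \<in> signed_indices" "q \<in> signed_indices" "j \<in> signed_indices" "t \<in> signed_indices"
      using DV_pair[OF p q] DV_pair[OF j t] unfolding root_pair_def by blast+
    have "p \<noteq> t" using p t by (auto simp: mid_indices_def)
    then show "Mc (eps i + eps s) (eps p + eps q) Z * entry (X (eps p + eps q)) j t
      = (if p = j \<and> q = t then Mc (eps i + eps s) (eps j + eps t) Z * k j t else 0)"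
      by (simp add: X_DV(2)[OF p q] entry_simps entry_wedge I)
  qed
  also have "\<dots> = Mc (eps i + eps s) (eps j + eps t) Z * k j t"
  proof -
    have "(\<Sum>q\<in>mid_indices. if p = j \<and> q = t then w else 0) = (if p = j then w else 0)" for p and w :: complex
      by (cases "p = j") (simp_all add: finite_mid t)
    then show ?thesis using j by auto
  qed
  finally show ?thesis by (rule sym)
qed

definition K where "K = uea_const (1 / (2 * g))"

text \<open>The scalings of the root vectors cancel: \<open>u2\<close> depends only on the invariant tensor that pairs
  the two halves of the nilradical, and on the choice of \<open>X \<gamma>\<close> through the factor \<open>K\<close>.\<close>

lemma u2_formula:
  assumes Z: "Z \<in> derived_algebra l" and Zl: "Z \<in> l"
    and c: "\<And>i s. i \<in> {1, 2} \<Longrightarrow> s \<in> mid_indices \<Longrightarrow> c1 i s \<in> mid \<and> c2 i s \<in> mid \<and>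
      lie Z (wedge (v i) (v s)) = wedge (v 1) (c1 i s) + wedge (v 2) (c2 i s)"
  shows "u2 Z = K * (\<Sum>s\<in>mid_indices. ua (v (- s)) * (ua (c2 1 s) - ub (c1 1 s)) + ub (v (- s)) * (ua (c2 2 s) - ub (c1 2 s)))"
proof -
  let ?e = "\<lambda>i s j t. entry (lie Z (wedge (v i) (v s))) j t"
  have ent: "?e i s 1 (- t) = bil (c1 i s) (v t)" "?e i s 2 (- t) = bil (c2 i s) (v t)"
    if "i \<in> {1, 2}" "s \<in> mid_indices" "t \<in> mid_indices" for i s t
    using c[OF that(1,2)] mid_bil[OF v_mid[OF that(3)]] bil_v_concrete mid_bil
    by (simp_all add: entry_def app_simps app_wedge bil_simps)
  have summand: "uea_const (N (eps j + eps t) (\<gamma> - (eps j + eps t)) * Mc (eps i + eps s) (\<gamma> - (eps j + eps t)) Z)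
        * uea_of (X (- (eps i + eps s))) * uea_of (X (- (eps j + eps t)))
      = uea_const (sgn_row j / g * ?e i s (3 - j) (- t)) * (row i (v (- s)) * row j (v (- t)))"
    if i: "i \<in> {1, 2}" and s: "s \<in> mid_indices" and j: "j \<in> {1, 2}" and t: "t \<in> mid_indices" for i s j t
  proof -
    have j': "3 - j \<in> {1, 2}" and t': "- t \<in> mid_indices" using j t by (auto simp: mid_uminus)
    have "N (eps j + eps t) (\<gamma> - (eps j + eps t)) * Mc (eps i + eps s) (\<gamma> - (eps j + eps t)) Z
        = sgn_row j * k j t / g * (Mc (eps i + eps s) (eps (3 - j) + eps (- t)) Z * k (3 - j) (- t))"
      unfolding N_value[OF j t] unfolding complement[OF j] by simp
    also have "\<dots> = sgn_row j / g * ?e i s (3 - j) (- t) * (k i s * k j t)"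
      unfolding Mc_value[OF Zl i s j' t'] by simp
    finally have NM: "N (eps j + eps t) (\<gamma> - (eps j + eps t)) * Mc (eps i + eps s) (\<gamma> - (eps j + eps t)) Z
      = sgn_row j / g * ?e i s (3 - j) (- t) * (k i s * k j t)" .
    have "uea_const (sgn_row j / g * ?e i s (3 - j) (- t) * (k i s * k j t)) * uea_of (X (- (eps i + eps s))) * uea_of (X (- (eps j + eps t)))
      = uea_const (sgn_row j / g * ?e i s (3 - j) (- t) * (k i s * k j t) * ((- 1 / k i s) * (- 1 / k j t))) * (row i (v (- s)) * row j (v (- t)))"
      unfolding X_DV(3)[OF i s] X_DV(3)[OF j t] uea_of_cscale row_def[symmetric]
      by (simp only: uea_const_mult mult.assoc const_left_commute[of "row i (v (- s))"])
    also have "sgn_row j / g * ?e i s (3 - j) (- t) * (k i s * k j t) * ((- 1 / k i s) * (- 1 / k j t)) = sgn_row j / g * ?e i s (3 - j) (- t)"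
      using X_DV(1)[OF i s] X_DV(1)[OF j t] by simp
    finally show ?thesis unfolding NM .
  qed
  have inner: "(\<Sum>j\<in>{1, 2}. \<Sum>t\<in>mid_indices. uea_const (sgn_row j / g * ?e i s (3 - j) (- t)) * (row i (v (- s)) * row j (v (- t))))
      = uea_const (1 / g) * (row i (v (- s)) * (ub (c1 i s) - ua (c2 i s)))"
    if i: "i \<in> {1, 2}" and s: "s \<in> mid_indices" for i s
  proof -
    have mid: "c1 i s \<in> mid" "c2 i s \<in> mid" using c[OF i s] by blast+
    have "(\<Sum>t\<in>mid_indices. uea_const (sgn_row 1 / g * ?e i s (3 - 1) (- t)) * (row i (v (- s)) * row 1 (v (- t))))
        = (\<Sum>t\<in>mid_indices. uea_const (- 1 / g) * (uea_const (bil (c2 i s) (v t)) * (row i (v (- s)) * ua (v (- t)))))"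
      by (intro sum.cong refl) (simp add: ent[OF i s] sgn_row_def row_simps mult.assoc uea_const_mult[symmetric] flip: mult.assoc)
    also have "\<dots> = uea_const (- 1 / g) * (row i (v (- s)) * ua (c2 i s))"
      by (simp only: sum_distrib_left[symmetric] contract_ua_mult[OF mid(2)])
    finally have 1: "(\<Sum>t\<in>mid_indices. uea_const (sgn_row 1 / g * ?e i s (3 - 1) (- t)) * (row i (v (- s)) * row 1 (v (- t))))
        = uea_const (- 1 / g) * (row i (v (- s)) * ua (c2 i s))" .
    have "(\<Sum>t\<in>mid_indices. uea_const (sgn_row 2 / g * ?e i s (3 - 2) (- t)) * (row i (v (- s)) * row 2 (v (- t))))
        = (\<Sum>t\<in>mid_indices. uea_const (1 / g) * (uea_const (bil (c1 i s) (v t)) * (row i (v (- s)) * ub (v (- t)))))"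
      by (intro sum.cong refl) (simp add: ent[OF i s] sgn_row_def row_simps mult.assoc uea_const_mult[symmetric] flip: mult.assoc)
    also have "\<dots> = uea_const (1 / g) * (row i (v (- s)) * ub (c1 i s))"
      by (simp only: sum_distrib_left[symmetric] contract_ub_mult[OF mid(1)])
    finally have 2: "(\<Sum>t\<in>mid_indices. uea_const (sgn_row 2 / g * ?e i s (3 - 2) (- t)) * (row i (v (- s)) * row 2 (v (- t))))
        = uea_const (1 / g) * (row i (v (- s)) * ub (c1 i s))" .
    have neg: "uea_const (- 1 / g) = - uea_const (1 / g)" by (simp flip: uea_const_minus)
    have "(\<Sum>j\<in>{1, 2}. \<Sum>t\<in>mid_indices. uea_const (sgn_row j / g * ?e i s (3 - j) (- t)) * (row i (v (- s)) * row j (v (- t))))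
      = uea_const (- 1 / g) * (row i (v (- s)) * ua (c2 i s)) + uea_const (1 / g) * (row i (v (- s)) * ub (c1 i s))"
      by (subst sum.insert) (use 1 2 in \<open>simp_all only: sum.insert sum.empty finite.intros, simp_all\<close>)
    then show ?thesis unfolding neg by (simp add: right_diff_distrib)
  qed
  have "u2 Z = uea_const (- 1 / 2) * (\<Sum>i\<in>{1, 2}. \<Sum>s\<in>mid_indices. \<Sum>j\<in>{1, 2}. \<Sum>t\<in>mid_indices.
      uea_const (sgn_row j / g * ?e i s (3 - j) (- t)) * (row i (v (- s)) * row j (v (- t))))"
    using u2_derived Z by (simp only: sum_DV summand cong: sum.cong)
  also have "\<dots> = uea_const (- 1 / 2) * (\<Sum>i\<in>{1, 2}. \<Sum>s\<in>mid_indices. uea_const (1 / g) * (row i (v (- s)) * (ub (c1 i s) - ua (c2 i s))))"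
    by (simp only: inner cong: sum.cong)
  also have "\<dots> = uea_const (- 1 / 2) * (uea_const (1 / g) * (\<Sum>s\<in>mid_indices. ua (v (- s)) * (ub (c1 1 s) - ua (c2 1 s))
      + ub (v (- s)) * (ub (c1 2 s) - ua (c2 2 s))))"
    by (simp add: row_simps sum_distrib_left distrib_left sum.distrib)
  also have "\<dots> = K * - (\<Sum>s\<in>mid_indices. ua (v (- s)) * (ub (c1 1 s) - ua (c2 1 s))
      + ub (v (- s)) * (ub (c1 2 s) - ua (c2 2 s)))"
  proof -
    have half: "uea_const (- 1 / 2) * uea_const (1 / g) = - K"
      by (simp add: K_def flip: uea_const_mult uea_const_minus)
    show ?thesis unfolding mult.assoc[symmetric] half by simp
  qed
  also have "- (\<Sum>s\<in>mid_indices. ua (v (- s)) * (ub (c1 1 s) - ua (c2 1 s)) + ub (v (- s)) * (ub (c1 2 s) - ua (c2 2 s)))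
     = (\<Sum>s\<in>mid_indices. ua (v (- s)) * (ua (c2 1 s) - ub (c1 1 s)) + ub (v (- s)) * (ua (c2 2 s) - ub (c1 2 s)))"
    by (simp add: sum_negf[symmetric] algebra_simps)
  finally show ?thesis .
qed

lemma derived_add: "x \<in> derived_algebra l \<Longrightarrow> y \<in> derived_algebra l \<Longrightarrow> x + y \<in> derived_algebra l"
  and derived_scale: "x \<in> derived_algebra l \<Longrightarrow> c *\<^sub>C x \<in> derived_algebra l"
  and derived_zero: "0 \<in> derived_algebra l"
  and derived_lie: "x \<in> l \<Longrightarrow> y \<in> l \<Longrightarrow> lie x y \<in> derived_algebra l"
  unfolding derived_algebra_def
  by (erule (1) cvs.span_add, erule cvs.span_scale, rule cvs.span_zero,
      rule cvs.span_base, blast)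

text \<open>A torus element \<open>wedge (v s) (v (- s))\<close> of the middle block is obtained from two commutators that involve
  another index \<open>p\<close> and in whose sum the torus element of \<open>p\<close> cancels.\<close>

lemma derived_elements:
  "wedge (v 1) (v (- 2)) \<in> derived_algebra l" "wedge (v 2) (v (- 1)) \<in> derived_algebra l"
  "wedge (v 1) (v (- 1)) - wedge (v 2) (v (- 2)) \<in> derived_algebra l"
  "c \<in> mid \<Longrightarrow> d \<in> mid \<Longrightarrow> wedge c d \<in> derived_algebra l"
proof -
  have "lie (wedge (v 1) (v (- 1))) (wedge (v 1) (v (- 2))) = wedge (v 1) (v (- 2))"
    "lie (wedge (v 2) (v (- 2))) (wedge (v 2) (v (- 1))) = wedge (v 2) (v (- 1))"
    "lie (wedge (v 1) (v (- 2))) (wedge (v 2) (v (- 1))) = wedge (v 1) (v (- 1)) - wedge (v 2) (v (- 2))"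
    by (simp_all add: lie_wedge_wedge bil_v_concrete wedge_simps)
  then show "wedge (v 1) (v (- 2)) \<in> derived_algebra l" "wedge (v 2) (v (- 1)) \<in> derived_algebra l"
    "wedge (v 1) (v (- 1)) - wedge (v 2) (v (- 2)) \<in> derived_algebra l"
    using derived_lie levi_elements by metis+
  have st: "wedge (v s) (v t) \<in> derived_algebra l" if s: "s \<in> mid_indices" and t: "t \<in> mid_indices" for s t
  proof -
    have I: "s \<in> signed_indices" "t \<in> signed_indices" "s \<noteq> 0" "t \<noteq> 0"
      using s t mid_signed signed_nonzero by blast+
    have W: "wedge (v p) (v q) \<in> l" if "p \<in> mid_indices" "q \<in> mid_indices" for p q
      using levi_elements(5) v_mid that by blast
    consider "s = t" | "s \<noteq> t" "s \<noteq> - t" | "s = - t" by blast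
    then show ?thesis
    proof cases
      case 1
      then show ?thesis by (simp add: wedge_simps derived_zero)
    next
      case 2
      have "t \<noteq> s" "t \<noteq> - s" "s \<noteq> - s" using 2 I by auto
      then have "lie (torus s) (wedge (v s) (v t)) = wedge (v s) (v t)"
        using lie_h_wedge[OF torus_h[OF I(1)] I(1,2)] eps_torus[OF I(1) I(1)] eps_torus[OF I(1) I(2)]
        by (simp add: cscale_simps)
      then show ?thesis
        using derived_lie[OF W[OF s, of "- s"] W[OF s t]] s unfolding torus_def by (simp add: mid_uminus)
    next
      case 3
      then have t: "t = - s" by simp
      obtain p where p: "p \<in> mid_indices" "p \<noteq> s" "p \<noteq> - s" by (rule other_mid_index)
      have J: "p \<in> signed_indices" "- p \<in> signed_indices" "- s \<in> signed_indices" "p \<noteq> 0"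
        using p(1) I mid_signed signed_nonzero by (simp_all add: signed_uminus)
      have ne: "p \<noteq> - p" "s \<noteq> - s" "- p \<noteq> s" "s \<noteq> p" using J(4) I(3) p by auto
      have zero: "bil (v p) (v p) = 0" "bil (v s) (v s) = 0" "bil (v s) (v p) = 0" "bil (v p) (v s) = 0"
        "bil (v (- p)) (v (- p)) = 0" "bil (v (- s)) (v (- s)) = 0" "bil (v (- s)) (v p) = 0"
        "bil (v p) (v (- s)) = 0" "bil (v s) (v (- p)) = 0" "bil (v (- p)) (v s) = 0"
        "bil (v (- p)) (v (- s)) = 0" "bil (v (- s)) (v (- p)) = 0"
        using p ne J(4) I(3) by (simp_all add: bil_v I J(1-3))
      have br: "lie (wedge (v s) (v p)) (wedge (v (- s)) (v (- p))) = - wedge (v p) (v (- p)) - wedge (v s) (v (- s))"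
        "lie (wedge (v s) (v (- p))) (wedge (v (- s)) (v p)) = - wedge (v (- p)) (v p) - wedge (v s) (v (- s))"
        using bil_v_mid[OF p(1)] bil_v_mid[OF s] wedge_commute[of "v (- s)" "v s"]
        by (simp_all add: lie_wedge_wedge zero wedge_simps)
      have "wedge (v s) (v (- s)) = (- 1 / 2) *\<^sub>C
          (lie (wedge (v s) (v p)) (wedge (v (- s)) (v (- p))) + lie (wedge (v s) (v (- p))) (wedge (v (- s)) (v p)))"
      proof -
        have "- wedge (v p) (v (- p)) - wedge (v s) (v (- s)) + (- wedge (v (- p)) (v p) - wedge (v s) (v (- s)))
          = (- 2) *\<^sub>C wedge (v s) (v (- s))"
          using wedge_commute[of "v (- p)" "v p"] cscale_left_distrib[of "- 1" "- 1" "wedge (v s) (v (- s))"]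
          by (simp add: cscale_simps)
        then show ?thesis unfolding br by (simp add: cscale_simps)
      qed
      also have "\<dots> \<in> derived_algebra l"
        by (intro derived_scale derived_add derived_lie W) (simp_all add: s p(1) mid_uminus)
      finally show ?thesis unfolding t .
    qed
  qed
  assume c: "c \<in> mid" and d: "d \<in> mid"
  have sd: "wedge (v s) d \<in> derived_algebra l" if s: "s \<in> mid_indices" for s
    using d by (induction rule: mid_induct) (simp_all add: wedge_simps st s derived_add derived_scale)
  show "wedge c d \<in> derived_algebra l"
    using c by (induction rule: mid_induct) (simp_all add: wedge_simps sd derived_add derived_scale)
qed

lemma u2_mid:
  assumes p: "p \<in> mid" and r: "r \<in> mid"
  shows "u2 (wedge p r) = K * (2 * (ua p * ub r - ua r * ub p))"
proof -
  define w where "w s = bil r (v s) *s p - bil p (v s) *s r" for s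
  have w: "w s \<in> mid" for s unfolding w_def by (intro mid_diff mid_scale p r)
  have lin: "ua (w s) = uea_const (bil r (v s)) * ua p - uea_const (bil p (v s)) * ua r"
    "ub (w s) = uea_const (bil r (v s)) * ub p - uea_const (bil p (v s)) * ub r" for s
    by (simp_all add: w_def ua_linear ub_linear)
  have "u2 (wedge p r) = K * (\<Sum>s\<in>mid_indices. ua (v (- s)) * (ua (if (1::int) = 1 then 0 else w s) - ub (if (1::int) = 1 then w s else 0))
      + ub (v (- s)) * (ua (if (2::int) = 1 then 0 else w s) - ub (if (2::int) = 1 then w s else 0)))"
  proof (rule u2_formula[where ?c1.0 = "\<lambda>i s. if i = 1 then w s else 0" and ?c2.0 = "\<lambda>i s. if i = 1 then 0 else w s"])
    show "wedge p r \<in> derived_algebra l" "wedge p r \<in> l" using p r derived_elements levi_elements by blast+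
    fix i :: int and s assume "i \<in> {1, 2}" "s \<in> mid_indices"
    then show "(if i = 1 then w s else 0) \<in> mid \<and> (if i = 1 then 0 else w s) \<in> mid \<and>
        lie (wedge p r) (wedge (v i) (v s)) = wedge (v 1) (if i = 1 then w s else 0) + wedge (v 2) (if i = 1 then 0 else w s)"
      using w[of s] mid_zero mid_bil[OF p] mid_bil[OF r] by (auto simp: lie_wedge_wedge w_def wedge_simps)
  qed
  also have "\<dots> = K * (\<Sum>s\<in>mid_indices. ub (v (- s)) * ua (w s) - ua (v (- s)) * ub (w s))"
    using ua_linear(2)[of 0 0] ub_linear(2)[of 0 0] by (simp add: algebra_simps)
  also have "(\<Sum>s\<in>mid_indices. ub (v (- s)) * ua (w s) - ua (v (- s)) * ub (w s))
     = (\<Sum>s\<in>mid_indices. uea_const (bil r (v s)) * (ub (v (- s)) * ua p) - uea_const (bil p (v s)) * (ub (v (- s)) * ua r)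
        - (uea_const (bil r (v s)) * (ua (v (- s)) * ub p) - uea_const (bil p (v s)) * (ua (v (- s)) * ub r)))"
    by (intro sum.cong refl) (simp only: lin right_diff_distrib const_left_commute)
  also have "\<dots> = ub r * ua p - ub p * ua r - (ua r * ub p - ua p * ub r)"
    by (simp only: sum_subtractf contract_ua_mult[OF p] contract_ua_mult[OF r] contract_ub_mult[OF p]
        contract_ub_mult[OF r])
  also have "\<dots> = 2 * (ua p * ub r - ua r * ub p)"
    using comm(3)[OF p r] comm(3)[OF r p] bil_commute[of p r] by (simp add: numeral_expand algebra_simps)
  finally show ?thesis .
qed

lemma u2_e12: "u2 (wedge (v 1) (v (- 2))) = K * (- uB)"
proof -
  have "u2 (wedge (v 1) (v (- 2))) = K * (\<Sum>s\<in>mid_indices. ua (v (- s)) * (ua 0 - ub (if (1::int) = 1 then 0 else v s))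
      + ub (v (- s)) * (ua 0 - ub (if (2::int) = 1 then 0 else v s)))"
  proof (rule u2_formula[where ?c1.0 = "\<lambda>i s. if i = 1 then 0 else v s" and ?c2.0 = "\<lambda>i s. 0"])
    fix i :: int and s assume "i \<in> {1, 2}" "s \<in> mid_indices"
    then show "(if i = 1 then 0 else v s) \<in> mid \<and> 0 \<in> mid \<and>
        lie (wedge (v 1) (v (- 2))) (wedge (v i) (v s)) = wedge (v 1) (if i = 1 then 0 else v s) + wedge (v 2) 0"
      using v_mid[of s] mid_zero mid_bil[OF v_mid[of s]] by (auto simp: lie_wedge_wedge bil_v_concrete wedge_simps)
  qed (rule derived_elements levi_elements)+
  also have "\<dots> = K * - (\<Sum>s\<in>mid_indices. ub (v (- s)) * ub (v (- (- s))))"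
    using ua_linear(2)[of 0 0] ub_linear(2)[of 0 0] by (simp add: sum_negf)
  also have "(\<Sum>s\<in>mid_indices. ub (v (- s)) * ub (v (- (- s)))) = uB"
    unfolding uB_def by (rule sum_mid_uminus)
  finally show ?thesis .
qed

lemma u2_e21: "u2 (wedge (v 2) (v (- 1))) = K * uA"
proof -
  have "u2 (wedge (v 2) (v (- 1))) = K * (\<Sum>s\<in>mid_indices. ua (v (- s)) * (ua (if (1::int) = 1 then v s else 0) - ub 0)
      + ub (v (- s)) * (ua (if (2::int) = 1 then v s else 0) - ub 0))"
  proof (rule u2_formula[where ?c1.0 = "\<lambda>i s. 0" and ?c2.0 = "\<lambda>i s. if i = 1 then v s else 0"])
    fix i :: int and s assume "i \<in> {1, 2}" "s \<in> mid_indices"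
    then show "0 \<in> mid \<and> (if i = 1 then v s else 0) \<in> mid \<and>
        lie (wedge (v 2) (v (- 1))) (wedge (v i) (v s)) = wedge (v 1) 0 + wedge (v 2) (if i = 1 then v s else 0)"
      using v_mid[of s] mid_zero mid_bil[OF v_mid[of s]] by (auto simp: lie_wedge_wedge bil_v_concrete wedge_simps)
  qed (rule derived_elements levi_elements)+
  also have "\<dots> = K * (\<Sum>s\<in>mid_indices. ua (v (- s)) * ua (v (- (- s))))"
    using ua_linear(2)[of 0 0] ub_linear(2)[of 0 0] by simp
  also have "(\<Sum>s\<in>mid_indices. ua (v (- s)) * ua (v (- (- s)))) = uA"
    unfolding uA_def by (rule sum_mid_uminus)
  finally show ?thesis .
qed

lemma u2_difference:
  "u2 (wedge (v 1) (v (- 1)) - wedge (v 2) (v (- 2))) = K * (- 2 * (uC + 2 * uz))"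
proof -
  let ?T = "wedge (v 1) (v (- 1)) - wedge (v 2) (v (- 2))"
  have lie_diff: "lie (x - y) z = lie x z - lie y z" for x y z :: so8
    using lie_add_left[of "x - y" y z] by simp
  have "u2 ?T = K * (\<Sum>s\<in>mid_indices. ua (v (- s)) * (ua (if (1::int) = 1 then 0 else - v s) - ub (if (1::int) = 1 then v s else 0))
      + ub (v (- s)) * (ua (if (2::int) = 1 then 0 else - v s) - ub (if (2::int) = 1 then v s else 0)))"
  proof (rule u2_formula[where ?c1.0 = "\<lambda>i s. if i = 1 then v s else 0" and ?c2.0 = "\<lambda>i s. if i = 1 then 0 else - v s"])
    show "?T \<in> derived_algebra l" by (rule derived_elements)
    show "?T \<in> l" by (intro l_diff levi_elements)
    fix i :: int and s assume "i \<in> {1, 2}" "s \<in> mid_indices"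
    then show "(if i = 1 then v s else 0) \<in> mid \<and> (if i = 1 then 0 else - v s) \<in> mid \<and>
        lie ?T (wedge (v i) (v s)) = wedge (v 1) (if i = 1 then v s else 0) + wedge (v 2) (if i = 1 then 0 else - v s)"
      using v_mid[of s] mid_zero mid_minus[OF v_mid[of s]] mid_bil[OF v_mid[of s]]
      by (auto simp: lie_diff lie_wedge_wedge bil_v_concrete wedge_simps)
  qed
  also have "\<dots> = K * - ((\<Sum>s\<in>mid_indices. ua (v (- s)) * ub (v s)) + (\<Sum>s\<in>mid_indices. ub (v (- s)) * ua (v (- (- s)))))"
    using ua_linear(2)[of 0 0] ub_linear(2)[of 0 0] ua_linear(4) by (simp add: sum_negf sum_subtractf)
  also have "(\<Sum>s\<in>mid_indices. ub (v (- s)) * ua (v (- (- s)))) = (\<Sum>s\<in>mid_indices. ub (v s) * ua (v (- s)))"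
    by (rule sum_mid_uminus)
  also have "- ((\<Sum>s\<in>mid_indices. ua (v (- s)) * ub (v s)) + (\<Sum>s\<in>mid_indices. ub (v s) * ua (v (- s)))) = - 2 * (uC + 2 * uz)"
    unfolding uC_swap by (simp add: numeral_expand algebra_simps)
  finally show ?thesis .
qed

lemma u2_minus: "x \<in> l \<Longrightarrow> u2 (- x) = - u2 x"
  using u2_scale[rule_format, of x "- 1"] by (simp add: cscale_simps uea_const_minus)

lemma u2_diff: "x \<in> l \<Longrightarrow> y \<in> l \<Longrightarrow> u2 (x - y) = u2 x - u2 y"
  using u2_add[rule_format, of x "- y"] u2_minus[of y] l_minus[of y] by simp

text \<open>The difference of the two arguments lies in the derived algebra, and their sum is \<open>H \<gamma>\<close>, where \<open>u2\<close> vanishes.\<close>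

lemma u2_diagonal:
  "u2 (wedge (v 1) (v (- 1))) = K * (- (uC + 2 * uz))" "u2 (wedge (v 2) (v (- 2))) = K * (uC + 2 * uz)"
proof -
  let ?x = "wedge (v 1) (v (- 1))" and ?y = "wedge (v 2) (v (- 2))"
  have sum: "u2 ?x + u2 ?y = 0"
    using u2_H u2_add levi_elements(1,4) unfolding H_\<gamma> torus_def by simp
  have diff: "u2 ?x - u2 ?y = K * (- 2 * (uC + 2 * uz))"
    using u2_difference u2_diff levi_elements(1,4) by simp
  have "2 * u2 ?x = (u2 ?x + u2 ?y) + (u2 ?x - u2 ?y)" "2 * u2 ?y = (u2 ?x + u2 ?y) - (u2 ?x - u2 ?y)"
    by (simp_all add: numeral_expand)
  then have "2 * u2 ?x = 2 * (K * (- (uC + 2 * uz)))" "2 * u2 ?y = 2 * (K * (uC + 2 * uz))"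
    unfolding sum diff by (simp_all add: numeral_expand algebra_simps)
  moreover have "u = w" if "2 * u = 2 * w" for u w :: "so8 uea"
  proof -
    have half: "uea_const (1 / 2) * (2 * x) = x" for x :: "so8 uea"
      using uea_const_cancel[of 2 x] by simp
    show ?thesis using that half by metis
  qed
  ultimately show "u2 ?x = K * (- (uC + 2 * uz))" "u2 ?y = K * (uC + 2 * uz)" by blast+
qed

definition omega :: "so8 \<Rightarrow> so8 uea" where
  "omega Y = (\<Sum>\<epsilon>\<in>DV. uea_of (X (- \<epsilon>)) * u2 (lie (X \<epsilon>) Y))"

lemma bracket_V_minus:
  assumes i: "i \<in> {1, 2}" and s: "s \<in> mid_indices" and d: "d \<in> mid"
  shows "lie (wedge (v 1) (v s)) (wedge (v (- 1)) d) = wedge d (v s) - bil (v s) d *\<^sub>C wedge (v 1) (v (- 1))"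
    "lie (wedge (v 2) (v s)) (wedge (v (- 1)) d) = - (bil (v s) d *\<^sub>C wedge (v 2) (v (- 1)))"
    "lie (wedge (v 1) (v s)) (wedge (v (- 2)) d) = - (bil (v s) d *\<^sub>C wedge (v 1) (v (- 2)))"
    "lie (wedge (v 2) (v s)) (wedge (v (- 2)) d) = wedge d (v s) - bil (v s) d *\<^sub>C wedge (v 2) (v (- 2))"
  using mid_bil[OF d] mid_bil[OF v_mid[OF s]] wedge_commute[of d "v s"] wedge_commute[of "v (- 1)" "v 1"]
    wedge_commute[of "v (- 1)" "v 2"] wedge_commute[of "v (- 2)" "v 1"] wedge_commute[of "v (- 2)" "v 2"]
  by (simp_all add: lie_wedge_wedge bil_v_concrete wedge_simps cscale_simps)

text \<open>The scalings of \<open>X \<epsilon>\<close> and \<open>X (- \<epsilon>)\<close> cancel up to the sign.\<close>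

lemma omega_sum:
  assumes Y: "Y = wedge (v (- 1)) c + wedge (v (- 2)) d" and c: "c \<in> mid" and d: "d \<in> mid"
  shows "omega Y = - (\<Sum>s\<in>mid_indices. ua (v (- s)) * u2 (lie (wedge (v 1) (v s)) Y) + ub (v (- s)) * u2 (lie (wedge (v 2) (v s)) Y))"
proof -
  have l_lie: "lie (wedge (v i) (v s)) Y \<in> l" if "i \<in> {1, 2}" "s \<in> mid_indices" for i s
  proof -
    have "lie (wedge (v 1) (v s)) Y \<in> l" "lie (wedge (v 2) (v s)) Y \<in> l"
      unfolding Y lie_add_right bracket_V_minus[OF that c] bracket_V_minus[OF that d]
      by (intro l_add l_diff l_minus l_scale levi_elements c d v_mid that)+
    then show ?thesis using that(1) by auto
  qed
  have "uea_of (X (- (eps i + eps s))) * u2 (lie (X (eps i + eps s)) Y)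
      = - (row i (v (- s)) * u2 (lie (wedge (v i) (v s)) Y))" if "i \<in> {1, 2}" "s \<in> mid_indices" for i s
  proof -
    have "uea_of (X (- (eps i + eps s))) * u2 (lie (X (eps i + eps s)) Y)
      = uea_const (- 1 / k i s) * (uea_const (k i s) * (row i (v (- s)) * u2 (lie (wedge (v i) (v s)) Y)))"
      unfolding X_DV(2,3)[OF that] lie_cscale_left u2_scale[rule_format, OF l_lie[OF that]]
        uea_of_cscale row_def[symmetric] mult.assoc const_left_commute[of "row i (v (- s))"] ..
    also have "\<dots> = uea_const (- 1 / k i s * k i s) * (row i (v (- s)) * u2 (lie (wedge (v i) (v s)) Y))"
      by (simp only: uea_const_mult mult.assoc)
    also have "- 1 / k i s * k i s = - 1" using X_DV(1)[OF that] by simp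
    also have "uea_const (- 1) * (row i (v (- s)) * u2 (lie (wedge (v i) (v s)) Y))
        = - (row i (v (- s)) * u2 (lie (wedge (v i) (v s)) Y))" by (simp add: uea_const_minus)
    finally show ?thesis .
  qed
  then have "omega Y = (\<Sum>i\<in>{1, 2}. \<Sum>s\<in>mid_indices. - (row i (v (- s)) * u2 (lie (wedge (v i) (v s)) Y)))"
    unfolding omega_def sum_DV by (intro sum.cong refl)
  then show ?thesis by (simp add: row_simps sum_negf sum.distrib)
qed

lemma K_left: "u * (K * w) = K * (u * w)" and uea_const_K_left: "uea_const c * (K * w) = K * (uea_const c * w)"
  unfolding K_def by (rule const_left_commute)+

lemma omega_first:
  assumes d: "d \<in> mid"
  shows "omega (wedge (v (- 1)) d) = K * (3 * uw d)"
proof -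
  have Y: "wedge (v (- 1)) d = wedge (v (- 1)) d + wedge (v (- 2)) 0" by (simp add: wedge_simps)
  have "omega (wedge (v (- 1)) d) = - (\<Sum>s\<in>mid_indices.
      ua (v (- s)) * (K * (2 * (ua d * ub (v s) - ua (v s) * ub d)) - uea_const (bil d (v s)) * (K * - (uC + 2 * uz)))
      + ub (v (- s)) * (- (uea_const (bil d (v s)) * (K * uA))))"
    unfolding omega_sum[OF Y d mid_zero]
  proof (intro arg_cong[of _ _ uminus] sum.cong refl)
    fix s assume s: "s \<in> mid_indices"
    have i: "1 \<in> {1, 2 :: int}" by simp
    have "u2 (lie (wedge (v 1) (v s)) (wedge (v (- 1)) d)) = K * (2 * (ua d * ub (v s) - ua (v s) * ub d)) - uea_const (bil d (v s)) * (K * - (uC + 2 * uz))"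
      using u2_diff[OF levi_elements(5)[OF d v_mid[OF s]] l_scale[OF levi_elements(1)]] u2_scale levi_elements(1)
      by (simp add: bracket_V_minus[OF i s d] u2_mid[OF d v_mid[OF s]] u2_diagonal bil_commute)
    moreover have "u2 (lie (wedge (v 2) (v s)) (wedge (v (- 1)) d)) = - (uea_const (bil d (v s)) * (K * uA))"
      using u2_minus[OF l_scale[OF levi_elements(3)]] u2_scale levi_elements(3)
      by (simp add: bracket_V_minus[OF i s d] u2_e21 bil_commute)
    ultimately show "ua (v (- s)) * u2 (lie (wedge (v 1) (v s)) (wedge (v (- 1)) d)) + ub (v (- s)) * u2 (lie (wedge (v 2) (v s)) (wedge (v (- 1)) d))
      = ua (v (- s)) * (K * (2 * (ua d * ub (v s) - ua (v s) * ub d)) - uea_const (bil d (v s)) * (K * - (uC + 2 * uz)))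
      + ub (v (- s)) * (- (uea_const (bil d (v s)) * (K * uA)))" by simp
  qed
  also have "\<dots> = - (\<Sum>s\<in>mid_indices. K * (2 * (ua d * (ua (v (- s)) * ub (v s))) - 2 * (ua (v s) * ua (v (- s)) * ub d)
      + uea_const (bil d (v s)) * (ua (v (- s)) * (uC + 2 * uz)) - uea_const (bil d (v s)) * (ub (v (- s)) * uA)))"
  proof (intro arg_cong[of _ _ uminus] sum.cong refl)
    fix s assume s: "s \<in> mid_indices"
    have c: "ua (v (- s)) * (ua d * x) = ua d * (ua (v (- s)) * x)" "ua (v (- s)) * (ua (v s) * x) = ua (v s) * (ua (v (- s)) * x)" for x
      using comm_assoc(1)[OF v_uminus_mid[OF s] d] comm_assoc(1)[OF v_uminus_mid[OF s] v_mid[OF s]] by blast+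
    show "ua (v (- s)) * (K * (2 * (ua d * ub (v s) - ua (v s) * ub d)) - uea_const (bil d (v s)) * (K * - (uC + 2 * uz)))
      + ub (v (- s)) * (- (uea_const (bil d (v s)) * (K * uA)))
      = K * (2 * (ua d * (ua (v (- s)) * ub (v s))) - 2 * (ua (v s) * ua (v (- s)) * ub d)
      + uea_const (bil d (v s)) * (ua (v (- s)) * (uC + 2 * uz)) - uea_const (bil d (v s)) * (ub (v (- s)) * uA))"
      by (simp add: K_left[of "ua c" for c] K_left[of "ub c" for c] uea_const_K_left const_left_commutes right_diff_distrib
          distrib_left c mult.assoc numeral_expand)
  qed
  also have "\<dots> = K * - (2 * (ua d * (\<Sum>s\<in>mid_indices. ua (v (- s)) * ub (v s))) - 2 * (uA * ub d)
      + ua d * (uC + 2 * uz) - ub d * uA)"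
    by (simp only: sum_distrib_left[symmetric] sum.distrib sum_subtractf contract_ua_mult[OF d]
        contract_ub_mult[OF d] uA_def sum_distrib_right[symmetric] mult_minus_right)
  also have "- (2 * (ua d * (\<Sum>s\<in>mid_indices. ua (v (- s)) * ub (v s))) - 2 * (uA * ub d)
      + ua d * (uC + 2 * uz) - ub d * uA) = 3 * uw d"
    unfolding uC_swap ub_uA[OF d] uw_def by (simp add: numeral_expand algebra_simps comm_single d)
  finally show ?thesis .
qed

lemma omega_second:
  assumes d: "d \<in> mid"
  shows "omega (wedge (v (- 2)) d) = K * (3 * uw' d)"
proof -
  have Y: "wedge (v (- 2)) d = wedge (v (- 1)) 0 + wedge (v (- 2)) d" by (simp add: wedge_simps)
  have "omega (wedge (v (- 2)) d) = - (\<Sum>s\<in>mid_indices.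
      ua (v (- s)) * (- (uea_const (bil d (v s)) * (K * - uB)))
      + ub (v (- s)) * (K * (2 * (ua d * ub (v s) - ua (v s) * ub d)) - uea_const (bil d (v s)) * (K * (uC + 2 * uz))))"
    unfolding omega_sum[OF Y mid_zero d]
  proof (intro arg_cong[of _ _ uminus] sum.cong refl)
    fix s assume s: "s \<in> mid_indices"
    have i: "1 \<in> {1, 2 :: int}" by simp
    have "u2 (lie (wedge (v 2) (v s)) (wedge (v (- 2)) d)) = K * (2 * (ua d * ub (v s) - ua (v s) * ub d)) - uea_const (bil d (v s)) * (K * (uC + 2 * uz))"
      using u2_diff[OF levi_elements(5)[OF d v_mid[OF s]] l_scale[OF levi_elements(4)]] u2_scale levi_elements(4)
      by (simp add: bracket_V_minus[OF i s d] u2_mid[OF d v_mid[OF s]] u2_diagonal bil_commute)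
    moreover have "u2 (lie (wedge (v 1) (v s)) (wedge (v (- 2)) d)) = - (uea_const (bil d (v s)) * (K * - uB))"
      using u2_minus[OF l_scale[OF levi_elements(2)]] u2_scale levi_elements(2)
      by (simp add: bracket_V_minus[OF i s d] u2_e12 bil_commute)
    ultimately show "ua (v (- s)) * u2 (lie (wedge (v 1) (v s)) (wedge (v (- 2)) d)) + ub (v (- s)) * u2 (lie (wedge (v 2) (v s)) (wedge (v (- 2)) d))
      = ua (v (- s)) * (- (uea_const (bil d (v s)) * (K * - uB)))
      + ub (v (- s)) * (K * (2 * (ua d * ub (v s) - ua (v s) * ub d)) - uea_const (bil d (v s)) * (K * (uC + 2 * uz)))" by simp
  qed
  also have "\<dots> = - (\<Sum>s\<in>mid_indices. K * (uea_const (bil d (v s)) * (ua (v (- s)) * uB)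
      + 2 * (ua d * (ub (v (- s)) * ub (v (- (- s))))) + 2 * (uea_const (bil d (v (- s))) * (uz * ub (v s)))
      - 2 * (ub (v (- s)) * ua (v (- (- s))) * ub d) - uea_const (bil d (v s)) * (ub (v (- s)) * (uC + 2 * uz))))"
  proof (intro arg_cong[of _ _ uminus] sum.cong refl)
    fix s assume s: "s \<in> mid_indices"
    have c: "ub (v (- s)) * (ua d * x) = ua d * (ub (v (- s)) * x) + uea_const (bil d (v (- s))) * (uz * x)" for x
      using comm_assoc(3)[OF d v_uminus_mid[OF s]] by (simp add: distrib_right mult.assoc)
    show "ua (v (- s)) * (- (uea_const (bil d (v s)) * (K * - uB)))
      + ub (v (- s)) * (K * (2 * (ua d * ub (v s) - ua (v s) * ub d)) - uea_const (bil d (v s)) * (K * (uC + 2 * uz)))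
      = K * (uea_const (bil d (v s)) * (ua (v (- s)) * uB)
      + 2 * (ua d * (ub (v (- s)) * ub (v (- (- s))))) + 2 * (uea_const (bil d (v (- s))) * (uz * ub (v s)))
      - 2 * (ub (v (- s)) * ua (v (- (- s))) * ub d) - uea_const (bil d (v s)) * (ub (v (- s)) * (uC + 2 * uz)))"
      by (simp add: K_left[of "ua c" for c] K_left[of "ub c" for c] uea_const_K_left const_left_commutes right_diff_distrib
          distrib_left c mult.assoc numeral_expand algebra_simps)
  qed
  also have "\<dots> = K * - (ua d * uB
      + 2 * (ua d * (\<Sum>s\<in>mid_indices. ub (v (- s)) * ub (v (- (- s))))) + 2 * (uz * ub d)
      - 2 * ((\<Sum>s\<in>mid_indices. ub (v (- s)) * ua (v (- (- s)))) * ub d) - ub d * (uC + 2 * uz))"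
    by (simp only: sum_distrib_left[symmetric] sum.distrib sum_subtractf contract_ua_mult[OF d]
        contract_ub_mult[OF d] sum_distrib_right[symmetric] mult_minus_right)
  also have "(\<Sum>s\<in>mid_indices. ub (v (- s)) * ub (v (- (- s)))) = uB"
    unfolding uB_def by (rule sum_mid_uminus)
  also have "(\<Sum>s\<in>mid_indices. ub (v (- s)) * ua (v (- (- s)))) = (\<Sum>s\<in>mid_indices. ub (v s) * ua (v (- s)))"
    by (rule sum_mid_uminus)
  also have "- (ua d * uB + 2 * (ua d * uB) + 2 * (uz * ub d)
      - 2 * ((\<Sum>s\<in>mid_indices. ub (v s) * ua (v (- s))) * ub d) - ub d * (uC + 2 * uz)) = 3 * uw' d"
    unfolding uC_swap uw'_def distrib_left[of "ub d"] ub_uC[OF d]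
    by (simp add: numeral_expand algebra_simps comm_single d)
  finally show ?thesis .
qed

lemma omega_eq:
  assumes c: "c \<in> mid" and d: "d \<in> mid"
  shows "omega (wedge (v (- 1)) c + wedge (v (- 2)) d) = K * (3 * (uw c + uw' d))"
proof -
  have Y1: "wedge (v (- 1)) c = wedge (v (- 1)) c + wedge (v (- 2)) 0"
    and Y2: "wedge (v (- 2)) d = wedge (v (- 1)) 0 + wedge (v (- 2)) d" by (simp_all add: wedge_simps)
  have "u2 (lie (wedge (v i) (v s)) (wedge (v (- 1)) c + wedge (v (- 2)) d))
      = u2 (lie (wedge (v i) (v s)) (wedge (v (- 1)) c)) + u2 (lie (wedge (v i) (v s)) (wedge (v (- 2)) d))"
    if "i \<in> {1, 2}" "s \<in> mid_indices" for i s
  proof -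
    have "lie (wedge (v i) (v s)) (wedge (v (- 1)) c) \<in> l" "lie (wedge (v i) (v s)) (wedge (v (- 2)) d) \<in> l"
    proof -
      have "lie (wedge (v 1) (v s)) (wedge (v (- 1)) c) \<in> l" "lie (wedge (v 2) (v s)) (wedge (v (- 1)) c) \<in> l"
        "lie (wedge (v 1) (v s)) (wedge (v (- 2)) d) \<in> l" "lie (wedge (v 2) (v s)) (wedge (v (- 2)) d) \<in> l"
        unfolding bracket_V_minus[OF that c] bracket_V_minus[OF that d]
        by (intro l_add l_diff l_minus l_scale levi_elements c d v_mid that)+
      then show "lie (wedge (v i) (v s)) (wedge (v (- 1)) c) \<in> l" "lie (wedge (v i) (v s)) (wedge (v (- 2)) d) \<in> l"
        using that(1) by auto
    qed
    then show ?thesis unfolding lie_add_right using u2_add by blast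
  qed
  then have "omega (wedge (v (- 1)) c + wedge (v (- 2)) d) = omega (wedge (v (- 1)) c) + omega (wedge (v (- 2)) d)"
    unfolding omega_sum[OF refl c d] omega_sum[OF Y1 c mid_zero] omega_sum[OF Y2 mid_zero d]
    by (simp add: distrib_left sum.distrib)
  then show ?thesis by (simp add: omega_first[OF c] omega_second[OF d] distrib_left)
qed

end

section \<open>The generalized Verma module\<close>

text \<open>Only the term survives in which every derivation falls on a denominator.\<close>

lemma val_cubic:
  assumes p: "l p \<noteq> 0"
    and "l (lie y (lie z p)) = 0" "l (lie x (lie z p)) = 0" "l (lie x (lie y p)) = 0"
      "l (lie x (lie y (lie z p))) = 0"
  shows "val p l (der p x (der p y (der p z Recip))) = - 6 * (l (lie x p) * l (lie y p) * l (lie z p)) / l p ^ 4"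
  using assms by (simp add: field_simps power4_eq_xxxx)

locale verma_setting = omega_setting +
  fixes d\<chi> :: "so8 \<Rightarrow> complex"
  assumes d\<chi>_add: "\<forall>x\<in>q. \<forall>y\<in>q. d\<chi> (x + y) = d\<chi> x + d\<chi> y"
    and d\<chi>_scale: "\<forall>c. \<forall>x\<in>q. d\<chi> (c *\<^sub>C x) = c * d\<chi> x"
    and d\<chi>_levi: "\<forall>Z\<in>l. lie Z (X \<gamma>) = d\<chi> Z *\<^sub>C X \<gamma>"
    and d\<chi>_nil: "\<forall>x\<in>n. d\<chi> x = 0"
begin

lemma lie_q_X\<gamma>:
  assumes x: "x \<in> q"
  shows "lie x (X \<gamma>) = d\<chi> x *\<^sub>C X \<gamma>"
proof -
  obtain y z where yz: "x = y + z" "y \<in> l" "z \<in> n" using q_cases[OF x] by blast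
  have "lie z (wedge (v 1) (v 2)) = 0"
    using yz(3)
  proof (induction rule: n_induct)
    case zero
    show ?case using lie_cscale_left[of 0 0] by (simp add: cscale_simps)
  qed (simp_all add: lie_add_left lie_cscale_left cscale_simps lie_wedge_wedge bil_v_concrete mid_bil wedge_simps)
  then have "lie z (X \<gamma>) = 0" unfolding X_\<gamma>(2) lie_cscale_right by (simp add: cscale_simps)
  moreover have "d\<chi> x = d\<chi> y"
    using d\<chi>_add d\<chi>_nil l_subset_q[OF yz(2)] n_subset_q[OF yz(3)] yz by simp
  ultimately show ?thesis using d\<chi>_levi yz(2) unfolding yz(1) lie_add_left by simp
qed

lemma d\<chi>_eqI:
  assumes "x \<in> q" "lie x (wedge (v 1) (v 2)) = c *\<^sub>C wedge (v 1) (v 2)"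
  shows "d\<chi> x = c"
proof -
  have "(g * c) *\<^sub>C wedge (v 1) (v 2) = (d\<chi> x * g) *\<^sub>C wedge (v 1) (v 2)"
    using lie_q_X\<gamma>[OF assms(1)] unfolding X_\<gamma>(2) lie_cscale_right assms(2) cscale_cscale .
  then show ?thesis using wedge_nonzero[OF root_pair_12] X_\<gamma>(1) by (simp add: cvs.scale_cancel_right)
qed

lemma d\<chi>_values:
  "d\<chi> (wedge (v 1) (v (- 1))) = 1" "d\<chi> (wedge (v 2) (v (- 2))) = 1"
  "d\<chi> (wedge (v 1) (v (- 2))) = 0" "d\<chi> (wedge (v 2) (v (- 1))) = 0"
  "c \<in> mid \<Longrightarrow> d \<in> mid \<Longrightarrow> d\<chi> (wedge c d) = 0"
  using levi_elements
  by (auto intro!: d\<chi>_eqI l_subset_q simp: lie_wedge_wedge bil_v_concrete mid_bil wedge_simps cscale_simps)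

text \<open>A point of the dual space at which the function obtained from \<open>1 / X\<^sub>\<gamma>\<close> by applying \<open>uw (v 3)\<close>
  does not vanish. It is supported in the grades one and two, so that only the principal symbol of
  an element of the enveloping algebra of the opposite nilradical contributes.\<close>

definition point :: "so8 \<Rightarrow> complex" where
  "point A = entry A 1 2 + entry A 2 3 + entry A 1 (- 3)"

lemma point_regular: "point \<in> regular_points (X \<gamma>)" and point_X\<gamma>: "point (X \<gamma>) = g"
proof -
  show "point (X \<gamma>) = g"
    unfolding X_\<gamma>(2) point_def by (simp add: entry_simps entry_wedge signed_indices_def)
  then show "point \<in> regular_points (X \<gamma>)"
    using X_\<gamma>(1) by (simp add: regular_points_def) (simp add: point_def entry_simps algebra_simps)
qed

lemma point_cscale: "point (c *\<^sub>C A) = c * point A"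
  and point_minus: "point (- A) = - point A"
  by (simp_all add: point_def entry_simps algebra_simps)

lemma grade_lie:
  assumes "lie (H \<gamma>) x = a *\<^sub>C x" "lie (H \<gamma>) y = b *\<^sub>C y"
  shows "lie (H \<gamma>) (lie x y) = (a + b) *\<^sub>C lie x y"
  using lie_lie[of "H \<gamma>" x y] assms by (simp add: lie_cscale_left lie_cscale_right cscale_simps)

lemma point_low_grade:
  assumes "lie (H \<gamma>) x = a *\<^sub>C x" "a \<noteq> 1" "a \<noteq> 2"
  shows "point x = 0"
proof -
  have "entry x s t = 0" if st: "s \<in> signed_indices" "t \<in> signed_indices" "grade s + grade t = m" "m = 1 \<or> m = 2" for s t m
  proof -
    have "(eps s (H \<gamma>) + eps t (H \<gamma>)) * entry x s t = a * entry x s t"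
      using entry_lie_h[OF H_\<gamma>_h st(1,2), of x] by (auto simp: assms(1) entry_simps)
    moreover have "eps s (H \<gamma>) + eps t (H \<gamma>) = of_int m" by (simp add: eps_grade st(1,2) flip: st(3))
    ultimately show ?thesis using st(4) assms(2,3) by auto
  qed
  from this[of 1 2 2] this[of 2 3 1] this[of 1 "- 3" 1] show ?thesis
    by (simp add: point_def grade_def signed_indices_def)
qed

lemma pairing_cubic:
  assumes x: "lie (H \<gamma>) x = (- 1) *\<^sub>C x" and y: "lie (H \<gamma>) y = (- 1) *\<^sub>C y" and z: "lie (H \<gamma>) z = (- 1) *\<^sub>C z"
  shows "pairing (X \<gamma>) point Recip (uea_of x * uea_of y * uea_of z)
    = - 6 * (point (lie x (X \<gamma>)) * point (lie y (X \<gamma>)) * point (lie z (X \<gamma>))) / g ^ 4"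
proof -
  have "lie (H \<gamma>) (X \<gamma>) = 2 *\<^sub>C X \<gamma>"
    using lie_h_wedge[OF H_\<gamma>_h, of 1 2] unfolding X_\<gamma>(2)
    by (simp add: lie_cscale_right eps_grade grade_def signed_indices_def cscale_simps mult.commute)
  note one = grade_lie[OF x this] grade_lie[OF y this] grade_lie[OF z this]
  note zero = grade_lie[OF y one(3)] grade_lie[OF x one(3)] grade_lie[OF x one(2)]
  note neg = grade_lie[OF x zero(1)]
  have "pairing (X \<gamma>) point Recip (uea_of x * uea_of y * uea_of z)
      = val (X \<gamma>) point (der (X \<gamma>) x (der (X \<gamma>) y (der (X \<gamma>) z Recip)))"
    by (simp only: pairing_mult_of[OF point_regular] pairing_of[OF point_regular])
  also have "\<dots> = - 6 * (point (lie x (X \<gamma>)) * point (lie y (X \<gamma>)) * point (lie z (X \<gamma>))) / point (X \<gamma>) ^ 4"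
    by (rule val_cubic; (rule point_low_grade[OF zero(1)] point_low_grade[OF zero(2)]
        point_low_grade[OF zero(3)] point_low_grade[OF neg])?; simp add: point_X\<gamma> X_\<gamma>(1))
  finally show ?thesis by (simp only: point_X\<gamma>)
qed

lemma V_minus_rows:
  assumes d: "d \<in> mid"
  shows "lie (H \<gamma>) (wedge (v (- 1)) d) = (- 1) *\<^sub>C wedge (v (- 1)) d"
    "lie (H \<gamma>) (wedge (v (- 2)) d) = (- 1) *\<^sub>C wedge (v (- 2)) d"
proof -
  have "wedge (v (- 1)) d + wedge (v (- 2)) 0 \<in> ad_eigenspace (H \<gamma>) (- 1)"
    "wedge (v (- 1)) 0 + wedge (v (- 2)) d \<in> ad_eigenspace (H \<gamma>) (- 1)"
    unfolding V_minus_eq using d mid_zero by blast+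
  then show "lie (H \<gamma>) (wedge (v (- 1)) d) = (- 1) *\<^sub>C wedge (v (- 1)) d"
    "lie (H \<gamma>) (wedge (v (- 2)) d) = (- 1) *\<^sub>C wedge (v (- 2)) d"
    unfolding ad_eigenspace_def wedge_zero_right add_0_left add_0_right by blast+
qed

lemma point_rows:
  assumes d: "d \<in> mid"
  shows "point (lie (wedge (v (- 1)) d) (X \<gamma>)) = g * bil d (v (- 3))"
    "point (lie (wedge (v (- 2)) d) (X \<gamma>)) = - g * bil d (v 3)"
proof -
  have "lie (wedge (v (- 1)) d) (wedge (v 1) (v 2)) = wedge (v 2) d"
    "lie (wedge (v (- 2)) d) (wedge (v 1) (v 2)) = - wedge (v 1) d"
    using wedge_commute[of d "v 2"] by (simp_all add: lie_wedge_wedge bil_v_concrete mid_bil[OF d] wedge_simps)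
  moreover have "point (wedge (v 2) d) = bil d (v (- 3))" "point (wedge (v 1) d) = bil d (v 3)"
    using mid_bil[OF d] by (simp_all add: point_def entry_def app_wedge bil_simps bil_v_concrete bil_v signed_indices_def)
  ultimately show "point (lie (wedge (v (- 1)) d) (X \<gamma>)) = g * bil d (v (- 3))"
    "point (lie (wedge (v (- 2)) d) (X \<gamma>)) = - g * bil d (v 3)"
    unfolding X_\<gamma>(2) lie_cscale_right by (simp_all add: point_cscale point_minus)
qed

lemma pairing_uw: "pairing (X \<gamma>) point Recip (uw (v 3)) \<noteq> 0"
proof -
  let ?P = "pairing (X \<gamma>) point Recip"
  have three: "3 \<in> mid_indices" by (simp add: mid_indices_def)
  have sum: "?P (\<Sum>s\<in>I. f s) = (\<Sum>s\<in>I. ?P (f s))" for f :: "int \<Rightarrow> so8 uea" and I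
  proof (induction I rule: infinite_finite_induct)
    case (insert s I)
    then show ?case by (simp add: pairing_add[OF point_regular])
  qed (use pairing_const[OF point_regular, of Recip 0] in simp_all)
  have aab: "?P (ua c * ua d * ub e) = - 6 * ((g * bil c (v (- 3))) * (g * bil d (v (- 3))) * (- g * bil e (v 3))) / g ^ 4"
    if "c \<in> mid" "d \<in> mid" "e \<in> mid" for c d e
    unfolding ua_def ub_def
    using pairing_cubic[OF V_minus_rows(1)[OF that(1)] V_minus_rows(1)[OF that(2)] V_minus_rows(2)[OF that(3)]]
    by (simp_all only: point_rows that)
  have b3: "bil (v s) (v (- 3)) = (if s = 3 then 1 else 0)" "bil (v s) (v 3) = (if s = - 3 then 1 else 0)"
    if "s \<in> mid_indices" for s
    using bil_v[OF mid_signed[OF that], of "- 3"] bil_v[OF mid_signed[OF that], of 3]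
    by (auto simp: signed_indices_def)
  have "?P (uA * ub (v 3)) = (\<Sum>s\<in>mid_indices. ?P (ua (v s) * ua (v (- s)) * ub (v 3)))"
    unfolding uA_def sum_distrib_right sum ..
  also have "\<dots> = 0"
    by (rule sum.neutral) (simp add: aab v_mid v_uminus_mid three b3 mid_uminus)
  finally have 1: "?P (uA * ub (v 3)) = 0" .
  have "?P (ua (v 3) * uC) = (\<Sum>s\<in>mid_indices. ?P (ua (v 3) * ua (v s) * ub (v (- s))))"
    unfolding uC_def sum_distrib_left sum mult.assoc ..
  also have "\<dots> = (\<Sum>s\<in>mid_indices. if s = 3 then 6 / g else 0)"
    using X_\<gamma>(1) by (intro sum.cong refl) (simp add: aab[unfolded mult.assoc] v_mid v_uminus_mid three b3 mid_uminus field_simps power4_eq_xxxx)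
  also have "\<dots> = 6 / g" using three finite_mid by simp
  finally show ?thesis
    using 1 X_\<gamma>(1) by (simp add: uw_def pairing_diff[OF point_regular])
qed

definition C where "C = one_dim_module q (\<lambda>x. - d\<chi> x)"
definition M where "M = ext_scalars (uea_sub q) C"
text \<open>Every element of the carrier that occurs below has this form, since the module induced from is a line.\<close>

definition t where "t u = tensor_elt (uea_sub q) C u 1"

sublocale scal: scalar_extension "uea_sub q" C
  by standard (simp_all add: C_def one_dim_module_def)

lemma carrier_C: "z \<in> carrier C"
  by (simp add: C_def one_dim_module_def)

lemma t_M: "t u \<in> carrier M"
  unfolding t_def M_def by (rule scal.tensor_elt_T[OF carrier_C])

lemma comm_group_M: "comm_group M"
  unfolding M_def by (rule scal.comm_group_T)

lemma t_add: "t (u + w) = t u \<otimes>\<^bsub>M\<^esub> t w"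
  unfolding t_def M_def by (rule scal.tensor_add_left[OF carrier_C])

lemma t_zero: "t 0 = \<one>\<^bsub>M\<^esub>"
  unfolding t_def M_def by (rule scal.tensor_zero_left[OF carrier_C])

lemma t_lact: "lact M r (t u) = t (r * u)"
  unfolding t_def M_def by (rule scal.lact_tensor[OF carrier_C])

lemmas character = character_ext_spec[OF point_regular lie_q_X\<gamma>]

lemma t_q: "x \<in> q \<Longrightarrow> t (u * uea_of x) = t (u * uea_const (- d\<chi> x))"
proof -
  assume x: "x \<in> q"
  have "t (u * uea_of x) = tensor_elt (uea_sub q) C u (lact C (uea_of x) 1)"
    unfolding t_def by (rule scal.tensor_balanced[OF sub_gen[OF x] carrier_C])
  also have "lact C (uea_of x) 1 = lact C (uea_const (- d\<chi> x)) 1"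
    using x by (simp add: C_def one_dim_module_def character)
  also have "tensor_elt (uea_sub q) C u (lact C (uea_const (- d\<chi> x)) 1) = t (u * uea_const (- d\<chi> x))"
    unfolding t_def by (rule scal.tensor_balanced[OF sub_const carrier_C, symmetric])
  finally show ?thesis .
qed

text \<open>Equalities in the generalized Verma module become congruences modulo a left ideal of the enveloping
  algebra, to which the computations with singular vectors apply.\<close>

definition J where "J = {u. t u = \<one>\<^bsub>M\<^esub>}"

lemma t_eq_iff: "t u = t w \<longleftrightarrow> u - w \<in> J"
proof -
  interpret M: comm_group M by (rule comm_group_M)
  have "t u = t (u - w) \<otimes>\<^bsub>M\<^esub> t w" by (simp flip: t_add)
  then show ?thesis unfolding J_def
    using M.right_cancel[OF t_M[of w] t_M[of "u - w"] M.one_closed] t_M[of w] by simp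
qed

lemma J_q: "x \<in> q \<Longrightarrow> d\<chi> x = c \<Longrightarrow> uea_of x + uea_const c \<in> J"
  using t_q[of x 1] t_eq_iff[of "uea_of x" "uea_const (- c)"] by (simp add: uea_const_minus)

sublocale verma_ideal v J
proof
  interpret M: comm_group M by (rule comm_group_M)
  show "u + w \<in> J" if "u \<in> J" "w \<in> J" for u w
    using that by (simp add: J_def t_add)
  show "u * w \<in> J" if "w \<in> J" for u w
  proof -
    have "t (u * w) = lact M u (t w)" by (simp add: t_lact)
    also have "\<dots> = lact M u (t 0)" using that by (simp add: J_def t_zero)
    also have "\<dots> = \<one>\<^bsub>M\<^esub>" by (subst t_lact) (simp add: t_zero)
    finally show ?thesis by (simp add: J_def)
  qed
  note lq = levi_elements[THEN l_subset_q]
  show "ur c d \<in> J" if "c \<in> mid" "d \<in> mid" for c d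
    using J_q[OF lq(5)[OF that] d\<chi>_values(5)[OF that]] by (simp add: ur_def)
  show "ue 1 2 \<in> J" "ue 2 1 \<in> J" "ue 1 1 + 1 \<in> J" "ue 2 2 + 1 \<in> J"
    using J_q[OF lq(2) d\<chi>_values(3)] J_q[OF lq(3) d\<chi>_values(4)] J_q[OF lq(1) d\<chi>_values(1)]
      J_q[OF lq(4) d\<chi>_values(2)] by (simp_all add: ue_def)
  have nil: "uea_of x \<in> J" if "x \<in> n" for x
    using J_q[OF n_subset_q[OF that], of 0] d\<chi>_nil that by simp
  show "ux c \<in> J" "uy c \<in> J" if "c \<in> mid" for c
    unfolding ux_def uy_def using nil nil_elements[OF that] by blast+
qed

notation eqv (infix "\<doteq>" 50)

text \<open>The functional \<open>pairing (X \<gamma>) point Recip\<close> factors through the generalized Verma module, because \<open>1 / X\<^sub>\<gamma>\<close>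
  transforms under \<open>q\<close> by the character that defines the module.\<close>

lemma uw_not_J: "uw (v 3) \<notin> J"
proof
  assume "uw (v 3) \<in> J"
  let ?H = "\<lparr>carrier = UNIV, mult = (+), one = 0\<rparr> :: complex monoid"
  have H: "comm_group ?H"
  proof (rule comm_groupI)
    show "\<exists>y\<in>carrier ?H. y \<otimes>\<^bsub>?H\<^esub> x = \<one>\<^bsub>?H\<^esub>" for x by (rule bexI[of _ "- x"]) simp_all
  qed (simp_all add: add_ac)
  obtain \<phi> where \<phi>: "\<phi> \<in> hom M ?H"
    "\<And>u z. z \<in> carrier C \<Longrightarrow> \<phi> (tensor_elt (uea_sub q) C u z) = pairing (X \<gamma>) point Recip u * z"
    unfolding M_def
  proof (rule scal.universal[OF H, of "\<lambda>u z. pairing (X \<gamma>) point Recip u * z"])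
    fix u s :: "so8 uea" and z assume "s \<in> uea_sub q"
    then show "pairing (X \<gamma>) point Recip (u * s) * z = pairing (X \<gamma>) point Recip u * lact C s z"
      using pairing_mult_sub[OF point_regular lie_q_X\<gamma>, of q s u] by (simp add: C_def one_dim_module_def)
  qed (simp_all add: C_def one_dim_module_def pairing_add[OF point_regular] algebra_simps)
  have "\<phi> (t u) = pairing (X \<gamma>) point Recip u" for u
    using \<phi>(2)[OF carrier_C, of u 1] by (simp add: t_def)
  moreover have "t (uw (v 3)) = t 0" using \<open>uw (v 3) \<in> J\<close> by (simp add: J_def t_zero)
  moreover have "pairing (X \<gamma>) point Recip 0 = 0"
    using pairing_const[OF point_regular, of Recip 0] by simp
  ultimately show False using pairing_uw by metis
qed

definition E where "E = {t (uw c + uw' d) | c d. c \<in> mid \<and> d \<in> mid}"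

lemma lact_const_t: "lact M (uea_const a) (t (uw c + uw' d)) = t (uw (a *s c) + uw' (a *s d))"
  by (simp add: t_lact uw_linear uw'_linear distrib_left)

lemma omega_E: "{t (omega Y) | Y. Y \<in> ad_eigenspace (H \<gamma>) (- 1)} = E"
proof -
  let ?k = "3 / (2 * g)"
  have k: "?k \<noteq> 0" using X_\<gamma>(1) by simp
  have "K * (3 * u) = uea_const ?k * u" for u :: "so8 uea"
    by (simp add: K_def mult.assoc[symmetric] flip: uea_const_numeral uea_const_mult)
  then have om: "omega (wedge (v (- 1)) c + wedge (v (- 2)) d) = uw (?k *s c) + uw' (?k *s d)"
    if "c \<in> mid" "d \<in> mid" for c d
    using omega_eq[OF that] by (simp add: uw_linear uw'_linear distrib_left)
  show ?thesis
  proof (intro equalityI subsetI)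
    fix e assume "e \<in> {t (omega Y) | Y. Y \<in> ad_eigenspace (H \<gamma>) (- 1)}"
    then obtain c d where cd: "c \<in> mid" "d \<in> mid" and "e = t (omega (wedge (v (- 1)) c + wedge (v (- 2)) d))"
      unfolding V_minus_eq by blast
    then have "e = t (uw (?k *s c) + uw' (?k *s d))" by (simp only: om[OF cd])
    then show "e \<in> E" unfolding E_def using mid_scale cd by blast
  next
    fix e assume "e \<in> E"
    then obtain c d where cd: "c \<in> mid" "d \<in> mid" and e: "e = t (uw c + uw' d)" unfolding E_def by blast
    have "?k *s (inverse ?k *s x) = x" for x :: "complex^8"
      by (simp only: vec.scale_scale right_inverse[OF k] vec.scale_one)
    then have "e = t (omega (wedge (v (- 1)) (inverse ?k *s c) + wedge (v (- 2)) (inverse ?k *s d)))"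
      unfolding e om[OF mid_scale[OF cd(1)] mid_scale[OF cd(2)]] by (simp only:)
    then show "e \<in> {t (omega Y) | Y. Y \<in> ad_eigenspace (H \<gamma>) (- 1)}"
      unfolding V_minus_eq using mid_scale cd by blast
  qed
qed

lemma uw_zero: "uw 0 = 0" "uw' 0 = 0"
  using uw_linear(2)[of 0 0] uw'_linear(2)[of 0 0] by simp_all

lemma csubspace_E: "csubspace M E"
  unfolding csubspace_def
proof (intro conjI ballI allI)
  show "E \<subseteq> carrier M" using t_M by (auto simp: E_def)
  have "\<one>\<^bsub>M\<^esub> = t (uw 0 + uw' 0)" by (simp add: uw_zero t_zero)
  then show "\<one>\<^bsub>M\<^esub> \<in> E" unfolding E_def using mid_zero by blast
  fix e assume "e \<in> E"
  then obtain c d where cd: "c \<in> mid" "d \<in> mid" "e = t (uw c + uw' d)" unfolding E_def by blast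
  show "lact M (uea_const a) e \<in> E" for a
    unfolding cd(3) lact_const_t E_def using mid_scale cd(1,2) by blast
  fix e' assume "e' \<in> E"
  then obtain c' d' where cd': "c' \<in> mid" "d' \<in> mid" "e' = t (uw c' + uw' d')" unfolding E_def by blast
  have "e \<otimes>\<^bsub>M\<^esub> e' = t (uw (c + c') + uw' (d + d'))"
    by (simp add: cd cd' uw_linear uw'_linear add_ac flip: t_add)
  then show "e \<otimes>\<^bsub>M\<^esub> e' \<in> E" unfolding E_def using mid_add cd cd' by blast
qed

lemma cspan_omega: "cspan M {t (omega Y) | Y. Y \<in> ad_eigenspace (H \<gamma>) (- 1)} = E"
  unfolding omega_E cspan_def using csubspace_E by blast

lemma eqv_t: "u \<doteq> w \<Longrightarrow> t u = t w"
  by (simp add: eqv_def t_eq_iff)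

lemma levi_stable:
  assumes Z: "Z \<in> l" and c: "c \<in> mid" and d: "d \<in> mid"
  shows "\<exists>c' d'. c' \<in> mid \<and> d' \<in> mid \<and> uea_of Z * (uw c + uw' d) \<doteq> uw c' + uw' d'"
  using Z
proof (induction rule: l_induct)
  case zero
  show ?case by (rule exI[of _ 0], rule exI[of _ 0]) (simp add: uw_zero mid_zero eqv_refl)
next
  case (add x y)
  then obtain c1 d1 c2 d2 where mem: "c1 \<in> mid" "d1 \<in> mid" "c2 \<in> mid" "d2 \<in> mid"
    and eqs: "uea_of x * (uw c + uw' d) \<doteq> uw c1 + uw' d1" "uea_of y * (uw c + uw' d) \<doteq> uw c2 + uw' d2" by blast
  have "uea_of x * (uw c + uw' d) + uea_of y * (uw c + uw' d) \<doteq> (uw c1 + uw' d1) + (uw c2 + uw' d2)"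
    using eqs by (rule eqv_add)
  then have "uea_of (x + y) * (uw c + uw' d) \<doteq> uw (c1 + c2) + uw' (d1 + d2)"
    by (simp add: uea_of_add distrib_right uw_linear uw'_linear add_ac)
  then show ?case using mid_add mem by blast
next
  case (scale k x)
  then obtain c1 d1 where mem: "c1 \<in> mid" "d1 \<in> mid" and eqs: "uea_of x * (uw c + uw' d) \<doteq> uw c1 + uw' d1" by blast
  have "uea_const k * (uea_of x * (uw c + uw' d)) \<doteq> uea_const k * (uw c1 + uw' d1)"
    using eqs by (rule eqv_mult)
  then have "uea_of (k *\<^sub>C x) * (uw c + uw' d) \<doteq> uw (k *s c1) + uw' (k *s d1)"
    by (simp add: uea_of_cscale mult.assoc uw_linear uw'_linear distrib_left)
  then show ?case using mid_scale mem by blast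
next
  case e11
  have "ue 1 1 * uw c + ue 1 1 * uw' d \<doteq> - 3 * uw c + - 2 * uw' d"
    by (intro eqv_add levi_uw levi_uw' c d)
  then have "uea_of (wedge (v 1) (v (- 1))) * (uw c + uw' d) \<doteq> uw (- 3 *s c) + uw' (- 2 *s d)"
    by (simp only: ue_def distrib_left uw_linear uw'_linear uw_zero uea_const_minus uea_const_numeral uea_const_1 mult_minus_left mult_1_left add_0_left add_0_right)
  then show ?case using mid_scale mid_zero c d by blast
next
  case e22
  have "ue 2 2 * uw c + ue 2 2 * uw' d \<doteq> - 2 * uw c + - 3 * uw' d"
    by (intro eqv_add levi_uw levi_uw' c d)
  then have "uea_of (wedge (v 2) (v (- 2))) * (uw c + uw' d) \<doteq> uw (- 2 *s c) + uw' (- 3 *s d)"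
    by (simp only: ue_def distrib_left uw_linear uw'_linear uw_zero uea_const_minus uea_const_numeral uea_const_1 mult_minus_left mult_1_left add_0_left add_0_right)
  then show ?case using mid_scale mid_zero c d by blast
next
  case e12
  have "ue 1 2 * uw c + ue 1 2 * uw' d \<doteq> - uw' c + 0"
    by (intro eqv_add levi_uw levi_uw' c d)
  then have "uea_of (wedge (v 1) (v (- 2))) * (uw c + uw' d) \<doteq> uw 0 + uw' ((- 1) *s c)"
    by (simp only: ue_def distrib_left uw_linear uw'_linear uw_zero uea_const_minus uea_const_numeral uea_const_1 mult_minus_left mult_1_left add_0_left add_0_right)
  then show ?case using mid_scale mid_zero c d by blast
next
  case e21
  have "ue 2 1 * uw c + ue 2 1 * uw' d \<doteq> 0 + - uw d"
    by (intro eqv_add levi_uw levi_uw' c d)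
  then have "uea_of (wedge (v 2) (v (- 1))) * (uw c + uw' d) \<doteq> uw ((- 1) *s d) + uw' 0"
    by (simp only: ue_def distrib_left uw_linear uw'_linear uw_zero uea_const_minus uea_const_numeral uea_const_1 mult_minus_left mult_1_left add_0_left add_0_right)
  then show ?case using mid_scale mid_zero c d by blast
next
  case (mid a b)
  have "ur a b * uw c + ur a b * uw' d \<doteq> uw (bil b c *s a - bil a c *s b) + uw' (bil b d *s a - bil a d *s b)"
    by (intro eqv_add ur_uw mid c d)
  moreover have "bil b x *s a - bil a x *s b \<in> mid" for x by (intro mid_diff mid_scale mid)
  ultimately show ?case unfolding ur_def[symmetric] distrib_left by blast
qed

lemma nil_kills:
  assumes x: "x \<in> n" and c: "c \<in> mid" and d: "d \<in> mid"
  shows "uea_of x * (uw c + uw' d) \<in> J"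
  using x
proof (induction rule: n_induct)
  case zero
  show ?case by (simp add: J_zero)
next
  case (add x y)
  then show ?case by (simp add: uea_of_add distrib_right J_add)
next
  case (scale k x)
  then show ?case by (simp add: uea_of_cscale mult.assoc J_mult)
next
  case (first d')
  then show ?case using ux_uw[of d' c] ux_uw'[of d' d] c d by (simp add: ux_def distrib_left J_add)
next
  case (second d')
  then show ?case using uy_uw[of d' c] uy_uw'[of d' d] c d by (simp add: uy_def distrib_left J_add)
next
  case top
  have m: "v 3 \<in> mid" "v (- 3) \<in> mid" by (rule v_mid; simp add: mid_indices_def)+
  have "bil (v 3) (v (- 3)) = 1" by (simp add: bil_v signed_indices_def)
  then have "uea_of (wedge (v 1) (v 2)) = uy (v (- 3)) * ux (v 3) - ux (v 3) * uy (v (- 3))"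
    unfolding ux_def uy_def using wedge_commute[of "v 2" "v 1"]
    by (subst (2) bracket) (simp add: bil_v_concrete mid_bil m uea_of_minus)
  then have "uea_of (wedge (v 1) (v 2)) * (uw c + uw' d)
     = uy (v (- 3)) * (ux (v 3) * uw c + ux (v 3) * uw' d) + - (ux (v 3) * (uy (v (- 3)) * uw c + uy (v (- 3)) * uw' d))"
    by (simp only:) (simp add: algebra_simps)
  also have "\<dots> \<in> J"
    by (intro J_add J_uminus J_mult ux_uw ux_uw' uy_uw uy_uw' c d m)
  finally show ?case .
qed

lemma submodule_l: "x \<in> l \<Longrightarrow> e \<in> E \<Longrightarrow> lact M (uea_of x) e \<in> E"
proof -
  assume x: "x \<in> l" and "e \<in> E"
  then obtain c d where cd: "c \<in> mid" "d \<in> mid" "e = t (uw c + uw' d)" unfolding E_def by blast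
  obtain c' d' where "c' \<in> mid" "d' \<in> mid" "uea_of x * (uw c + uw' d) \<doteq> uw c' + uw' d'"
    using levi_stable[OF x cd(1,2)] by blast
  then show ?thesis unfolding cd(3) t_lact E_def using eqv_t by blast
qed

lemma trivial_n: "x \<in> n \<Longrightarrow> e \<in> E \<Longrightarrow> lact M (uea_of x) e = \<one>\<^bsub>M\<^esub>"
proof -
  assume x: "x \<in> n" and "e \<in> E"
  then obtain c d where cd: "c \<in> mid" "d \<in> mid" "e = t (uw c + uw' d)" unfolding E_def by blast
  then show ?thesis using nil_kills[OF x cd(1,2)] by (simp add: t_lact J_def)
qed

lemma lact_add_left: "e \<in> E \<Longrightarrow> lact M (u + w) e = lact M u e \<otimes>\<^bsub>M\<^esub> lact M w e"
  and lact_mult_left: "e \<in> E \<Longrightarrow> lact M (u * w) e = lact M u (lact M w e)"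
proof -
  assume "e \<in> E"
  then obtain r where e: "e = t r" unfolding E_def by blast
  show "lact M (u + w) e = lact M u e \<otimes>\<^bsub>M\<^esub> lact M w e"
    "lact M (u * w) e = lact M u (lact M w e)"
    unfolding e t_lact by (simp_all add: distrib_right t_add mult.assoc)
qed

lemma submodule_q: "lie_submodule q M E"
  unfolding lie_submodule_def
proof (intro conjI ballI csubspace_E)
  fix x e assume x: "x \<in> q" and e: "e \<in> E"
  obtain y z where yz: "x = y + z" "y \<in> l" "z \<in> n" using q_cases[OF x] by blast
  have "\<one>\<^bsub>M\<^esub> \<in> E" using csubspace_E by (simp add: csubspace_def)
  then show "lact M (uea_of x) e \<in> E"
    using submodule_l[OF yz(2) e] trivial_n[OF yz(3) e] csubspace_E
    by (simp add: yz(1) uea_of_add lact_add_left[OF e] csubspace_def)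
qed

text \<open>Two successive rotations turn a non-zero vector into a multiple of some basis vector, and further
  rotations carry it to the other basis vectors. At most two rotations are needed from \<open>v p\<close> to \<open>v (- p)\<close>.\<close>

lemma mid_irreducible:
  assumes R: "R \<subseteq> mid" and scale: "\<And>k r. r \<in> R \<Longrightarrow> k *s r \<in> R" and add: "\<And>r r'. r \<in> R \<Longrightarrow> r' \<in> R \<Longrightarrow> r + r' \<in> R"
    and rot: "\<And>a b r. a \<in> mid \<Longrightarrow> b \<in> mid \<Longrightarrow> r \<in> R \<Longrightarrow> bil b r *s a - bil a r *s b \<in> R"
    and r: "r \<in> R" "r \<noteq> 0"
  shows "mid \<subseteq> R"
proof -
  have step: "v p \<in> R" if s: "v s \<in> R" "s \<in> mid_indices" and p: "p \<in> mid_indices" "p \<noteq> - s" for s p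
  proof -
    have "bil (v (- s)) (v s) *s v p - bil (v p) (v s) *s v (- s) \<in> R"
      by (rule rot[OF v_mid[OF p(1)] v_uminus_mid[OF s(2)] s(1)])
    moreover have "bil (v p) (v s) = 0" using p s by (simp add: bil_v mid_signed)
    ultimately show ?thesis by (simp add: bil_v_mid[OF s(2)])
  qed
  have "\<exists>s\<in>mid_indices. bil r (v (- s)) \<noteq> 0"
  proof (rule ccontr)
    assume "\<not> ?thesis"
    then have "r = 0" using mid_expand[of r] r(1) R by auto
    then show False using r(2) by simp
  qed
  then obtain s where s: "s \<in> mid_indices" "bil r (v (- s)) \<noteq> 0" by blast
  obtain p where p: "p \<in> mid_indices" "p \<noteq> s" "p \<noteq> - s" by (rule other_mid_index)
  let ?c = "bil (v (- s)) r"
  let ?r = "?c *s v p - bil (v p) r *s v (- s)"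
  have c: "?c \<noteq> 0" using s by (simp add: bil_commute)
  have "?r \<in> R" by (rule rot[OF v_mid[OF p(1)] v_uminus_mid[OF s(1)] r(1)])
  then have "bil (v (- p)) ?r *s v p - bil (v p) ?r *s v (- p) \<in> R"
    by (rule rot[OF v_mid[OF p(1)] v_uminus_mid[OF p(1)]])
  moreover have I: "p \<in> signed_indices" "s \<in> signed_indices" "- s \<in> signed_indices" "- p \<in> signed_indices"
    using p s mid_signed by (simp_all add: signed_uminus)
  then have "bil (v (- p)) (v (- s)) = 0" "bil (v p) (v (- s)) = 0" "bil (v p) (v p) = 0"
    using p signed_nonzero[OF I(1)] by (simp_all add: bil_v)
  then have "bil (v (- p)) ?r = ?c" "bil (v p) ?r = 0"
    using bil_v_mid[OF p(1)] by (simp_all add: bil_simps)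
  ultimately have "?c *s v p \<in> R" by simp
  from scale[OF this, of "inverse ?c"] have vp: "v p \<in> R" using c by simp
  have all: "v m \<in> R" if m: "m \<in> mid_indices" for m
  proof (cases "m = - p")
    case False
    then show ?thesis using step[OF vp p(1) m] by simp
  next
    case True
    have "v s \<in> R" using step[OF vp p(1) s(1)] p by auto
    then show ?thesis using step[of s m] s(1) m p True by auto
  qed
  show ?thesis
  proof
    fix d assume "d \<in> mid"
    then show "d \<in> R" by (induction rule: mid_induct) (auto intro: all add scale)
  qed
qed

text \<open>A non-zero stable subspace contains a non-zero vector of the first row, because \<open>ue 2 1\<close> maps the
  second row injectively to the first and kills the latter; rotations then give the whole first row and
  \<open>ue 1 2\<close> the second.\<close>

lemma irreducible_l: "lie_irreducible l M E"
  unfolding lie_irreducible_def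
proof (intro conjI allI impI)
  interpret M: comm_group M by (rule comm_group_M)
  show sub: "lie_submodule l M E"
    using submodule_q l_subset_q unfolding lie_submodule_def by blast
  have "t (uw (v 3) + uw' 0) \<in> E" unfolding E_def using v_mid[of 3] mid_zero by (auto simp: mid_indices_def)
  moreover have "t (uw (v 3) + uw' 0) \<noteq> \<one>\<^bsub>M\<^esub>" using uw_not_J by (simp add: uw_zero J_def)
  ultimately show "E \<noteq> {\<one>\<^bsub>M\<^esub>}" by blast
  fix W assume W: "W \<subseteq> E \<and> lie_submodule l M W"
  show "W = {\<one>\<^bsub>M\<^esub>} \<or> W = E"
  proof (rule disjCI)
    assume "W \<noteq> E"
    show "W = {\<one>\<^bsub>M\<^esub>}"
    proof (rule ccontr)
      assume W1: "W \<noteq> {\<one>\<^bsub>M\<^esub>}"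
      have cs: "csubspace M W" and stable: "\<And>x w. x \<in> l \<Longrightarrow> w \<in> W \<Longrightarrow> lact M (uea_of x) w \<in> W"
        using W unfolding lie_submodule_def by blast+
      have W_add: "t (u + w) \<in> W" if "t u \<in> W" "t w \<in> W" for u w
        using that cs unfolding csubspace_def t_add by blast
      have W_scale: "t (uea_const k * u) \<in> W" if "t u \<in> W" for k u
        using that cs unfolding csubspace_def t_lact[symmetric] by blast
      have W_act: "t (uea_of x * u) \<in> W" if "x \<in> l" "t u \<in> W" for x u
        using stable[OF that] unfolding t_lact .
      have W_minus: "t (- u) \<in> W" if "t u \<in> W" for u
        using W_scale[OF that, of "- 1"] by (simp add: uea_const_minus)
      obtain e where e: "e \<in> W" "e \<noteq> \<one>\<^bsub>M\<^esub>" using W1 cs unfolding csubspace_def by blast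
      then obtain c d where cd: "c \<in> mid" "d \<in> mid" "e = t (uw c + uw' d)"
        using W unfolding E_def by blast
      have "\<exists>r\<in>mid. r \<noteq> 0 \<and> t (uw r) \<in> W"
      proof (cases "d = 0")
        case True
        then have "e = t (uw c)" using cd by (simp add: uw_zero)
        moreover have "c \<noteq> 0" using e(2) calculation by (auto simp: uw_zero t_zero)
        ultimately show ?thesis using e(1) cd(1) by blast
      next
        case False
        have "ue 2 1 * uw c + ue 2 1 * uw' d \<doteq> 0 + - uw d"
          by (intro eqv_add levi_uw levi_uw' cd)
        then have "t (ue 2 1 * (uw c + uw' d)) = t (- uw d)" by (simp add: distrib_left eqv_t)
        moreover have "t (ue 2 1 * (uw c + uw' d)) \<in> W"
          unfolding ue_def using W_act[OF levi_elements(3)] e(1) cd(3) by blast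
        ultimately have "t (- (- uw d)) \<in> W" using W_minus by metis
        then show ?thesis using False cd(2) by auto
      qed
      then obtain r where r: "r \<in> mid" "r \<noteq> 0" "t (uw r) \<in> W" by blast
      have "mid \<subseteq> {r \<in> mid. t (uw r) \<in> W}"
      proof (rule mid_irreducible)
        show "r \<in> {r \<in> mid. t (uw r) \<in> W}" "r \<noteq> 0" using r by simp_all
        fix a b r assume ab: "a \<in> mid" "b \<in> mid" and r: "r \<in> {r \<in> mid. t (uw r) \<in> W}"
        have "t (ur a b * uw r) \<in> W" unfolding ur_def using W_act[OF levi_elements(5)[OF ab]] r by blast
        moreover have "t (ur a b * uw r) = t (uw (bil b r *s a - bil a r *s b))"
          using r by (intro eqv_t ur_uw ab) blast
        ultimately show "bil b r *s a - bil a r *s b \<in> {r \<in> mid. t (uw r) \<in> W}"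
          using ab by (simp add: mid_diff mid_scale)
      qed (auto simp: mid_scale mid_add uw_linear intro: W_scale W_add)
      then have first: "t (uw c) \<in> W" if "c \<in> mid" for c using that by blast
      have second: "t (uw' c) \<in> W" if "c \<in> mid" for c
      proof -
        have "t (ue 1 2 * uw c) \<in> W" unfolding ue_def by (intro W_act levi_elements first that)
        then have "t (- uw' c) \<in> W" using eqv_t[OF levi_uw(4)[OF that]] by simp
        then show ?thesis using W_minus by fastforce
      qed
      have "E \<subseteq> W" unfolding E_def using first second W_add by blast
      then show False using W \<open>W \<noteq> E\<close> by blast
    qed
  qed
qed

lemma sub_stable: "s \<in> uea_sub q \<Longrightarrow> e \<in> E \<Longrightarrow> lact M s e \<in> E"
proof (induction arbitrary: e rule: uea_sub.induct)
  case (sub_const c)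
  then show ?case using csubspace_E unfolding csubspace_def by blast
next
  case (sub_gen x)
  then show ?case using submodule_q unfolding lie_submodule_def by blast
next
  case (sub_add u w)
  then show ?case using csubspace_E unfolding csubspace_def by (simp add: lact_add_left)
next
  case (sub_mult u w)
  then show ?case by (simp add: lact_mult_left)
qed

lemma E_M: "e \<in> E \<Longrightarrow> e \<in> carrier M"
  using csubspace_E by (auto simp: csubspace_def)

lemma homomorphism:
  defines "ME \<equiv> M\<lparr>carrier := E\<rparr>"
  shows "\<exists>\<phi> \<in> lmodule_hom (ext_scalars (uea_sub q) ME) M.
     (\<exists>m \<in> carrier (ext_scalars (uea_sub q) ME). \<phi> m \<noteq> \<one>\<^bsub>M\<^esub>) \<and>
     (\<forall>u. \<forall>e\<in>E. \<phi> (tensor_elt (uea_sub q) ME u e) = lact M u e)"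
proof -
  interpret ext: scalar_extension "uea_sub q" ME
    using csubspace_E sub_stable by unfold_locales (auto simp: ME_def csubspace_def)
  obtain \<phi> where \<phi>: "\<phi> \<in> hom ext.T M" "\<And>u e. e \<in> carrier ME \<Longrightarrow> \<phi> (tensor_elt (uea_sub q) ME u e) = lact M u e"
  proof (rule ext.universal[OF comm_group_M, of "\<lambda>u e. lact M u e"])
    show "lact M u e \<in> carrier M" if "e \<in> carrier ME" for u e
      using that scal.lact_T E_M by (simp add: ME_def M_def[symmetric])
    show "lact M (u + u') e = lact M u e \<otimes>\<^bsub>M\<^esub> lact M u' e" if "e \<in> carrier ME" for u u' e
      using that by (simp add: ME_def lact_add_left)
    show "lact M u (e \<otimes>\<^bsub>ME\<^esub> e') = lact M u e \<otimes>\<^bsub>M\<^esub> lact M u e'" if "e \<in> carrier ME" "e' \<in> carrier ME" for u e e'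
      using that scal.lact_mult[folded M_def] E_M by (simp add: ME_def)
    show "lact M (u * s) e = lact M u (lact ME s e)" if "s \<in> uea_sub q" "e \<in> carrier ME" for u s e
      using that by (simp add: ME_def lact_mult_left)
  qed blast
  have "\<phi> (lact ext.T r m) = lact M r (\<phi> m)" if m: "m \<in> carrier ext.T" for r m
  proof -
    have "(\<phi> \<circ> lact ext.T r) m = (lact M r \<circ> \<phi>) m"
    proof (rule ext.hom_eqI[OF comm_group_M _ _ _ m])
      show "\<phi> \<circ> lact ext.T r \<in> hom ext.T M"
        by (rule hom_compose[OF ext.lact_hom \<phi>(1)])
      show "lact M r \<circ> \<phi> \<in> hom ext.T M"
        by (rule hom_compose[OF \<phi>(1) scal.lact_hom[folded M_def]])
      fix u e assume e: "e \<in> carrier ME"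
      then show "(\<phi> \<circ> lact ext.T r) (tensor_elt (uea_sub q) ME u e) = (lact M r \<circ> \<phi>) (tensor_elt (uea_sub q) ME u e)"
        by (simp add: ext.lact_tensor \<phi>(2)) (simp add: ME_def lact_mult_left)
    qed
    then show ?thesis by simp
  qed
  then have hom: "\<phi> \<in> lmodule_hom ext.T M" using \<phi>(1) by (simp add: lmodule_hom_def)
  obtain e where e: "e \<in> E" "e \<noteq> \<one>\<^bsub>M\<^esub>"
    using irreducible_l csubspace_E unfolding lie_irreducible_def csubspace_def by blast
  have "lact M 1 e = e" using e(1) by (auto simp: E_def t_lact)
  then have "\<phi> (tensor_elt (uea_sub q) ME 1 e) \<noteq> \<one>\<^bsub>M\<^esub>" using \<phi>(2)[of e 1] e by (simp add: ME_def)
  moreover have "tensor_elt (uea_sub q) ME 1 e \<in> carrier ext.T"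
    using e(1) by (intro ext.tensor_elt_T) (simp add: ME_def)
  ultimately show ?thesis using hom \<phi>(2) by (intro bexI[of _ \<phi>] conjI) (auto simp: ME_def)
qed

end

theorem mainTheorem2:
  fixes h l n q Vplus Vminus :: "so8 set"
    and P \<Theta> DV :: "(so8 \<Rightarrow> complex) set"
    and \<gamma> d\<chi> :: "so8 \<Rightarrow> complex"
    and B :: "so8 \<Rightarrow> so8 \<Rightarrow> complex"
    and X H :: "(so8 \<Rightarrow> complex) \<Rightarrow> so8"
    and N :: "(so8 \<Rightarrow> complex) \<Rightarrow> (so8 \<Rightarrow> complex) \<Rightarrow> complex"
    and Mc :: "(so8 \<Rightarrow> complex) \<Rightarrow> (so8 \<Rightarrow> complex) \<Rightarrow> so8 \<Rightarrow> complex"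
    and u2 :: "so8 \<Rightarrow> so8 uea"
  assumes cartan: "cartan_subalgebra h"
    and pos: "positive_system h P"
    and high: "highest_root h P \<gamma>"
    and form: "\<exists>c::real. c > 0 \<and> (\<forall>x y. B x y = complex_of_real c * killing_form x y)"
    and root_vectors: "normalized_root_vectors B h P X H"
    and \<Theta>: "\<Theta> = {\<alpha> \<in> simple_roots P. dual_form B h \<alpha> \<gamma> = 0}"
    and l: "l = std_levi h \<Theta>"
    and n: "n = std_nilradical h P \<Theta>"
    and q: "q = std_parabolic h P \<Theta>"
    and Vplus: "Vplus = ad_eigenspace (H \<gamma>) 1"
    and Vminus: "Vminus = ad_eigenspace (H \<gamma>) (- 1)"
    and DV: "DV = {\<alpha> \<in> roots h. root_space h \<alpha> \<subseteq> Vplus}"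
    and d\<chi>_add: "\<forall>x\<in>q. \<forall>y\<in>q. d\<chi> (x + y) = d\<chi> x + d\<chi> y"
    and d\<chi>_scale: "\<forall>c. \<forall>x\<in>q. d\<chi> (c *\<^sub>C x) = c * d\<chi> x"
    and d\<chi>_levi: "\<forall>Z\<in>l. lie Z (X \<gamma>) = d\<chi> Z *\<^sub>C X \<gamma>"
    and d\<chi>_nil: "\<forall>x\<in>n. d\<chi> x = 0"
    and N: "\<forall>\<beta>\<in>DV. lie (X \<beta>) (X (\<gamma> - \<beta>)) = N \<beta> (\<gamma> - \<beta>) *\<^sub>C X \<gamma>"
    and Mc: "\<forall>Z\<in>l. \<forall>\<alpha>\<in>DV. lie Z (X \<alpha>) = (\<Sum>\<beta>\<in>DV. Mc \<alpha> \<beta> Z *\<^sub>C X \<beta>)"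
    and u2_add: "\<forall>x\<in>l. \<forall>y\<in>l. u2 (x + y) = u2 x + u2 y"
    and u2_scale: "\<forall>c. \<forall>x\<in>l. u2 (c *\<^sub>C x) = uea_const c * u2 x"
    and u2_H: "u2 (H \<gamma>) = 0"
    and u2_derived: "\<forall>Z\<in>derived_algebra l. u2 Z =
      uea_const (- 1 / 2) * (\<Sum>\<alpha>\<in>DV. \<Sum>\<beta>\<in>DV.
        uea_const (N \<beta> (\<gamma> - \<beta>) * Mc \<alpha> (\<gamma> - \<beta>) Z) * uea_of (X (- \<alpha>)) * uea_of (X (- \<beta>)))"
    and C: "C = one_dim_module q (\<lambda>x. - d\<chi> x)"
    and M: "M = ext_scalars (uea_sub q) C"
    and \<omega>\<^sub>3: "\<omega>\<^sub>3 = (\<lambda>Y. tensor_elt (uea_sub q) C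
                   (\<Sum>\<epsilon>\<in>DV. uea_of (X (- \<epsilon>)) * u2 (lie (X \<epsilon>) Y)) 1)"
    and E: "E = cspan M (\<omega>\<^sub>3 ` Vminus)"
    and ME: "ME = M\<lparr>carrier := E\<rparr>"
  shows "lie_submodule q M E \<and>
         lie_irreducible l M E \<and>
         (\<forall>x\<in>n. \<forall>e\<in>E. lact M (uea_of x) e = \<one>\<^bsub>M\<^esub>) \<and>
         (\<exists>\<phi> \<in> lmodule_hom (ext_scalars (uea_sub q) ME) M.
           (\<exists>t \<in> carrier (ext_scalars (uea_sub q) ME). \<phi> t \<noteq> \<one>\<^bsub>M\<^esub>) \<and>
           (\<forall>u. \<forall>Y\<in>Vminus. \<phi> (tensor_elt (uea_sub q) ME u (\<omega>\<^sub>3 Y)) = lact M u (\<omega>\<^sub>3 Y)))"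
proof -
  obtain v\<^sub>0 where v\<^sub>0: "cartan_basis v\<^sub>0 h" using witt_basis_exists[OF cartan] by blast
  have "\<gamma> \<in> roots h" using high by (simp add: highest_root_def)
  then obtain v where v: "cartan_basis v h" "\<gamma> = cartan_basis.eps v h 1 + cartan_basis.eps v h 2"
    using relabelled_basis[OF v\<^sub>0] by blast
  interpret cartan_basis v h by (rule v(1))
  interpret V: verma_setting v h P B X H \<gamma> \<Theta> l n q DV N Mc u2 d\<chi>
    by unfold_locales (fact assms v DV[unfolded Vplus])+
  have M': "M = V.M" and C': "C = V.C" unfolding M C V.M_def V.C_def by (rule refl)+
  have \<omega>': "\<omega>\<^sub>3 Y = V.t (V.omega Y)" for Y
    by (simp add: \<omega>\<^sub>3 V.t_def V.omega_def C')
  have "\<omega>\<^sub>3 ` Vminus = {V.t (V.omega Y) | Y. Y \<in> ad_eigenspace (H \<gamma>) (- 1)}"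
    by (auto simp: \<omega>' Vminus)
  then have E': "E = V.E" unfolding E M' by (simp only: V.cspan_omega)
  have mem: "\<omega>\<^sub>3 Y \<in> V.E" if "Y \<in> Vminus" for Y
    using that V.omega_E by (auto simp: \<omega>' Vminus)
  show ?thesis
    unfolding ME E' M'
  proof (intro conjI ballI)
    obtain \<phi> where \<phi>: "\<phi> \<in> lmodule_hom (ext_scalars (uea_sub q) (V.M\<lparr>carrier := V.E\<rparr>)) V.M"
      "\<exists>m \<in> carrier (ext_scalars (uea_sub q) (V.M\<lparr>carrier := V.E\<rparr>)). \<phi> m \<noteq> \<one>\<^bsub>V.M\<^esub>"
      "\<And>u e. e \<in> V.E \<Longrightarrow> \<phi> (tensor_elt (uea_sub q) (V.M\<lparr>carrier := V.E\<rparr>) u e) = lact V.M u e"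
      using V.homomorphism by blast
    show "\<exists>\<phi> \<in> lmodule_hom (ext_scalars (uea_sub q) (V.M\<lparr>carrier := V.E\<rparr>)) V.M.
       (\<exists>t \<in> carrier (ext_scalars (uea_sub q) (V.M\<lparr>carrier := V.E\<rparr>)). \<phi> t \<noteq> \<one>\<^bsub>V.M\<^esub>) \<and>
       (\<forall>u. \<forall>Y\<in>Vminus. \<phi> (tensor_elt (uea_sub q) (V.M\<lparr>carrier := V.E\<rparr>) u (\<omega>\<^sub>3 Y)) = lact V.M u (\<omega>\<^sub>3 Y))"
      using \<phi> mem by (intro bexI[OF _ \<phi>(1)] conjI allI ballI) simp_all
  qed (fact V.submodule_q V.irreducible_l V.trivial_n)+
qed

end
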